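(* Let $G$ be a finite group. Every smooth $G$-manifold is fibrant in the geometric model structure on $\mathsf{isvt\text{-}Top}$; equivalently, for every smooth $G$-manifold $M$, every $n\geq 0$ and every strictly increasing chain $\mathbf H$ of subgroups of $G$, every isovariant map $\big(I\times D^n\times\partial\Delta^{\mathbf H}_G\big)\cup_{\{0\}\times D^n\times\partial\Delta^{\mathbf H}_G}\big(\{0\}\times D^n\times\Delta^{\mathbf H}_G\big)\to M$ extends to an isovariant map $I\times D^n\times\Delta^{\mathbf H}_G\to M$.
   Context: $\mathsf{isvt\text{-}Top}$ is the category of $G$-spaces (compactly generated spaces with continuous left $G$-action) and isovariant maps (equivariant $f$ with $G_{f(x)}=G_x$ for all $x$), with a formally adjoined terminal object $T$; $\mathsf{Map_{isvt}}(X,Y)$ is the space of isovariant maps. $I=[0,1]$ and $D^n$ carry trivial actions. For a strictly increasing chain of subgroups $\mathbf{H}=H_0<\cdots<H_m$, the linking simplex $\Delta^{\mathbf H}_G$ is the quotient of $G\times\Delta^m$ by $(g,x)\sim(g',x)$ iff $gH_k=g'H_k$, where $k$ is largest with $x=(t_0,\dots,t_{m-k},0,\dots,0)$, with left $G$-action on the $G$ factor; $\partial\Delta^{\mathbf H}_G$ is the image of $G\times\partial\Delta^m$ and $b^{\mathbf H}$ its inclusion. With $s_{j-1}:S^{j-1}\to D^j$, $i_0:\{0\}\to[0,1]$ and $\Box$ the pushout-product, the geometric model structure is the cofibrantly generated model structure with generating cofibrations $\{s_{j-1}\Box b^{\mathbf H}\}$, generating acyclic cofibrations $\{s_{j-1}\Box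 b^{\mathbf H}\Box i_0\}$, and weak equivalences the maps $f$ with $\mathsf{Map_{isvt}}(\Delta^{\mathbf H}_G,f)$ a weak homotopy equivalence for all chains $\mathbf H$. An object $X$ is fibrant if $X\to T$ is a fibration. *)

theory Defs
  imports "HOL-Analysis.Analysis" "HOL-Homology.Simplices" "HOL-Algebra.Group_Action" "HOL-Algebra.Coset"
begin

text \<open>Iterated partial derivatives of a real-valued function on R^d
  (points of R^d are functions nat => real vanishing from index d on).
  The list i # is means: first the partial derivatives listed in is, then the i-th one.\<close>
fun iter_partial :: "nat list \<Rightarrow> ((nat \<Rightarrow> real) \<Rightarrow> real) \<Rightarrow> (nat \<Rightarrow> real) \<Rightarrow> real" where
  "iter_partial [] f = f"
| "iter_partial (i # is) f = (\<lambda>x. deriv (\<lambda>h. iter_partial is f (x(i := x i + h))) 0)"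

definition smooth_real_on :: "nat \<Rightarrow> (nat \<Rightarrow> real) set \<Rightarrow> ((nat \<Rightarrow> real) \<Rightarrow> real) \<Rightarrow> bool" where
  "smooth_real_on d U f \<longleftrightarrow>
     (\<forall>is. set is \<subseteq> {..<d} \<longrightarrow>
        continuous_map (subtopology (Euclidean_space d) U) euclideanreal (iter_partial is f) \<and>
        (\<forall>i<d. \<forall>x\<in>U. (\<lambda>h. iter_partial is f (x(i := x i + h))) differentiable (at 0)))"

definition smooth_map_on :: "nat \<Rightarrow> (nat \<Rightarrow> real) set \<Rightarrow> ((nat \<Rightarrow> real) \<Rightarrow> (nat \<Rightarrow> real)) \<Rightarrow> bool" where
  "smooth_map_on d U F \<longleftrightarrow> (\<forall>j<d. smooth_real_on d U (\<lambda>x. F x j))"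

definition smooth_atlas :: "nat \<Rightarrow> 'm topology \<Rightarrow> ('m set \<times> ('m \<Rightarrow> nat \<Rightarrow> real)) set \<Rightarrow> bool" where
  "smooth_atlas d M A \<longleftrightarrow>
     \<Union>(fst ` A) = topspace M \<and>
     (\<forall>(U, \<phi>)\<in>A. openin M U \<and> openin (Euclidean_space d) (\<phi> ` U) \<and>
         homeomorphic_map (subtopology M U) (subtopology (Euclidean_space d) (\<phi> ` U)) \<phi>) \<and>
     (\<forall>(U, \<phi>)\<in>A. \<forall>(V, \<psi>)\<in>A. smooth_map_on d (\<psi> ` (U \<inter> V)) (\<phi> \<circ> inv_into V \<psi>))"

definition smooth_G_manifold ::
  "('g, 'b) monoid_scheme \<Rightarrow> ('g \<Rightarrow> 'm \<Rightarrow> 'm) \<Rightarrow> nat \<Rightarrow> 'm topology \<Rightarrow> bool" where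
  "smooth_G_manifold G act d M \<longleftrightarrow>
     Hausdorff_space M \<and> second_countable M \<and>
     group_action G (topspace M) act \<and>
     (\<forall>g\<in>carrier G. continuous_map M M (act g)) \<and>
     (\<exists>A. smooth_atlas d M A \<and>
        (\<forall>g\<in>carrier G. \<forall>(U, \<phi>)\<in>A. \<forall>(V, \<psi>)\<in>A.
           smooth_map_on d (\<psi> ` (V \<inter> {y \<in> topspace M. act g y \<in> U})) (\<phi> \<circ> act g \<circ> inv_into V \<psi>)))"

definition quotient_topology :: "'a topology \<Rightarrow> ('a \<Rightarrow> 'b) \<Rightarrow> 'b topology" where
  "quotient_topology X q =
     topology (\<lambda>U. U \<subseteq> q ` topspace X \<and> openin X {x \<in> topspace X. q x \<in> U})"

definition link_index :: "nat \<Rightarrow> (nat \<Rightarrow> real) \<Rightarrow> nat" where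
  "link_index m x = (GREATEST k. k \<le> m \<and> (\<forall>i. m - k < i \<and> i \<le> m \<longrightarrow> x i = 0))"

text \<open>A chain H_0 < ... < H_m is the list Hs = [H_0,...,H_m], so m = length Hs - 1.
  The class of (g,x) is represented by the pair (g H_k, x).\<close>
definition link_quot :: "('g, 'b) monoid_scheme \<Rightarrow> 'g set list \<Rightarrow> 'g \<times> (nat \<Rightarrow> real) \<Rightarrow> 'g set \<times> (nat \<Rightarrow> real)" where
  "link_quot G Hs = (\<lambda>(g, x). (g <#\<^bsub>G\<^esub> (Hs ! link_index (length Hs - 1) x), x))"

definition linking_simplex :: "('g, 'b) monoid_scheme \<Rightarrow> 'g set list \<Rightarrow> ('g set \<times> (nat \<Rightarrow> real)) topology" where
  "linking_simplex G Hs =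
     quotient_topology
       (prod_topology (discrete_topology (carrier G))
          (subtopology (powertop_real UNIV) (standard_simplex (length Hs - 1))))
       (link_quot G Hs)"

definition link_boundary :: "('g, 'b) monoid_scheme \<Rightarrow> 'g set list \<Rightarrow> ('g set \<times> (nat \<Rightarrow> real)) set" where
  "link_boundary G Hs =
     {p \<in> topspace (linking_simplex G Hs). \<exists>i \<le> length Hs - 1. snd p i = 0}"

definition link_act :: "('g, 'b) monoid_scheme \<Rightarrow> 'g \<Rightarrow> 'g set \<times> (nat \<Rightarrow> real) \<Rightarrow> 'g set \<times> (nat \<Rightarrow> real)" where
  "link_act G g = (\<lambda>(C, x). (g <#\<^bsub>G\<^esub> C, x))"

definition disc :: "nat \<Rightarrow> (nat \<Rightarrow> real) set" where
  "disc n = {x. (\<forall>i\<ge>n. x i = 0) \<and> (\<Sum>i<n. (x i)\<^sup>2) \<le> 1}"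

definition cyl :: "('g, 'b) monoid_scheme \<Rightarrow> nat \<Rightarrow> 'g set list \<Rightarrow>
    (real \<times> (nat \<Rightarrow> real) \<times> ('g set \<times> (nat \<Rightarrow> real))) topology" where
  "cyl G n Hs =
     prod_topology (top_of_set {0..1})
       (prod_topology (subtopology (Euclidean_space n) (disc n)) (linking_simplex G Hs))"

text \<open>(I x D^n x boundary) union ({0} x D^n x Delta^H_G), as a subspace of the cylinder
  (this is the pushout, all spaces being compact Hausdorff and the maps closed inclusions).\<close>
definition horn :: "('g, 'b) monoid_scheme \<Rightarrow> nat \<Rightarrow> 'g set list \<Rightarrow>
    (real \<times> (nat \<Rightarrow> real) \<times> ('g set \<times> (nat \<Rightarrow> real))) set" where
  "horn G n Hs = {(t, v, p) \<in> topspace (cyl G n Hs). p \<in> link_boundary G Hs \<or> t = 0}"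

definition cyl_act :: "('g, 'b) monoid_scheme \<Rightarrow> 'g \<Rightarrow>
    real \<times> (nat \<Rightarrow> real) \<times> ('g set \<times> (nat \<Rightarrow> real)) \<Rightarrow>
    real \<times> (nat \<Rightarrow> real) \<times> ('g set \<times> (nat \<Rightarrow> real))" where
  "cyl_act G g = (\<lambda>(t, v, p). (t, v, link_act G g p))"

definition isovariant_map ::
  "('g, 'b) monoid_scheme \<Rightarrow> 'x topology \<Rightarrow> ('g \<Rightarrow> 'x \<Rightarrow> 'x) \<Rightarrow>
   'y topology \<Rightarrow> ('g \<Rightarrow> 'y \<Rightarrow> 'y) \<Rightarrow> ('x \<Rightarrow> 'y) \<Rightarrow> bool" where
  "isovariant_map G X actX Y actY f \<longleftrightarrow>
     continuous_map X Y f \<and>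
     (\<forall>g\<in>carrier G. \<forall>x\<in>topspace X. f (actX g x) = actY g (f x)) \<and>
     (\<forall>x\<in>topspace X. {g \<in> carrier G. actX g x = x} = {g \<in> carrier G. actY g (f x) = f x})"

end

theory Submission
  imports Defs "HOL-Homology.Invariance_of_Domain"
begin

text \<open>An isovariant map out of \<open>I \<times> D\<^sup>n \<times> \<Delta>\<^sub>G\<close> is the same as a map \<open>I \<times> D\<^sup>n \<times> \<Delta>\<^sup>m \<rightarrow> M\<close> with prescribed isotropy
  groups, and along the horn each path \<open>t \<mapsto> f (t, v, x)\<close> has constant isotropy. So it suffices that \<open>M\<close> has
  isotropy-preserving path transport: along a family of paths of constant isotropy, any family of
  points can be carried in an isotropy-preserving way, continuously in all the data, so that a
  point that is the start of its path just follows that path. Retracting a neighbourhood of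
  \<open>\<partial>\<Delta>\<^sup>m\<close> onto \<open>\<partial>\<Delta>\<^sup>m\<close> and transporting the given map at time \<open>0\<close> along the retracted boundary paths
  extends \<open>f\<close>.

  Transport is a local property of \<open>M\<close>: a transport defined near the set where the point is the start of
  its path extends to all parameters by stopping it early elsewhere, and local transports are
  concatenated along stopping times. Near a point with stabilizer \<open>Q\<close> the manifold is a linear
  representation of \<open>Q\<close>. There, split off the fixed subspace, on which transport is translation; on the
  complement transport directions, which have smaller isotropy groups, by induction, and rescale.\<close>

section \<open>Isotropy-preserving transport\<close>

text \<open>The given paths are merely continuous, and paths from different points run through
  different strata, so no flow or smooth isotopy is available to carry them along. What is demanded
  of a transport is weak, however: a point that is not the start of its path only has to keep its
  own isotropy group. In particular the point and the path may have different isotropy, and this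
  does happen, since retracting onto the boundary of the simplex can enlarge the group. The freedom
  to slow motions down away from a closed coincidence set pays for the localization; the price is
  continuity where a path or a point meets a deeper stratum, and there the lengths of transverse
  components have to be compared.

  Isotropy enters as an abstract label, because the induction on representations replaces the
  stabilizer in a group by the stabilizer in a subgroup. Equivariance plays no part in transport:
  the linking simplex is a finite union of translates of one section over the simplex, and the
  extended map is spread from that section by the action.\<close>

definition transports ::
  "'k::topological_space set \<Rightarrow> 'a topology \<Rightarrow> ('a \<Rightarrow> 'l) \<Rightarrow> (real \<times> 'k \<Rightarrow> 'a) \<Rightarrow> ('k \<Rightarrow> 'a) \<Rightarrow>
    (real \<times> 'k \<Rightarrow> 'a) \<Rightarrow> bool" where
  "transports K X lab h u H \<longleftrightarrow>
     continuous_map (top_of_set ({0..1} \<times> K)) X H \<and>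
     (\<forall>x\<in>K. H (0, x) = u x) \<and>
     (\<forall>x\<in>K. \<forall>t\<in>{0..1}. lab (H (t, x)) = lab (u x)) \<and>
     (\<forall>x\<in>K. u x = h (0, x) \<longrightarrow> (\<forall>t\<in>{0..1}. H (t, x) = h (t, x)))"

definition iso_homotopy ::
  "'k::topological_space set \<Rightarrow> 'a topology \<Rightarrow> ('a \<Rightarrow> 'l) \<Rightarrow> (real \<times> 'k \<Rightarrow> 'a) \<Rightarrow> bool" where
  "iso_homotopy K X lab h \<longleftrightarrow>
     continuous_map (top_of_set ({0..1} \<times> K)) X h \<and>
     (\<forall>x\<in>K. \<forall>t\<in>{0..1}. lab (h (t, x)) = lab (h (0, x)))"

text \<open>\<open>K\<close> is an arbitrary subset because the arguments keep restricting to
  relatively open sets of parameters. Metrizability of \<open>'k\<close> supplies Urysohn functions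
  on all of these, second countability supplies countable subcovers.\<close>

definition has_transport ::
  "'k::{metric_space, second_countable_topology} itself \<Rightarrow> 'a topology \<Rightarrow> ('a \<Rightarrow> 'l) \<Rightarrow> bool" where
  "has_transport _ X lab \<longleftrightarrow>
     (\<forall>(K :: 'k set) h u. iso_homotopy K X lab h \<and> continuous_map (top_of_set K) X u \<longrightarrow>
        (\<exists>H. transports K X lab h u H))"

lemma iso_homotopyI:
  assumes "continuous_map (top_of_set ({0..1} \<times> K)) X h"
    and "\<And>x t. x \<in> K \<Longrightarrow> t \<in> {0..1} \<Longrightarrow> lab (h (t, x)) = lab (h (0, x))"
  shows "iso_homotopy K X lab h"
  using assms unfolding iso_homotopy_def by blast

lemma iso_homotopyD:
  assumes "iso_homotopy K X lab h"
  shows "continuous_map (top_of_set ({0..1} \<times> K)) X h"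
    and "x \<in> K \<Longrightarrow> t \<in> {0..1} \<Longrightarrow> lab (h (t, x)) = lab (h (0, x))"
  using assms unfolding iso_homotopy_def by blast+

section \<open>Continuity on subsets and the tube lemma\<close>

lemma continuous_map_locally:
  assumes "\<And>x. x \<in> S \<Longrightarrow>
    \<exists>U. openin (top_of_set S) U \<and> x \<in> U \<and> continuous_map (top_of_set U) X f"
  shows "continuous_map (top_of_set S) X f"
proof -
  obtain U where U: "\<And>x. x \<in> S \<Longrightarrow>
      openin (top_of_set S) (U x) \<and> x \<in> U x \<and> continuous_map (top_of_set (U x)) X f"
    using assms by metis
  show ?thesis
  proof (rule pasting_lemma[where I = S and T = U and f = "\<lambda>_. f"])
    show "continuous_map (subtopology (top_of_set S) (U i)) X f" if "i \<in> S" for i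
      using U[OF that] openin_imp_subset[of "top_of_set S" "U i"]
      by (metis openin_imp_subset subtopology_subtopology inf.absorb2)
  qed (use U in auto)
qed

lemma continuous_map_reparam:
  assumes "continuous_map (top_of_set S) X h" "continuous_on T p" "\<And>x. x \<in> T \<Longrightarrow> p x \<in> S"
  shows "continuous_map (top_of_set T) X (\<lambda>x. h (p x))"
proof -
  have "continuous_map (top_of_set T) (top_of_set S) p"
    using assms(2,3) by (simp add: image_subset_iff_funcset [symmetric] image_subset_iff)
  from continuous_map_compose[OF this assms(1)] show ?thesis by (simp add: o_def)
qed

lemma continuous_map_subset:
  assumes "continuous_map (top_of_set S) X h" "T \<subseteq> S"
  shows "continuous_map (top_of_set T) X h"
  using continuous_map_reparam[OF assms(1), of T "\<lambda>x. x"] assms(2) by auto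

lemma continuous_map_cong_on:
  assumes "continuous_map (top_of_set S) X h" "\<And>x. x \<in> S \<Longrightarrow> g x = h x"
  shows "continuous_map (top_of_set S) X g"
  using assms continuous_map_eq[of "top_of_set S" X h g] by simp

lemma openin_cylinder:
  assumes "openin (top_of_set K) B"
  shows "openin (top_of_set ({0..1::real} \<times> K)) ({0..1} \<times> B)"
proof -
  have "openin (prod_topology (top_of_set {0..1::real}) (top_of_set K)) ({0..1} \<times> B)"
    using assms by (simp only: openin_prod_Times_iff) auto
  then show ?thesis by simp
qed

text \<open>Projection along the compact interval is a closed map, and the parameters whose track
  leaves \<open>W\<close> are the image of a closed set.\<close>

lemma openin_tube:
  fixes H :: "real \<times> 'k::topological_space \<Rightarrow> 'a"
  assumes "continuous_map (top_of_set ({0..1} \<times> K)) X H" "openin X W"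
  shows "openin (top_of_set K) {x \<in> K. \<forall>t\<in>{0..1}. H (t, x) \<in> W}"
proof -
  have "openin (top_of_set ({0..1} \<times> K)) {p \<in> {0..1} \<times> K. H p \<in> W}"
    using openin_continuous_map_preimage[OF assms] by simp
  from closedin_diff[OF closedin_topspace this]
  have "closedin (top_of_set ({0..1} \<times> K)) ({0..1} \<times> K - {p \<in> {0..1} \<times> K. H p \<in> W})"
    by simp
  moreover have "closed_map (prod_topology (top_of_set {0..1::real}) (top_of_set K)) (top_of_set K) snd"
    by (rule Abstract_Topological_Spaces.closed_map_snd) (simp add: compact_space_subtopology)
  ultimately have "closedin (top_of_set K) (snd ` ({0..1} \<times> K - {p \<in> {0..1} \<times> K. H p \<in> W}))"
    by (simp add: closed_map_def)
  from openin_diff[OF openin_topspace this]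
  have "openin (top_of_set K) (K - snd ` ({0..1} \<times> K - {p \<in> {0..1} \<times> K. H p \<in> W}))"
    by simp
  also have "K - snd ` ({0..1} \<times> K - {p \<in> {0..1} \<times> K. H p \<in> W}) = {x \<in> K. \<forall>t\<in>{0..1}. H (t, x) \<in> W}"
  proof (intro Set.set_eqI iffI)
    fix x assume x: "x \<in> K - snd ` ({0..1} \<times> K - {p \<in> {0..1} \<times> K. H p \<in> W})"
    have "H (t, x) \<in> W" if "t \<in> {0..1}" for t
    proof (rule ccontr)
      assume "H (t, x) \<notin> W"
      then have "(t, x) \<in> {0..1} \<times> K - {p \<in> {0..1} \<times> K. H p \<in> W}" using x that by simp
      from imageI[OF this, of snd] show False using x by simp
    qed
    then show "x \<in> {x \<in> K. \<forall>t\<in>{0..1}. H (t, x) \<in> W}" using x by blast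
  next
    fix x assume "x \<in> {x \<in> K. \<forall>t\<in>{0..1}. H (t, x) \<in> W}"
    then show "x \<in> K - snd ` ({0..1} \<times> K - {p \<in> {0..1} \<times> K. H p \<in> W})" by auto
  qed
  finally show ?thesis .
qed

text \<open>Run \<open>H0\<close> at the speed \<open>l x\<close> given by a Urysohn function: full
  speed on the coincidence set, which is closed since \<open>X\<close> is Hausdorff, and speed 0
  near \<open>K - B\<close>. Slowing down keeps labels, and only points of the coincidence set are
  obliged to follow their paths.\<close>

lemma transports_cutoff:
  fixes K :: "'k::{metric_space, second_countable_topology} set"
  assumes X: "Hausdorff_space X" and h: "iso_homotopy K X lab h"
    and u: "continuous_map (top_of_set K) X u"
    and B: "openin (top_of_set K) B" and AB: "\<And>x. x \<in> K \<Longrightarrow> u x = h (0, x) \<Longrightarrow> x \<in> B"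
    and H0: "transports B X lab h u H0"
  shows "\<exists>H. transports K X lab h u H"
proof -
  have hc: "continuous_map (top_of_set ({0..1} \<times> K)) X h"
    using h by (auto simp: iso_homotopy_def)
  have h0: "continuous_map (top_of_set K) X (\<lambda>x. h (0, x))"
    by (rule continuous_map_reparam[OF hc]) (auto intro!: continuous_intros)
  have cA: "closedin (top_of_set K) {x \<in> K. u x = h (0, x)}"
    using closedin_continuous_maps_eq[OF X u h0] by simp
  have BK: "B \<subseteq> K" using B openin_imp_subset by auto
  have cB: "closedin (top_of_set K) (K - B)"
    using closedin_diff[OF closedin_topspace B] by simp
  have "normal_space (top_of_set K)"
    by (metis metrizable_imp_normal_space metrizable_space_euclidean metrizable_space_subtopology)
  moreover have "disjnt {x \<in> K. u x = h (0, x)} (K - B)"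
    using AB by (auto simp: disjnt_def)
  ultimately obtain f where f: "continuous_map (top_of_set K) euclideanreal f"
    "f ` {x \<in> K. u x = h (0, x)} \<subseteq> {0}" "f ` (K - B) \<subseteq> {1::real}"
    using cA cB unfolding normal_space_iff_Urysohn_alt by meson
  have fc: "continuous_on K f" using f(1) by simp
  \<comment> \<open>The factor 2 makes \<open>l\<close> vanish already where \<open>f\<close>
    exceeds 1/2, an open neighbourhood of \<open>K - B\<close>; there both branches of
    \<open>H\<close> below are equal to \<open>u\<close>.\<close>
  define l where "l = (\<lambda>x. max 0 (min 1 (1 - 2 * f x)))"
  have lc: "continuous_on K l" unfolding l_def by (intro continuous_intros fc)
  have l01: "l x \<in> {0..1}" for x by (auto simp: l_def)
  have lA: "l x = 1" if "x \<in> K" "u x = h (0, x)" for x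
    using f(2) that by (force simp: l_def)
  define H where "H = (\<lambda>(t, x). if x \<in> B then H0 (l x * t, x) else u x)"
  have H0c: "continuous_map (top_of_set ({0..1} \<times> B)) X H0"
    and H00: "\<And>x. x \<in> B \<Longrightarrow> H0 (0, x) = u x"
    and H0i: "\<And>x t. x \<in> B \<Longrightarrow> t \<in> {0..1} \<Longrightarrow> lab (H0 (t, x)) = lab (u x)"
    and H0h: "\<And>x t. x \<in> B \<Longrightarrow> u x = h (0, x) \<Longrightarrow> t \<in> {0..1} \<Longrightarrow> H0 (t, x) = h (t, x)"
    using H0 by (auto simp: transports_def)
  have lt: "l x * t \<in> {0..1}" if "t \<in> {0..1}" for t x
    using l01[of x] that by (auto simp: mult_le_one)
  have Hc: "continuous_map (top_of_set ({0..1} \<times> K)) X H"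
  proof (rule continuous_map_locally)
    fix p assume "p \<in> {0..1::real} \<times> K"
    then obtain t x where p: "p = (t, x)" "t \<in> {0..1}" "x \<in> K" by auto
    show "\<exists>U. openin (top_of_set ({0..1} \<times> K)) U \<and> p \<in> U \<and> continuous_map (top_of_set U) X H"
    proof (cases "x \<in> B")
      case True
      have "continuous_map (top_of_set ({0..1} \<times> B)) X (\<lambda>q. H0 (l (snd q) * fst q, snd q))"
        by (rule continuous_map_reparam[OF H0c])
          (use lt in \<open>auto intro!: continuous_intros continuous_on_compose2[OF lc] simp: BK[THEN subsetD]\<close>)
      then have "continuous_map (top_of_set ({0..1} \<times> B)) X H"
        by (rule continuous_map_cong_on) (auto simp: H_def)
      then show ?thesis using openin_cylinder[OF B] True p by blast
    next
      case False
      define W where "W = {x \<in> K. 1 / 2 < f x}"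
      have W: "openin (top_of_set K) W"
        unfolding W_def using openin_continuous_map_preimage[OF f(1), of "{1/2<..}"] by simp
      have "continuous_map (top_of_set ({0..1::real} \<times> W)) X (\<lambda>q. u (snd q))"
        by (rule continuous_map_reparam[OF u]) (auto intro!: continuous_intros simp: W_def)
      then have "continuous_map (top_of_set ({0..1} \<times> W)) X H"
        by (rule continuous_map_cong_on) (auto simp: H_def W_def l_def H00)
      moreover have "f x = 1" using f(3) False p by auto
      ultimately show ?thesis using openin_cylinder[OF W] p by (auto simp: W_def)
    qed
  qed
  have "transports K X lab h u H"
    unfolding transports_def
    using Hc H00 H0i H0h lt lA AB by (auto simp: H_def)
  then show ?thesis by blast
qed

lemma transports_subset:
  assumes "transports K X lab h u H" "L \<subseteq> K"
  shows "transports L X lab h u H"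
  using assms continuous_map_subset[of "{0..1} \<times> K" X H "{0..1} \<times> L"]
  by (auto simp: transports_def Sigma_mono subset_iff)

lemma iso_homotopy_subset:
  assumes "iso_homotopy K X lab h" "L \<subseteq> K"
  shows "iso_homotopy L X lab h"
proof (rule iso_homotopyI)
  show "continuous_map (top_of_set ({0..1} \<times> L)) X h"
    using continuous_map_subset[OF iso_homotopyD(1)[OF assms(1)], of "{0..1} \<times> L"] assms(2) by blast
qed (use assms iso_homotopyD(2)[OF assms(1)] in blast)

text \<open>A transport in \<open>X\<close> may leave \<open>W\<close>. The parameters whose whole
  track stays in \<open>W\<close> form an open set, and it contains the coincidence set because
  there the track is \<open>h\<close> itself; the rest is cut off.\<close>

lemma has_transport_open_subspace:
  assumes X: "Hausdorff_space X" and W: "openin X W"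
    and TP: "has_transport TYPE('k::{metric_space, second_countable_topology}) X lab"
  shows "has_transport TYPE('k) (subtopology X W) lab"
  unfolding has_transport_def
proof (intro allI impI, elim conjE)
  fix K :: "'k set" and h u
  assume h: "iso_homotopy K (subtopology X W) lab h"
    and u: "continuous_map (top_of_set K) (subtopology X W) u"
  have "iso_homotopy K X lab h" "continuous_map (top_of_set K) X u"
    using h u by (simp_all only: iso_homotopy_def continuous_map_in_subtopology) blast+
  then obtain H where H: "transports K X lab h u H"
    using TP unfolding has_transport_def by blast
  then have Hc: "continuous_map (top_of_set ({0..1} \<times> K)) X H" by (simp add: transports_def)
  define B where "B = {x \<in> K. \<forall>t\<in>{0..1}. H (t, x) \<in> W}"
  have B: "openin (top_of_set K) B"
    unfolding B_def by (rule openin_tube[OF Hc W])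
  have BK: "B \<subseteq> K" by (auto simp: B_def)
  have hW: "h p \<in> W" if "p \<in> {0..1} \<times> K" for p
    using h that by (auto simp: iso_homotopy_def continuous_map_in_subtopology)
  show "\<exists>H. transports K (subtopology X W) lab h u H"
  proof (rule transports_cutoff[OF _ h u B])
    show "Hausdorff_space (subtopology X W)" using X Hausdorff_space_subtopology by blast
    show "x \<in> B" if "x \<in> K" "u x = h (0, x)" for x
      using H hW that by (auto simp: B_def transports_def)
    show "transports B (subtopology X W) lab h u H"
      using transports_subset[OF H BK] by (auto simp: transports_def continuous_map_in_subtopology B_def)
  qed
qed

text \<open>Only the paths have to lie in \<open>W\<close>. A point \<open>u x\<close> outside
  \<open>W\<close> cannot be the start of its path, so the cutoff lets it rest.\<close>

lemma has_transport_relative: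
  fixes K :: "'k::{metric_space, second_countable_topology} set"
  assumes X: "Hausdorff_space X" and W: "openin X W"
    and TP: "has_transport TYPE('k) (subtopology X W) lab"
    and h: "iso_homotopy K X lab h" and hW: "\<And>x t. x \<in> K \<Longrightarrow> t \<in> {0..1} \<Longrightarrow> h (t, x) \<in> W"
    and u: "continuous_map (top_of_set K) X u"
  shows "\<exists>H. transports K X lab h u H"
proof -
  define B where "B = {x \<in> K. u x \<in> W}"
  have B: "openin (top_of_set K) B"
    unfolding B_def using openin_continuous_map_preimage[OF u W] by simp
  have BK: "B \<subseteq> K" by (auto simp: B_def)
  have "iso_homotopy B (subtopology X W) lab h"
  proof (rule iso_homotopyI)
    show "continuous_map (top_of_set ({0..1} \<times> B)) (subtopology X W) h"
      using iso_homotopyD(1)[OF iso_homotopy_subset[OF h BK]] hW BK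
      by (auto simp: continuous_map_in_subtopology)
  qed (use h BK iso_homotopyD(2) in blast)
  moreover have "continuous_map (top_of_set B) (subtopology X W) u"
    using continuous_map_subset[OF u BK] by (auto simp: continuous_map_in_subtopology B_def)
  ultimately obtain H where "transports B (subtopology X W) lab h u H"
    using TP unfolding has_transport_def by blast
  then have H: "transports B X lab h u H"
    by (auto simp: transports_def continuous_map_in_subtopology)
  show ?thesis
  proof (rule transports_cutoff[OF X h u B _ H])
    show "x \<in> B" if "x \<in> K" "u x = h (0, x)" for x
      using hW that by (auto simp: B_def)
  qed
qed

section \<open>Transport is a local property\<close>

text \<open>A partial transport: the path is frozen at time \<open>\<sigma> x\<close>. The second
  clause makes the carried point rest from then on as well, so that a further piece can be attached
  continuously at that time.\<close>

definition transports_until ::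
  "'k::topological_space set \<Rightarrow> 'a topology \<Rightarrow> ('a \<Rightarrow> 'l) \<Rightarrow> (real \<times> 'k \<Rightarrow> 'a) \<Rightarrow> ('k \<Rightarrow> 'a) \<Rightarrow>
    ('k \<Rightarrow> real) \<Rightarrow> (real \<times> 'k \<Rightarrow> 'a) \<Rightarrow> bool" where
  "transports_until K X lab h u \<sigma> F \<longleftrightarrow>
     transports K X lab (\<lambda>(t, x). h (min t (\<sigma> x), x)) u F \<and>
     (\<forall>x\<in>K. \<forall>t\<in>{0..1}. \<sigma> x \<le> t \<longrightarrow> F (t, x) = F (\<sigma> x, x))"

lemma transports_untilI:
  assumes "continuous_map (top_of_set ({0..1} \<times> K)) X F"
    and "\<And>x. x \<in> K \<Longrightarrow> 0 \<le> \<sigma> x"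
    and "\<And>x. x \<in> K \<Longrightarrow> F (0, x) = u x"
    and "\<And>x t. x \<in> K \<Longrightarrow> t \<in> {0..1} \<Longrightarrow> lab (F (t, x)) = lab (u x)"
    and "\<And>x t. x \<in> K \<Longrightarrow> u x = h (0, x) \<Longrightarrow> t \<in> {0..1} \<Longrightarrow> F (t, x) = h (min t (\<sigma> x), x)"
    and "\<And>x t. x \<in> K \<Longrightarrow> t \<in> {0..1} \<Longrightarrow> \<sigma> x \<le> t \<Longrightarrow> F (t, x) = F (\<sigma> x, x)"
  shows "transports_until K X lab h u \<sigma> F"
proof -
  have "u x = (\<lambda>(t, x). h (min t (\<sigma> x), x)) (0, x) \<longleftrightarrow> u x = h (0, x)" if "x \<in> K" for x
    using assms(2)[OF that] by (simp add: min_def)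
  then show ?thesis
    using assms unfolding transports_until_def transports_def prod.case by blast
qed

lemma transports_untilD:
  assumes F: "transports_until K X lab h u \<sigma> F" and \<sigma>: "\<And>x. x \<in> K \<Longrightarrow> 0 \<le> \<sigma> x"
  shows "continuous_map (top_of_set ({0..1} \<times> K)) X F"
    and "x \<in> K \<Longrightarrow> F (0, x) = u x"
    and "x \<in> K \<Longrightarrow> t \<in> {0..1} \<Longrightarrow> lab (F (t, x)) = lab (u x)"
    and "x \<in> K \<Longrightarrow> u x = h (0, x) \<Longrightarrow> t \<in> {0..1} \<Longrightarrow> F (t, x) = h (min t (\<sigma> x), x)"
    and "x \<in> K \<Longrightarrow> t \<in> {0..1} \<Longrightarrow> \<sigma> x \<le> t \<Longrightarrow> F (t, x) = F (\<sigma> x, x)"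
proof -
  have *: "u x = (\<lambda>(t, x). h (min t (\<sigma> x), x)) (0, x) \<longleftrightarrow> u x = h (0, x)" if "x \<in> K" for x
    using \<sigma>[OF that] by (simp add: min_def)
  show "continuous_map (top_of_set ({0..1} \<times> K)) X F"
    and "x \<in> K \<Longrightarrow> F (0, x) = u x"
    and "x \<in> K \<Longrightarrow> t \<in> {0..1} \<Longrightarrow> lab (F (t, x)) = lab (u x)"
    and "x \<in> K \<Longrightarrow> t \<in> {0..1} \<Longrightarrow> \<sigma> x \<le> t \<Longrightarrow> F (t, x) = F (\<sigma> x, x)"
    using F unfolding transports_until_def transports_def by blast+
  show "x \<in> K \<Longrightarrow> u x = h (0, x) \<Longrightarrow> t \<in> {0..1} \<Longrightarrow> F (t, x) = h (min t (\<sigma> x), x)"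
    using F * unfolding transports_until_def transports_def by (metis (mono_tags) prod.case)
qed

lemma transports_until_cong:
  assumes "\<And>x. x \<in> K \<Longrightarrow> \<sigma> x = \<tau> x"
  shows "transports_until K X lab h u \<sigma> F \<longleftrightarrow> transports_until K X lab h u \<tau> F"
  using assms by (simp add: transports_until_def transports_def cong: ball_cong)

text \<open>Restart at \<open>v x = F (\<sigma> x, x)\<close> along the shifted path
  \<open>g\<close>. This path lies in \<open>W\<close> for parameters in \<open>C\<close>, hence by
  the tube lemma for parameters in an open set \<open>B\<close> around \<open>C\<close>. Off
  \<open>C\<close> the stopping times agree and the new piece has length 0, so the definitions over
  \<open>B\<close> and over \<open>K - C\<close> match.\<close>

lemma transports_until_step:
  fixes K :: "'k::{metric_space, second_countable_topology} set"
  assumes X: "Hausdorff_space X" and W: "openin X W"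
    and TP: "has_transport TYPE('k) (subtopology X W) lab"
    and h: "iso_homotopy K X lab h"
    and F: "transports_until K X lab h u \<sigma> F"
    and \<sigma>: "continuous_on K \<sigma>" and \<sigma>': "continuous_on K \<sigma>'"
    and ord: "\<And>x. x \<in> K \<Longrightarrow> 0 \<le> \<sigma> x \<and> \<sigma> x \<le> \<sigma>' x \<and> \<sigma>' x \<le> 1"
    and C: "closedin (top_of_set K) C" and off: "\<And>x. x \<in> K - C \<Longrightarrow> \<sigma>' x = \<sigma> x"
    and hW: "\<And>x t. x \<in> C \<Longrightarrow> \<sigma> x \<le> t \<Longrightarrow> t \<le> \<sigma>' x \<Longrightarrow> h (t, x) \<in> W"
  shows "\<exists>F'. transports_until K X lab h u \<sigma>' F' \<and> (\<forall>x\<in>K. \<forall>t\<in>{0..1}. t \<le> \<sigma> x \<longrightarrow> F' (t, x) = F (t, x))"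
proof -
  note hc = iso_homotopyD(1)[OF h] and hl = iso_homotopyD(2)[OF h]
  have \<sigma>0: "0 \<le> \<sigma> x" if "x \<in> K" for x using ord[OF that] by simp
  have Fc: "continuous_map (top_of_set ({0..1} \<times> K)) X F"
    and F0: "\<And>x. x \<in> K \<Longrightarrow> F (0, x) = u x"
    and Fl: "\<And>x t. x \<in> K \<Longrightarrow> t \<in> {0..1} \<Longrightarrow> lab (F (t, x)) = lab (u x)"
    and Fh: "\<And>x t. x \<in> K \<Longrightarrow> u x = h (0, x) \<Longrightarrow> t \<in> {0..1} \<Longrightarrow> F (t, x) = h (min t (\<sigma> x), x)"
    and Fs: "\<And>x t. x \<in> K \<Longrightarrow> t \<in> {0..1} \<Longrightarrow> \<sigma> x \<le> t \<Longrightarrow> F (t, x) = F (\<sigma> x, x)"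
    using transports_untilD[OF F] \<sigma>0 by blast+
  define g where "g = (\<lambda>(s, x). h (min (\<sigma> x + s) (\<sigma>' x), x))"
  have rng: "min (\<sigma> x + s) (\<sigma>' x) \<in> {0..1}" if "x \<in> K" "s \<in> {0..1}" for x s
    using ord[of x] that by auto
  have gc: "continuous_map (top_of_set ({0..1} \<times> K)) X g"
  proof -
    have "continuous_map (top_of_set ({0..1} \<times> K)) X
        (\<lambda>p. h (min (\<sigma> (snd p) + fst p) (\<sigma>' (snd p)), snd p))"
      using rng by (intro continuous_map_reparam[OF hc] continuous_intros
          continuous_on_compose2[OF \<sigma>] continuous_on_compose2[OF \<sigma>']) auto
    then show ?thesis by (rule continuous_map_cong_on) (auto simp: g_def)
  qed
  have g: "iso_homotopy K X lab g"
  proof (rule iso_homotopyI[OF gc])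
    fix x t assume x: "x \<in> K" "t \<in> {0..1::real}"
    show "lab (g (t, x)) = lab (g (0, x))"
      using hl[OF x(1) rng[OF x]] hl[OF x(1) rng[OF x(1), of 0]] by (simp add: g_def)
  qed
  define B where "B = {x \<in> K. \<forall>s\<in>{0..1}. g (s, x) \<in> W}"
  have B: "openin (top_of_set K) B"
    unfolding B_def by (rule openin_tube[OF gc W])
  have BK: "B \<subseteq> K" by (auto simp: B_def)
  have CK: "C \<subseteq> K" using closedin_subset[OF C] by simp
  have CB: "C \<subseteq> B"
  proof
    fix x assume x: "x \<in> C"
    then show "x \<in> B" using CK ord[of x] by (auto simp: B_def g_def intro!: hW)
  qed
  define v where "v = (\<lambda>x. F (\<sigma> x, x))"
  have \<sigma>01: "\<sigma> x \<in> {0..1}" if "x \<in> K" for x using ord[OF that] by auto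
  have v: "continuous_map (top_of_set K) X v"
    unfolding v_def using \<sigma>01 by (intro continuous_map_reparam[OF Fc] continuous_intros \<sigma>) auto
  obtain H where H: "transports B X lab g v H"
    using has_transport_relative[OF X W TP iso_homotopy_subset[OF g BK] _ continuous_map_subset[OF v BK]]
    by (auto simp: B_def)
  have Hc: "continuous_map (top_of_set ({0..1} \<times> B)) X H"
    and H0: "\<And>x. x \<in> B \<Longrightarrow> H (0, x) = v x"
    and Hl: "\<And>x t. x \<in> B \<Longrightarrow> t \<in> {0..1} \<Longrightarrow> lab (H (t, x)) = lab (v x)"
    and Hg: "\<And>x t. x \<in> B \<Longrightarrow> v x = g (0, x) \<Longrightarrow> t \<in> {0..1} \<Longrightarrow> H (t, x) = g (t, x)"
    using H by (auto simp: transports_def)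
  define F' where "F' = (\<lambda>(t, x). if x \<in> B then
      (if t \<le> \<sigma> x then F (t, x) else H (min t (\<sigma>' x) - \<sigma> x, x)) else F (t, x))"
  have r2: "min t (\<sigma>' x) - \<sigma> x \<in> {0..1}" if "x \<in> K" "\<sigma> x \<le> t" for x t
    using ord[OF that(1)] that by (auto simp: min_def)
  \<comment> \<open>If the stopping times agree, \<open>H\<close> is only evaluated at time 0, where
    it is \<open>v x\<close>, the resting position of \<open>F\<close>.\<close>
  have F'K: "F' (t, x) = F (t, x)" if "x \<in> K" "\<sigma>' x = \<sigma> x" "t \<in> {0..1}" for t x
    using that H0[of x] Fs[OF that(1,3)] by (auto simp: F'_def v_def min_def)
  have F'c: "continuous_map (top_of_set ({0..1} \<times> K)) X F'"
  proof (rule continuous_map_locally)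
    fix p assume "p \<in> {0..1::real} \<times> K"
    then obtain t x where p: "p = (t, x)" "t \<in> {0..1}" "x \<in> K" by auto
    show "\<exists>U. openin (top_of_set ({0..1} \<times> K)) U \<and> p \<in> U \<and> continuous_map (top_of_set U) X F'"
    proof (cases "x \<in> B")
      case True
      let ?T = "{0..1::real} \<times> B"
      have \<sigma>B: "continuous_on ?T (\<lambda>q. \<sigma> (snd q))"
        by (rule continuous_on_compose2[OF \<sigma>]) (use BK in \<open>auto intro!: continuous_intros\<close>)
      have \<sigma>'B: "continuous_on ?T (\<lambda>q. \<sigma>' (snd q))"
        by (rule continuous_on_compose2[OF \<sigma>']) (use BK in \<open>auto intro!: continuous_intros\<close>)
      have "continuous_map (top_of_set ?T) X
          (\<lambda>q. if fst q \<le> \<sigma> (snd q) then F q else H (min (fst q) (\<sigma>' (snd q)) - \<sigma> (snd q), snd q))"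
      proof (rule continuous_map_cases_le)
        show "continuous_map (subtopology (top_of_set ?T)
            {x \<in> topspace (top_of_set ?T). fst x \<le> \<sigma> (snd x)}) X F"
          unfolding subtopology_subtopology
          by (rule continuous_map_subset[OF Fc]) (use BK in auto)
        show "continuous_map (subtopology (top_of_set ?T)
            {x \<in> topspace (top_of_set ?T). \<sigma> (snd x) \<le> fst x}) X
            (\<lambda>q. H (min (fst q) (\<sigma>' (snd q)) - \<sigma> (snd q), snd q))"
          unfolding subtopology_subtopology
        proof (rule continuous_map_reparam[OF Hc])
          let ?S = "?T \<inter> {x \<in> topspace (top_of_set ?T). \<sigma> (snd x) \<le> fst x}"
          show "continuous_on ?S (\<lambda>q. (min (fst q) (\<sigma>' (snd q)) - \<sigma> (snd q), snd q))"
            by (intro continuous_intros continuous_on_subset[OF \<sigma>B] continuous_on_subset[OF \<sigma>'B]) auto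
          show "(min (fst q) (\<sigma>' (snd q)) - \<sigma> (snd q), snd q) \<in> ?T" if "q \<in> ?S" for q
            using r2[of "snd q" "fst q"] that BK by auto
        qed
        fix q assume q: "q \<in> topspace (top_of_set ?T)" "fst q = \<sigma> (snd q)"
        then have "snd q \<in> B" "snd q \<in> K" using BK by auto
        then show "F q = H (min (fst q) (\<sigma>' (snd q)) - \<sigma> (snd q), snd q)"
          using q H0[of "snd q"] ord[of "snd q"]
          by (metis add_0 add_diff_cancel diff_self min.absorb1 prod.collapse v_def)
      qed (use \<sigma>B in \<open>auto intro: continuous_intros\<close>)
      then have "continuous_map (top_of_set ?T) X F'"
        by (rule continuous_map_cong_on) (auto simp: F'_def)
      then show ?thesis using openin_cylinder[OF B] True p by blast
    next
      case False
      have KC: "openin (top_of_set K) (K - C)"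
        using openin_diff[OF openin_topspace C] by simp
      have "continuous_map (top_of_set ({0..1} \<times> (K - C))) X F'"
        by (rule continuous_map_cong_on[OF continuous_map_subset[OF Fc]])
          (use F'K off in auto)
      then show ?thesis using openin_cylinder[OF KC] False p CB by blast
    qed
  qed
  have ex: "F' (t, x) = F (t, x)" if "x \<in> K" "t \<in> {0..1}" "t \<le> \<sigma> x" for t x
    using that by (auto simp: F'_def)
  have lab': "lab (F' (t, x)) = lab (u x)" if "x \<in> K" "t \<in> {0..1}" for x t
    using Fl[OF that] Fl[OF that(1) \<sigma>01[OF that(1)]] Hl[of x "min t (\<sigma>' x) - \<sigma> x"] r2[of x t] that
    by (auto simp: F'_def v_def)
  have path: "F' (t, x) = h (min t (\<sigma>' x), x)" if x: "x \<in> K" "u x = h (0, x)" "t \<in> {0..1}" for x t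
  proof (cases "t \<le> \<sigma> x \<or> x \<notin> B")
    case True
    then have "F' (t, x) = F (t, x)" by (auto simp: F'_def)
    moreover have "min t (\<sigma> x) = min t (\<sigma>' x)"
    proof (cases "t \<le> \<sigma> x")
      case True
      then show ?thesis using ord[OF x(1)] by simp
    next
      case False
      then have "x \<in> K - C" using True CB x(1) by blast
      then show ?thesis using off by simp
    qed
    ultimately show ?thesis using Fh[OF x] by simp
  next
    case False
    have "v x = g (0, x)"
      using Fh[OF x(1,2) \<sigma>01[OF x(1)]] ord[OF x(1)] by (simp add: v_def g_def min_def)
    then show ?thesis
      using False Hg[of x "min t (\<sigma>' x) - \<sigma> x"] r2[of x t] x(1) by (auto simp: F'_def g_def min_def)
  qed
  have stop: "F' (t, x) = F' (\<sigma>' x, x)" if x: "x \<in> K" "t \<in> {0..1}" "\<sigma>' x \<le> t" for x t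
  proof (cases "\<sigma>' x = \<sigma> x")
    case True
    then show ?thesis using F'K[OF x(1) True x(2)] F'K[OF x(1) True \<sigma>01[OF x(1)]] Fs[OF x(1,2)] x(3) by simp
  next
    case False
    then have "x \<in> B" "\<sigma> x < \<sigma>' x" using off CB x(1) ord[OF x(1)] by force+
    then show ?thesis using x(3) by (auto simp: F'_def)
  qed
  have "F' (0, x) = u x" if "x \<in> K" for x
    using ex[OF that, of 0] ord[OF that] F0[OF that] by simp
  then have "transports_until K X lab h u \<sigma>' F'"
    using F'c lab' path stop ord by (intro transports_untilI) force+
  then show ?thesis using ex by blast
qed

text \<open>During the i-th of \<open>N\<close> equal time slots the path stays in
  \<open>W i\<close>. Clipping the grid points to the interval from \<open>\<sigma> x\<close> to
  \<open>\<sigma>' x\<close> gives intermediate stopping times \<open>\<tau> i\<close>, so that each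
  step involves a single open set.\<close>

lemma transports_until_chunks:
  fixes K :: "'k::{metric_space, second_countable_topology} set"
  assumes X: "Hausdorff_space X"
    and TP: "\<And>i. i < N \<Longrightarrow> openin X (W i) \<and> has_transport TYPE('k) (subtopology X (W i)) lab"
    and h: "iso_homotopy K X lab h"
    and F: "transports_until K X lab h u \<sigma> F"
    and \<sigma>: "continuous_on K \<sigma>" and \<sigma>': "continuous_on K \<sigma>'"
    and ord: "\<And>x. x \<in> K \<Longrightarrow> 0 \<le> \<sigma> x \<and> \<sigma> x \<le> \<sigma>' x \<and> \<sigma>' x \<le> 1"
    and C: "closedin (top_of_set K) C" and off: "\<And>x. x \<in> K - C \<Longrightarrow> \<sigma>' x = \<sigma> x"
    and N: "N > 0"
    and hW: "\<And>x t i. i < N \<Longrightarrow> x \<in> C \<Longrightarrow> real i / real N \<le> t \<Longrightarrow> t \<le> real (Suc i) / real N \<Longrightarrow> h (t, x) \<in> W i"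
  shows "\<exists>F'. transports_until K X lab h u \<sigma>' F' \<and> (\<forall>x\<in>K. \<forall>t\<in>{0..1}. t \<le> \<sigma> x \<longrightarrow> F' (t, x) = F (t, x))"
proof -
  define \<tau> where "\<tau> = (\<lambda>i x. max (\<sigma> x) (min (\<sigma>' x) (real i / real N)))"
  have \<tau>c: "continuous_on K (\<tau> i)" for i unfolding \<tau>_def by (intro continuous_intros \<sigma> \<sigma>')
  have "\<exists>F'. transports_until K X lab h u (\<tau> i) F' \<and> (\<forall>x\<in>K. \<forall>t\<in>{0..1}. t \<le> \<sigma> x \<longrightarrow> F' (t, x) = F (t, x))"
    if "i \<le> N" for i
    using that
  proof (induction i)
    case 0
    have "transports_until K X lab h u (\<tau> 0) F"
    proof (rule transports_until_cong[THEN iffD1, OF _ F])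
      show "\<sigma> x = \<tau> 0 x" if "x \<in> K" for x using ord[OF that] by (simp add: \<tau>_def)
    qed
    then show ?case by blast
  next
    case (Suc i)
    then obtain F1 where F1: "transports_until K X lab h u (\<tau> i) F1"
      "\<And>x t. x \<in> K \<Longrightarrow> t \<in> {0..1} \<Longrightarrow> t \<le> \<sigma> x \<Longrightarrow> F1 (t, x) = F (t, x)" by auto
    \<comment> \<open>Off \<open>D\<close> the clipped slot degenerates to one instant, which may
      lie outside the i-th slot and so need not have its path point in \<open>W i\<close>; on
      \<open>D\<close> the interval from \<open>\<tau> i x\<close> to
      \<open>\<tau> (Suc i) x\<close> lies inside the slot.\<close>
    define D where "D = C \<inter> {x \<in> K. \<tau> i x \<le> real (Suc i) / real N} \<inter> {x \<in> K. real i / real N \<le> \<tau> (Suc i) x}"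
    have le: "real i / real N \<le> real (Suc i) / real N" by (simp add: divide_right_mono)
    have cl1: "closedin (top_of_set K) {x \<in> K. \<tau> i x \<le> real (Suc i) / real N}"
      using continuous_closedin_preimage[OF \<tau>c[of i] closed_atMost, of "real (Suc i) / real N"]
      by (simp add: vimage_def Int_def)
    have cl2: "closedin (top_of_set K) {x \<in> K. real i / real N \<le> \<tau> (Suc i) x}"
      using continuous_closedin_preimage[OF \<tau>c[of "Suc i"] closed_atLeast, of "real i / real N"]
      by (simp add: vimage_def Int_def)
    have D: "closedin (top_of_set K) D" unfolding D_def using C cl1 cl2 by (intro closedin_Int)
    have CK: "C \<subseteq> K" using closedin_subset[OF C] by simp
    have "\<exists>F'. transports_until K X lab h u (\<tau> (Suc i)) F' \<and> (\<forall>x\<in>K. \<forall>t\<in>{0..1}. t \<le> \<tau> i x \<longrightarrow> F' (t, x) = F1 (t, x))"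
    proof (rule transports_until_step[OF X _ _ h F1(1) \<tau>c \<tau>c _ D])
      show "openin X (W i)" "has_transport TYPE('k) (subtopology X (W i)) lab"
        using TP[of i] Suc.prems by auto
      show "0 \<le> \<tau> i x \<and> \<tau> i x \<le> \<tau> (Suc i) x \<and> \<tau> (Suc i) x \<le> 1" if "x \<in> K" for x
        using ord[OF that] le by (auto simp: \<tau>_def max_def min_def)
      show "\<tau> (Suc i) x = \<tau> i x" if "x \<in> K - D" for x
      proof (cases "x \<in> C")
        case True
        then show ?thesis using that le ord[of x] unfolding D_def \<tau>_def by (auto simp: max_def min_def split: if_splits)
      next
        case False
        then show ?thesis using off[of x] that by (simp add: \<tau>_def)
      qed
      show "h (t, x) \<in> W i" if "x \<in> D" "\<tau> i x \<le> t" "t \<le> \<tau> (Suc i) x" for x t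
      proof (rule hW)
        have "x \<in> K" using that CK by (auto simp: D_def)
        then show "real i / real N \<le> t" "t \<le> real (Suc i) / real N"
          using that le ord[of x] unfolding D_def \<tau>_def by (auto simp: max_def min_def split: if_splits)
      qed (use that Suc.prems in \<open>auto simp: D_def\<close>)
    qed
    then obtain F2 where F2: "transports_until K X lab h u (\<tau> (Suc i)) F2"
      "\<And>x t. x \<in> K \<Longrightarrow> t \<in> {0..1} \<Longrightarrow> t \<le> \<tau> i x \<Longrightarrow> F2 (t, x) = F1 (t, x)" by auto
    have "F2 (t, x) = F (t, x)" if "x \<in> K" "t \<in> {0..1}" "t \<le> \<sigma> x" for x t
      using F2(2)[OF that(1,2)] F1(2)[OF that] that(3) by (simp add: \<tau>_def)
    then show ?case using F2(1) by blast
  qed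
  from this[of N] obtain F' where F': "transports_until K X lab h u (\<tau> N) F'"
    "\<forall>x\<in>K. \<forall>t\<in>{0..1}. t \<le> \<sigma> x \<longrightarrow> F' (t, x) = F (t, x)" by auto
  have eq: "\<tau> N x = \<sigma>' x" if "x \<in> K" for x
    using ord[OF that] N by (simp add: \<tau>_def)
  have "transports_until K X lab h u \<sigma>' F'"
    by (rule transports_until_cong[THEN iffD1, OF _ F'(1)]) (rule eq)
  then show ?thesis using F'(2) by blast
qed

text \<open>The compact segment \<open>{0..1} \<times> {x0}\<close> has a Lebesgue number
  \<open>e\<close> for the cover pulled back along \<open>h\<close>; half of it is spent on the
  radius around \<open>x0\<close>, half on the slot length.\<close>

lemma chunks_near_point:
  fixes K :: "'k::metric_space set"
  assumes h: "continuous_map (top_of_set ({0..1} \<times> K)) X h" and x0: "x0 \<in> K"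
    and cover: "\<And>p. p \<in> topspace X \<Longrightarrow> \<exists>W. openin X W \<and> p \<in> W \<and> P W"
  shows "\<exists>r>0. \<exists>N>0. \<exists>W. \<forall>i<N. openin X (W i) \<and> P (W i) \<and>
    (\<forall>x \<in> K \<inter> cball x0 r. \<forall>t. real i / real N \<le> t \<and> t \<le> real (Suc i) / real N \<longrightarrow> h (t, x) \<in> W i)"
proof -
  have "\<exists>V W. open V \<and> (t, x0) \<in> V \<and> openin X W \<and> P W \<and> (\<forall>p \<in> V \<inter> ({0..1} \<times> K). h p \<in> W)"
    if t: "t \<in> {0..1}" for t
  proof -
    have "h (t, x0) \<in> topspace X"
      using h t x0 by (auto simp: continuous_map_def)
    then obtain W where W: "openin X W" "h (t, x0) \<in> W" "P W" using cover by blast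
    have "openin (top_of_set ({0..1} \<times> K)) {p \<in> {0..1} \<times> K. h p \<in> W}"
      using openin_continuous_map_preimage[OF h W(1)] by simp
    then obtain V where "open V" "{p \<in> {0..1} \<times> K. h p \<in> W} = ({0..1} \<times> K) \<inter> V"
      by (auto simp: openin_open)
    then show ?thesis using W t x0 by (intro exI[of _ V] exI[of _ W]) auto
  qed
  then obtain V W where VW: "\<And>t. t \<in> {0..1} \<Longrightarrow>
      open (V t) \<and> (t, x0) \<in> V t \<and> openin X (W t) \<and> P (W t) \<and> (\<forall>p \<in> V t \<inter> ({0..1} \<times> K). h p \<in> W t)"
    by metis
  have "compact ({0..1::real} \<times> {x0})" by (intro compact_Times) auto
  moreover have "{0..1::real} \<times> {x0} \<subseteq> \<Union> (V ` {0..1})" using VW by fastforce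
  moreover have "open G" if "G \<in> V ` {0..1}" for G using VW that by blast
  ultimately obtain e where e: "e > 0"
    "\<And>p. p \<in> {0..1::real} \<times> {x0} \<Longrightarrow> \<exists>G \<in> V ` {0..1}. ball p e \<subseteq> G"
    by (rule Heine_Borel_lemma[of "{0..1::real} \<times> {x0}" "V ` {0..1}"]) blast+
  then have "\<exists>s\<in>{0..1}. ball (t, x0) e \<subseteq> V s" if "t \<in> {0..1}" for t
    using e(2)[of "(t, x0)"] that by auto
  then obtain s where s: "\<And>t. t \<in> {0..1} \<Longrightarrow> s t \<in> {0..1} \<and> ball (t, x0) e \<subseteq> V (s t)" by metis
  obtain N :: nat where N: "N > 0" "1 / real N < e / 2"
    using reals_Archimedean[of "e/2"] e(1) by (metis half_gt_zero inverse_eq_divide zero_less_Suc)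
  have "openin X (W (s (real i / real N))) \<and> P (W (s (real i / real N))) \<and>
    (\<forall>x \<in> K \<inter> cball x0 (e/2). \<forall>t. real i / real N \<le> t \<and> t \<le> real (Suc i) / real N \<longrightarrow> h (t, x) \<in> W (s (real i / real N)))"
    if i: "i < N" for i
  proof -
    have i01: "real i / real N \<in> {0..1}" using i by (simp add: divide_le_eq)
    note si = s[OF i01]
    have "h (t, x) \<in> W (s (real i / real N))"
      if x: "x \<in> K" "dist x0 x \<le> e/2" and t: "real i / real N \<le> t" "t \<le> real (Suc i) / real N" for x t
    proof -
      have "real (Suc i) / real N = real i / real N + 1 / real N" by (simp add: add_divide_distrib)
      then have d: "\<bar>real i / real N - t\<bar> < e / 2" using t N(2) by auto
      have "dist (real i / real N, x0) (t, x) \<le> \<bar>real i / real N - t\<bar> + dist x0 x"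
        unfolding dist_Pair_Pair dist_real_def
        by (rule order_trans[OF sqrt_sum_squares_le_sum_abs]) simp
      then have "(t, x) \<in> ball (real i / real N, x0) e" using d x by simp
      then have "(t, x) \<in> V (s (real i / real N))" using si by blast
      moreover have "t \<in> {0..1}"
      proof -
        have "real (Suc i) / real N \<le> 1" using i by (simp add: divide_le_eq)
        moreover have "0 \<le> t" using order_trans[OF _ t(1), of 0] by simp
        ultimately show ?thesis using t(2) by simp
      qed
      ultimately show ?thesis using VW[of "s (real i / real N)"] si x by blast
    qed
    then show ?thesis using VW[of "s (real i / real N)"] si by (auto simp: mem_cball)
  qed
  then show ?thesis using e(1) N(1) by (intro exI[of _ "e/2"] conjI exI[of _ N] exI[of _ "\<lambda>i. W (s (real i / real N))"]) auto
qed

text \<open>Around each parameter there is a ball over which the path passes through finitely many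
  good sets, one per time slot. Visiting countably many such balls in turn, stage \<open>n\<close>
  raises the stopping time by a bump supported in the n-th ball, capped at 1. Near every parameter
  the stopping time is 1 after finitely many stages, after which nothing changes, so the limit is
  continuous.\<close>

lemma has_transport_local:
  assumes X: "Hausdorff_space X"
    and loc: "\<And>p. p \<in> topspace X \<Longrightarrow> \<exists>W. openin X W \<and> p \<in> W \<and>
      has_transport TYPE('k::{metric_space, second_countable_topology}) (subtopology X W) lab"
  shows "has_transport TYPE('k) X lab"
  unfolding has_transport_def
proof (intro allI impI, elim conjE)
  fix K :: "'k set" and h u
  assume h: "iso_homotopy K X lab h" and u: "continuous_map (top_of_set K) X u"
  note hc = iso_homotopyD(1)[OF h]
  show "\<exists>H. transports K X lab h u H"
  proof (cases "K = {}")
    case True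
    then show ?thesis by (simp add: transports_def continuous_map_def)
  next
    case False
    have "\<forall>x0\<in>K. \<exists>r>0. \<exists>N>0. \<exists>W. \<forall>i<N. openin X (W i) \<and> has_transport TYPE('k) (subtopology X (W i)) lab \<and>
      (\<forall>x \<in> K \<inter> cball x0 r. \<forall>t. real i / real N \<le> t \<and> t \<le> real (Suc i) / real N \<longrightarrow> h (t, x) \<in> W i)"
      using chunks_near_point[OF hc _ loc] by blast
    then obtain r N W where rNW: "\<And>x0. x0 \<in> K \<Longrightarrow> r x0 > (0::real) \<and> N x0 > (0::nat) \<and>
      (\<forall>i<N x0. openin X (W x0 i) \<and> has_transport TYPE('k) (subtopology X (W x0 i)) lab \<and>
      (\<forall>x \<in> K \<inter> cball x0 (r x0). \<forall>t. real i / real (N x0) \<le> t \<and> t \<le> real (Suc i) / real (N x0) \<longrightarrow> h (t, x) \<in> W x0 i))"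
      by metis
    \<comment> \<open>Balls of half the radius already cover \<open>K\<close>, and on the half ball
      around \<open>d\<close> the bump is at least \<open>r d / 2\<close>. Boundedly many visits to
      \<open>d\<close> therefore suffice for the whole half ball at once.\<close>
    obtain \<F> where \<F>: "\<F> \<subseteq> (\<lambda>x. ball x (r x / 2)) ` K" "countable \<F>" "\<Union>\<F> = \<Union> ((\<lambda>x. ball x (r x / 2)) ` K)"
      by (rule Lindelof[of "(\<lambda>x. ball x (r x / 2)) ` K"]) blast+
    then obtain D where D: "countable D" "D \<subseteq> K" "\<F> = (\<lambda>x. ball x (r x / 2)) ` D"
      using countable_subset_image[THEN iffD1, OF conjI[OF \<F>(2,1)]] by blast
    have Dcov: "\<exists>d\<in>D. x \<in> ball d (r d / 2)" if "x \<in> K" for x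
    proof -
      have "x \<in> \<Union> ((\<lambda>x. ball x (r x / 2)) ` K)" using that rNW by force
      then have "x \<in> (\<Union>d\<in>D. ball d (r d / 2))" using \<F>(3) D(3) by simp
      then show ?thesis by blast
    qed
    have Dne: "D \<noteq> {}" using Dcov False by auto
    \<comment> \<open>Every ball occurs infinitely often, so the stopping times below reach 1 after finitely many steps.\<close>
    define c where "c = (\<lambda>n. from_nat_into D (fst (prod_decode n)))"
    have cD: "c n \<in> D" for n using from_nat_into[OF Dne] by (simp add: c_def)
    have cK: "c n \<in> K" for n using cD D(2) by auto
    define \<mu> where "\<mu> = (\<lambda>n x. max 0 (r (c n) - dist (c n) x))"
    define \<sigma> where "\<sigma> = rec_nat (\<lambda>x. 0) (\<lambda>n s x. min 1 (s x + \<mu> n x))"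
    have \<sigma>0: "\<sigma> 0 x = 0" and \<sigma>S: "\<sigma> (Suc n) x = min 1 (\<sigma> n x + \<mu> n x)" for n x
      by (simp_all add: \<sigma>_def)
    have \<mu>0: "\<mu> n x \<ge> 0" for n x by (simp add: \<mu>_def)
    have \<sigma>01: "0 \<le> \<sigma> n x \<and> \<sigma> n x \<le> 1" for n x
      by (induction n) (use \<mu>0 in \<open>auto simp: \<sigma>0 \<sigma>S intro: add_nonneg_nonneg\<close>)
    have \<sigma>mono1: "\<sigma> n x \<le> \<sigma> (Suc n) x" for n x using \<sigma>01[of n x] \<mu>0[of n x] by (simp add: \<sigma>S)
    have \<sigma>mono: "\<sigma> n x \<le> \<sigma> m x" if "n \<le> m" for n m x
      using \<sigma>mono1 that by (rule lift_Suc_mono_le)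
    have \<sigma>c: "continuous_on K (\<sigma> n)" for n
    proof (induction n)
      case 0
      then show ?case using \<sigma>0 by (simp cong: continuous_on_cong)
    next
      case (Suc n)
      have "continuous_on K (\<lambda>x. min 1 (\<sigma> n x + \<mu> n x))"
        unfolding \<mu>_def by (intro continuous_intros Suc)
      then show ?case by (simp add: \<sigma>S cong: continuous_on_cong)
    qed
    have reach: "\<exists>n. \<forall>y \<in> ball d (r d / 2). \<sigma> n y = 1" if d: "d \<in> D" for d
    proof -
      have rd: "r d > 0" using rNW d D(2) by auto
      have "\<exists>n. \<forall>y \<in> ball d (r d / 2). min 1 (real k * (r d / 2)) \<le> \<sigma> n y" for k
      proof (induction k)
        case 0
        then show ?case using \<sigma>01 by auto
      next
        case (Suc k)
        then obtain n where n: "\<forall>y \<in> ball d (r d / 2). min 1 (real k * (r d / 2)) \<le> \<sigma> n y" by blast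
        \<comment> \<open>A later visit to \<open>d\<close>: the code of a pair is at least its
          second component, so pairing the index of \<open>d\<close> with \<open>n\<close> gives a
          stage not before \<open>n\<close>.\<close>
        define m where "m = prod_encode (to_nat_on D d, n)"
        have cm: "c m = d" using D(1) d by (simp add: c_def m_def)
        have nm: "n \<le> m" unfolding m_def by (rule le_prod_encode_2)
        have "min 1 (real (Suc k) * (r d / 2)) \<le> \<sigma> (Suc m) y" if y: "y \<in> ball d (r d / 2)" for y
        proof -
          have "\<mu> m y \<ge> r d / 2" using y by (simp add: \<mu>_def cm max_def)
          moreover have "min 1 (real k * (r d / 2)) \<le> \<sigma> m y" using n y \<sigma>mono[OF nm, of y] by force
          ultimately show ?thesis using rd \<mu>0[of m y] by (auto simp: \<sigma>S algebra_simps min_le_iff_disj)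
        qed
        then show ?case by blast
      qed
      moreover obtain k :: nat where "1 / (r d / 2) < real k" using reals_Archimedean2 by blast
      then have "min 1 (real k * (r d / 2)) = 1" using rd by (simp add: field_simps)
      ultimately obtain n where "\<forall>y \<in> ball d (r d / 2). 1 \<le> \<sigma> n y" by metis
      then show ?thesis using \<sigma>01 by (meson order_antisym)
    qed
    have "\<exists>F. \<forall>n. transports_until K X lab h u (\<sigma> n) (F n) \<and>
      (\<forall>x\<in>K. \<forall>t\<in>{0..1}. t \<le> \<sigma> n x \<longrightarrow> F (Suc n) (t, x) = F n (t, x))"
    proof (rule dependent_nat_choice)
      have "continuous_map (top_of_set ({0..1::real} \<times> K)) X (\<lambda>p. u (snd p))"
        by (rule continuous_map_reparam[OF u]) (auto intro!: continuous_intros)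
      then show "\<exists>F. transports_until K X lab h u (\<sigma> 0) F"
        by (intro exI[of _ "\<lambda>p. u (snd p)"]) (auto simp: transports_until_def transports_def \<sigma>0)
      fix F n assume F: "transports_until K X lab h u (\<sigma> n) F"
      let ?C = "K \<inter> cball (c n) (r (c n))"
      show "\<exists>F'. transports_until K X lab h u (\<sigma> (Suc n)) F' \<and>
        (\<forall>x\<in>K. \<forall>t\<in>{0..1}. t \<le> \<sigma> n x \<longrightarrow> F' (t, x) = F (t, x))"
      proof (rule transports_until_chunks[where N = "N (c n)" and W = "W (c n)" and C = ?C, OF X _ h F \<sigma>c \<sigma>c])
        show "closedin (top_of_set K) ?C" by (auto intro: closedin_closed_Int)
        show "\<sigma> (Suc n) x = \<sigma> n x" if "x \<in> K - ?C" for x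
          using that \<sigma>01[of n x] by (auto simp: \<sigma>S \<mu>_def max_def min_def)
      qed (use rNW[OF cK[of n]] \<sigma>01 \<sigma>mono1 in auto)
    qed
    then obtain F where F: "\<And>n. transports_until K X lab h u (\<sigma> n) (F n)"
      "\<And>n x t. x \<in> K \<Longrightarrow> t \<in> {0..1} \<Longrightarrow> t \<le> \<sigma> n x \<Longrightarrow> F (Suc n) (t, x) = F n (t, x)" by blast
    have stab: "F m (t, x) = F n (t, x)" if "x \<in> K" "t \<in> {0..1}" "\<sigma> n x = 1" "n \<le> m" for m n t x
      using that(4)
    proof (induction m rule: dec_induct)
      case (step m)
      have "\<sigma> m x = 1" using \<sigma>mono[OF step.hyps(1), of x] \<sigma>01[of m x] that(3) by simp
      then show ?case using F(2)[OF that(1,2), of m] step.IH that(2) by simp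
    qed simp
    have ex1: "\<exists>n. \<sigma> n x = 1" if "x \<in> K" for x using Dcov[OF that] reach by blast
    \<comment> \<open>The choice of the least stage is immaterial: by \<open>stab\<close> every
      stage whose stopping time at \<open>x\<close> is 1 gives the same value, which makes
      \<open>G\<close> locally a single \<open>F n\<close>.\<close>
    define G where "G = (\<lambda>(t, x). F (LEAST n. \<sigma> n x = 1) (t, x))"
    have G: "G (t, x) = F n (t, x)" if "x \<in> K" "t \<in> {0..1}" "\<sigma> n x = 1" for n t x
    proof -
      have "\<sigma> (LEAST n. \<sigma> n x = 1) x = 1" "(LEAST n. \<sigma> n x = 1) \<le> n"
        using that(3) by (rule LeastI, rule Least_le)
      then show ?thesis using stab[OF that(1,2), of "LEAST n. \<sigma> n x = 1" n] by (simp add: G_def)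
    qed
    have Gc: "continuous_map (top_of_set ({0..1} \<times> K)) X G"
    proof (rule continuous_map_locally)
      fix p assume "p \<in> {0..1::real} \<times> K"
      then obtain t x where p: "p = (t, x)" "t \<in> {0..1}" "x \<in> K" by auto
      obtain d where d: "d \<in> D" "x \<in> ball d (r d / 2)" using Dcov[OF p(3)] by blast
      obtain n where n: "\<forall>y \<in> ball d (r d / 2). \<sigma> n y = 1" using reach[OF d(1)] by blast
      let ?B = "K \<inter> ball d (r d / 2)"
      have "continuous_map (top_of_set ({0..1} \<times> K)) X (F n)"
        using F(1)[of n] by (simp add: transports_until_def transports_def)
      then have "continuous_map (top_of_set ({0..1} \<times> ?B)) X (F n)"
        by (rule continuous_map_subset) auto
      then have "continuous_map (top_of_set ({0..1} \<times> ?B)) X G"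
        by (rule continuous_map_cong_on) (use G n in auto)
      moreover have "openin (top_of_set K) ?B" by (auto intro: openin_open_Int)
      ultimately show "\<exists>U. openin (top_of_set ({0..1} \<times> K)) U \<and> p \<in> U \<and> continuous_map (top_of_set U) X G"
        using openin_cylinder p d(2) by blast
    qed
    have "G (0, x) = u x \<and> (\<forall>t\<in>{0..1}. lab (G (t, x)) = lab (u x)) \<and>
        (u x = h (0, x) \<longrightarrow> (\<forall>t\<in>{0..1}. G (t, x) = h (t, x)))" if x: "x \<in> K" for x
    proof -
      obtain n where n: "\<sigma> n x = 1" using ex1[OF x] by blast
      have "G (t, x) = F n (t, x)" if "t \<in> {0..1}" for t using G[OF x that n] .
      then show ?thesis using F(1)[of n] n x
        by (simp add: transports_until_def transports_def min_def)
    qed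
    then show ?thesis using Gc unfolding transports_def by blast
  qed
qed

section \<open>Linear representations\<close>

text \<open>Transport sees only the partition of the space into classes of equal label, so the
  labels on the two sides may even have different types.\<close>

lemma has_transport_homeomorphic:
  assumes Y: "has_transport TYPE('k::{metric_space, second_countable_topology}) Y lab'"
    and fg: "homeomorphic_maps X Y f g"
    and lab: "\<And>p q. p \<in> topspace X \<Longrightarrow> q \<in> topspace X \<Longrightarrow> lab p = lab q \<longleftrightarrow> lab' (f p) = lab' (f q)"
  shows "has_transport TYPE('k) X lab"
  unfolding has_transport_def
proof (intro allI impI, elim conjE)
  fix K :: "'k set" and h u
  assume h: "iso_homotopy K X lab h" and u: "continuous_map (top_of_set K) X u"
  note hc = iso_homotopyD(1)[OF h]
  have f: "continuous_map X Y f" and g: "continuous_map Y X g"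
    and gf: "\<And>p. p \<in> topspace X \<Longrightarrow> g (f p) = p" and fg': "\<And>p. p \<in> topspace Y \<Longrightarrow> f (g p) = p"
    using fg by (auto simp: homeomorphic_maps_def)
  have hX: "h (t, x) \<in> topspace X" if "x \<in> K" "t \<in> {0..1}" for t x
    using continuous_map_funspace[OF hc] that by auto
  have uX: "u x \<in> topspace X" if "x \<in> K" for x
    using continuous_map_funspace[OF u] that by auto
  have "iso_homotopy K Y lab' (\<lambda>p. f (h p))"
  proof (rule iso_homotopyI)
    show "continuous_map (top_of_set ({0..1} \<times> K)) Y (\<lambda>p. f (h p))"
      using continuous_map_compose[OF hc f] by (simp add: o_def)
    show "lab' (f (h (t, x))) = lab' (f (h (0, x)))" if "x \<in> K" "t \<in> {0..1}" for x t
      using lab[OF hX[OF that] hX[OF that(1), of 0]] iso_homotopyD(2)[OF h that] by simp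
  qed
  moreover have "continuous_map (top_of_set K) Y (\<lambda>x. f (u x))"
    using continuous_map_compose[OF u f] by (simp add: o_def)
  ultimately obtain H where H: "transports K Y lab' (\<lambda>p. f (h p)) (\<lambda>x. f (u x)) H"
    using Y unfolding has_transport_def by blast
  have Hc: "continuous_map (top_of_set ({0..1} \<times> K)) Y H"
    and H0: "\<And>x. x \<in> K \<Longrightarrow> H (0, x) = f (u x)"
    and Hl: "\<And>x t. x \<in> K \<Longrightarrow> t \<in> {0..1} \<Longrightarrow> lab' (H (t, x)) = lab' (f (u x))"
    and Hh: "\<And>x t. x \<in> K \<Longrightarrow> f (u x) = f (h (0, x)) \<Longrightarrow> t \<in> {0..1} \<Longrightarrow> H (t, x) = f (h (t, x))"
    using H unfolding transports_def by blast+
  have HY: "H (t, x) \<in> topspace Y" if "x \<in> K" "t \<in> {0..1}" for t x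
    using continuous_map_funspace[OF Hc] that by auto
  have gX: "g y \<in> topspace X" if "y \<in> topspace Y" for y
    using continuous_map_funspace[OF g] that by auto
  have "continuous_map (top_of_set ({0..1} \<times> K)) X (\<lambda>p. g (H p))"
    using continuous_map_compose[OF Hc g] by (simp add: o_def)
  moreover have "g (H (0, x)) = u x" if "x \<in> K" for x using H0 gf uX that by simp
  moreover have "lab (g (H (t, x))) = lab (u x)" if "x \<in> K" "t \<in> {0..1}" for x t
    using lab[OF gX[OF HY[OF that]] uX[OF that(1)]] Hl[OF that] fg'[OF HY[OF that]] by simp
  moreover have "g (H (t, x)) = h (t, x)" if "x \<in> K" "u x = h (0, x)" "t \<in> {0..1}" for x t
    using Hh[OF that(1) _ that(3)] gf[OF hX[OF that(1,3)]] that(2) by simp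
  ultimately show "\<exists>H. transports K X lab h u H"
    unfolding transports_def by (intro exI[of _ "\<lambda>p. g (H p)"]) blast
qed

lemma has_transport_relabel:
  assumes "has_transport TYPE('k::{metric_space, second_countable_topology}) X lab'"
    and "\<And>p q. p \<in> topspace X \<Longrightarrow> q \<in> topspace X \<Longrightarrow> lab p = lab q \<longleftrightarrow> lab' p = lab' q"
  shows "has_transport TYPE('k) X lab"
  by (rule has_transport_homeomorphic[OF assms(1), where f = "\<lambda>x. x" and g = "\<lambda>x. x"])
    (use assms(2) in \<open>auto simp: homeomorphic_maps_def\<close>)

section \<open>Relative neighbourhoods and the cone over a transverse direction\<close>

lemma continuous_onI_openin:
  fixes f :: "'a::metric_space \<Rightarrow> 'b::metric_space"
  assumes "\<And>p e. p \<in> S \<Longrightarrow> e > 0 \<Longrightarrow>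
    \<exists>U. openin (top_of_set S) U \<and> p \<in> U \<and> (\<forall>q\<in>U. dist (f q) (f p) < e)"
  shows "continuous_on S f"
  unfolding continuous_on_iff
proof (intro ballI allI impI)
  fix p and e :: real assume "p \<in> S" "e > 0"
  then obtain U where U: "openin (top_of_set S) U" "p \<in> U" "\<forall>q\<in>U. dist (f q) (f p) < e"
    using assms by blast
  then obtain d where "d > 0" "\<And>q. q \<in> S \<Longrightarrow> dist q p < d \<Longrightarrow> q \<in> U"
    unfolding openin_euclidean_subtopology_iff by blast
  then show "\<exists>d>0. \<forall>q\<in>S. dist q p < d \<longrightarrow> dist (f q) (f p) < e" using U(3) by blast
qed

lemma continuous_onD_openin:
  fixes f :: "'a::metric_space \<Rightarrow> 'b::metric_space"
  assumes "continuous_on U f" "openin (top_of_set S) U" "p \<in> U" "e > 0"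
  shows "\<exists>V. openin (top_of_set S) V \<and> p \<in> V \<and> (\<forall>q\<in>V. dist (f q) (f p) < e)"
proof -
  have "openin (top_of_set U) (U \<inter> f -` ball (f p) e)"
    by (rule continuous_openin_preimage_gen[OF assms(1)]) simp
  then have "openin (top_of_set S) (U \<inter> f -` ball (f p) e)"
    using assms(2) openin_trans by blast
  then show ?thesis using assms(3,4) by (intro exI[of _ "U \<inter> f -` ball (f p) e"]) (auto simp: dist_commute)
qed

text \<open>The direction of a vector transverse to the deepest stratum is transported by hypothesis; its
  length is rescaled, and the motion is damped by \<open>\<kappa>\<close> once the transported vector is long
  compared with the transporting one, which gives continuity at the deepest stratum.\<close>

lemma has_transport_cone:
  fixes S :: "'v::real_normed_vector set" and A :: "'v \<Rightarrow> 'v"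
  assumes S: "subspace S" and A: "bounded_linear A"
    and AS: "\<And>v. v \<in> S \<Longrightarrow> A v \<in> S" and AA: "\<And>v. v \<in> S \<Longrightarrow> A (A v) = A v"
    and top: "\<And>v w. v \<in> S \<Longrightarrow> w \<in> S \<Longrightarrow> lab v = lab w \<Longrightarrow> A v = v \<Longrightarrow> A w = w"
    and add: "\<And>v z. v \<in> S \<Longrightarrow> z \<in> S \<Longrightarrow> A z = z \<Longrightarrow> lab (v + z) = lab v"
    and scale: "\<And>v c. v \<in> S \<Longrightarrow> c > 0 \<Longrightarrow> lab (c *\<^sub>R v) = lab v"
    and TP: "has_transport TYPE('k::{metric_space, second_countable_topology}) (top_of_set {v \<in> S. A v \<noteq> v}) lab"
  shows "has_transport TYPE('k) (top_of_set S) lab"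
  unfolding has_transport_def
proof (intro allI impI, elim conjE)
  fix K :: "'k set" and h u
  assume h: "iso_homotopy K (top_of_set S) lab h" and u: "continuous_map (top_of_set K) (top_of_set S) u"
  interpret A: bounded_linear A by (rule A)
  let ?I = "{0..1::real}"
  have hc: "continuous_on (?I \<times> K) h" and hS: "\<And>t x. x \<in> K \<Longrightarrow> t \<in> ?I \<Longrightarrow> h (t, x) \<in> S"
    using iso_homotopyD(1)[OF h] by auto
  note hl = iso_homotopyD(2)[OF h]
  have uc: "continuous_on K u" and uS: "\<And>x. x \<in> K \<Longrightarrow> u x \<in> S" using u by auto
  \<comment> \<open>On \<open>S\<close>, \<open>A\<close> is a projection onto the deepest stratum;
    \<open>w\<close> and \<open>b\<close> are the transverse components of the path and of the
    point. By \<open>add\<close>, discarding the component along the stratum does not change the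
    label.\<close>
  define w where "w = (\<lambda>p. h p - A (h p))"
  define b where "b = (\<lambda>x. u x - A (u x))"
  have proj: "v - A v \<in> S \<and> A (v - A v) = 0 \<and> lab (v - A v) = lab v" if v: "v \<in> S" for v
  proof -
    have "- A v \<in> S" using S AS[OF v] subspace_neg by blast
    moreover have "A (- A v) = - A v" using AA[OF v] by (simp add: A.neg)
    ultimately show ?thesis using add[OF v, of "- A v"] S AS[OF v] AA[OF v] v
      by (auto simp: A.diff subspace_diff)
  qed
  have wc: "continuous_on (?I \<times> K) w"
    unfolding w_def by (intro continuous_intros hc A.continuous_on)
  have bc: "continuous_on K b"
    unfolding b_def by (intro continuous_intros uc A.continuous_on)
  have wS: "w (t, x) \<in> S" and Aw: "A (w (t, x)) = 0" and wl: "lab (w (t, x)) = lab (h (t, x))"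
    if "x \<in> K" "t \<in> ?I" for t x
    using proj[OF hS[OF that]] by (auto simp: w_def)
  have bS: "b x \<in> S" and Ab: "A (b x) = 0" and bl: "lab (b x) = lab (u x)" if "x \<in> K" for x
    using proj[OF uS[OF that]] by (auto simp: b_def)
  \<comment> \<open>A path of constant label lies either entirely in the deepest stratum or entirely
    outside it.\<close>
  have w0: "w (t, x) = 0 \<longleftrightarrow> w (0, x) = 0" if x: "x \<in> K" and t: "t \<in> ?I" for t x
  proof -
    have "w (t, x) = 0 \<longleftrightarrow> A (h (t, x)) = h (t, x)" "w (0, x) = 0 \<longleftrightarrow> A (h (0, x)) = h (0, x)"
      by (auto simp: w_def)
    then show ?thesis using top[OF hS[OF x t] hS[OF x, of 0] hl[OF x t]]
        top[OF hS[OF x, of 0] hS[OF x t] hl[OF x t, symmetric]] by auto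
  qed
  have w0c: "continuous_on K (\<lambda>x. w (0, x))"
    by (rule continuous_on_compose2[OF wc]) (auto intro!: continuous_intros)
  define K1 where "K1 = {x \<in> K. w (0, x) \<noteq> 0 \<and> b x \<noteq> 0}"
  have K1: "openin (top_of_set K) K1"
  proof -
    have "openin (top_of_set K) (K \<inter> (\<lambda>x. (w (0, x), b x)) -` ((- {0}) \<times> (- {0})))"
      by (intro continuous_openin_preimage_gen continuous_intros w0c bc open_Times)
    moreover have "K \<inter> (\<lambda>x. (w (0, x), b x)) -` ((- {0}) \<times> (- {0})) = K1" by (auto simp: K1_def)
    ultimately show ?thesis by simp
  qed
  have K1K: "K1 \<subseteq> K" by (auto simp: K1_def)
  have wn: "w (t, x) \<noteq> 0" if "x \<in> K1" "t \<in> ?I" for t x using w0[of x t] that by (auto simp: K1_def)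
  define U where "U = {v \<in> S. A v \<noteq> v}"
  define hd where "hd = (\<lambda>p. (1 / norm (w p)) *\<^sub>R w p)"
  define ud where "ud = (\<lambda>x. (1 / norm (b x)) *\<^sub>R b x)"
  have Ahd: "A (hd (t, x)) = 0" "norm (hd (t, x)) = 1" "hd (t, x) \<in> S" "lab (hd (t, x)) = lab (h (t, x))"
    if "x \<in> K1" "t \<in> ?I" for t x
    using that wn[OF that] Aw[of x t] wS[of x t] wl[of x t] K1K S
      scale[of "w (t, x)" "1 / norm (w (t, x))"]
    by (auto simp: hd_def A.scaleR subspace_scale)
  have Aud: "A (ud x) = 0" "norm (ud x) = 1" "ud x \<in> S" "lab (ud x) = lab (u x)" if "x \<in> K1" for x
    using that Ab[of x] bS[of x] bl[of x] K1K S scale[of "b x" "1 / norm (b x)"]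
    by (auto simp: ud_def A.scaleR subspace_scale K1_def)
  have "iso_homotopy K1 (top_of_set U) lab hd"
  proof (rule iso_homotopyI)
    have "continuous_on (?I \<times> K1) w" by (rule continuous_on_subset[OF wc]) (use K1K in auto)
    then have "continuous_on (?I \<times> K1) hd"
      unfolding hd_def using wn by (intro continuous_intros) auto
    moreover have "hd (t, x) \<in> U" if "x \<in> K1" "t \<in> ?I" for t x
      using Ahd[OF that] by (auto simp: U_def)
    ultimately show "continuous_map (top_of_set (?I \<times> K1)) (top_of_set U) hd" by auto
    show "lab (hd (t, x)) = lab (hd (0, x))" if "x \<in> K1" "t \<in> ?I" for x t
      using Ahd(4)[OF that] Ahd(4)[OF that(1), of 0] hl[of x t] that K1K by auto
  qed
  moreover have "continuous_map (top_of_set K1) (top_of_set U) ud"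
  proof -
    have "continuous_on K1 ud"
      unfolding ud_def using continuous_on_subset[OF bc K1K] by (intro continuous_intros) (auto simp: K1_def)
    moreover have "ud x \<in> U" if "x \<in> K1" for x using Aud[OF that] by (auto simp: U_def)
    ultimately show ?thesis by auto
  qed
  ultimately obtain T where T: "transports K1 (top_of_set U) lab hd ud T"
    using TP unfolding has_transport_def U_def by blast
  have Tc: "continuous_on (?I \<times> K1) T" and TU: "\<And>t x. x \<in> K1 \<Longrightarrow> t \<in> ?I \<Longrightarrow> T (t, x) \<in> U"
    using T unfolding transports_def by auto
  have T0: "\<And>x. x \<in> K1 \<Longrightarrow> T (0, x) = ud x"
    and Tl: "\<And>t x. x \<in> K1 \<Longrightarrow> t \<in> ?I \<Longrightarrow> lab (T (t, x)) = lab (ud x)"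
    and Th: "\<And>t x. x \<in> K1 \<Longrightarrow> ud x = hd (0, x) \<Longrightarrow> t \<in> ?I \<Longrightarrow> T (t, x) = hd (t, x)"
    using T unfolding transports_def by blast+
  \<comment> \<open>\<open>T\<close> is only known to stay outside the deepest stratum; it may
    acquire a component along it and change its length. \<open>V\<close> removes the component and
    is still nonzero; the length is corrected in \<open>Y\<close>.\<close>
  define V where "V = (\<lambda>p. T p - A (T p))"
  have Vc: "continuous_on (?I \<times> K1) V"
    unfolding V_def by (intro continuous_intros Tc A.continuous_on)
  have V: "V (t, x) \<noteq> 0" "V (t, x) \<in> S" "lab (V (t, x)) = lab (u x)" if "x \<in> K1" "t \<in> ?I" for t x
    using TU[OF that] proj[of "T (t, x)"] Tl[OF that] Aud(4)[OF that(1)] by (auto simp: V_def U_def)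
  have V0: "V (0, x) = ud x" if "x \<in> K1" for x using T0[OF that] Aud[OF that] by (simp add: V_def)
  \<comment> \<open>\<open>\<kappa>\<close> is 1 for
    \<open>norm (b x) \<le> norm (w (0, x))\<close>, in particular when the point starts its path,
    and 0 once the quotient of the norms reaches 2.\<close>
  define \<kappa> where "\<kappa> = (\<lambda>x. max 0 (min 1 (2 - norm (b x) / norm (w (0, x)))))"
  have \<kappa>t: "\<kappa> x * t \<in> ?I" if "t \<in> ?I" for t x
    using that by (auto simp: \<kappa>_def max_def min_def mult_le_one)
  \<comment> \<open>The length is chosen so that its ratio to the length of \<open>w\<close> at the
    damped time stays constant. Outside \<open>K1\<close> the point or the path has no direction,
    and the transverse part rests.\<close>
  define Y where "Y = (\<lambda>(t, x). if x \<in> K1 then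
      (norm (b x) / norm (w (0, x)) * norm (w (\<kappa> x * t, x)) / norm (V (\<kappa> x * t, x))) *\<^sub>R V (\<kappa> x * t, x)
    else b x)"
  have YK1: "continuous_on (?I \<times> K1) Y"
  proof -
    have \<kappa>c: "continuous_on K1 \<kappa>"
      unfolding \<kappa>_def using continuous_on_subset[OF bc K1K] continuous_on_subset[OF w0c K1K]
      by (intro continuous_intros) (auto simp: K1_def)
    have p: "continuous_on (?I \<times> K1) (\<lambda>q. (\<kappa> (snd q) * fst q, snd q))"
      by (intro continuous_intros continuous_on_compose2[OF \<kappa>c]) auto
    have pm: "(\<lambda>q. (\<kappa> (snd q) * fst q, snd q)) ` (?I \<times> K1) \<subseteq> ?I \<times> K1" using \<kappa>t by auto
    have c1: "continuous_on (?I \<times> K1) (\<lambda>q. V (\<kappa> (snd q) * fst q, snd q))"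
      by (rule continuous_on_compose2[OF Vc p pm])
    have c2: "continuous_on (?I \<times> K1) (\<lambda>q. w (\<kappa> (snd q) * fst q, snd q))"
      by (rule continuous_on_compose2[OF wc p]) (use pm K1K in blast)
    have c3: "continuous_on (?I \<times> K1) (\<lambda>q. b (snd q))"
      by (rule continuous_on_compose2[OF bc]) (use K1K in \<open>auto intro!: continuous_intros\<close>)
    have c4: "continuous_on (?I \<times> K1) (\<lambda>q. w (0, snd q))"
      by (rule continuous_on_compose2[OF w0c]) (use K1K in \<open>auto intro!: continuous_intros\<close>)
    have "continuous_on (?I \<times> K1) (\<lambda>q. (norm (b (snd q)) / norm (w (0, snd q)) *
        norm (w (\<kappa> (snd q) * fst q, snd q)) / norm (V (\<kappa> (snd q) * fst q, snd q))) *\<^sub>R V (\<kappa> (snd q) * fst q, snd q))"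
      using V(1)[OF _ \<kappa>t] by (intro continuous_intros c1 c2 c3 c4) (auto simp: K1_def)
    then show ?thesis by (rule continuous_on_eq) (auto simp: Y_def)
  qed
  have Yb: "Y (t, x) = b x" if x: "x \<in> K" "2 * norm (w (0, x)) \<le> norm (b x)" for t x
  proof (cases "x \<in> K1")
    case True
    then have "2 \<le> norm (b x) / norm (w (0, x))" using x by (simp add: K1_def le_divide_eq)
    then have "\<kappa> x = 0" by (simp add: \<kappa>_def)
    then show ?thesis using True V0[OF True] Aud[OF True]
      by (simp add: Y_def) (simp add: ud_def K1_def)
  qed (simp add: Y_def)
  have Yn: "norm (Y (t, x)) = norm (b x) / norm (w (0, x)) * norm (w (\<kappa> x * t, x))"
    if "x \<in> K1" "t \<in> ?I" for t x
    using V(1)[OF that(1) \<kappa>t[OF that(2)]] that by (simp add: Y_def)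
  have Yc: "continuous_on (?I \<times> K) Y"
  proof (rule continuous_onI_openin)
    fix p and e :: real assume "p \<in> ?I \<times> K" and e: "e > 0"
    then obtain t x where p: "p = (t, x)" "t \<in> ?I" "x \<in> K" by auto
    consider "x \<in> K1" | "b x \<noteq> 0" "w (0, x) = 0" | "b x = 0" "w (0, x) = 0" | "b x = 0" "w (0, x) \<noteq> 0"
      using p by (auto simp: K1_def)
    then show "\<exists>U. openin (top_of_set (?I \<times> K)) U \<and> p \<in> U \<and> (\<forall>q\<in>U. dist (Y q) (Y p) < e)"
    proof cases
      case 1
      show ?thesis
        by (rule continuous_onD_openin[OF YK1 openin_cylinder[OF K1]]) (use 1 p e in auto)
    next
      \<comment> \<open>Nearby \<open>norm (b y)\<close> exceeds twice
        \<open>norm (w (0, y))\<close>, so the motion is completely damped and \<open>Y\<close> is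
        just \<open>b\<close>.\<close>
      case 2
      define B where "B = K \<inter> (\<lambda>x. norm (b x) - 2 * norm (w (0, x))) -` {0<..}"
      have B: "openin (top_of_set K) B"
        unfolding B_def by (intro continuous_openin_preimage_gen continuous_intros bc w0c)
      have "continuous_on (?I \<times> B) (\<lambda>q. b (snd q))"
        by (rule continuous_on_compose2[OF bc]) (auto intro!: continuous_intros simp: B_def)
      then have "continuous_on (?I \<times> B) Y"
        by (rule continuous_on_eq) (auto simp: B_def Yb)
      then show ?thesis
        by (rule continuous_onD_openin[OF _ openin_cylinder[OF B]]) (use 2 p e in \<open>auto simp: B_def\<close>)
    next
      \<comment> \<open>By \<open>w0\<close> the path at \<open>x\<close> stays in the deepest
        stratum, so the tube lemma makes \<open>w\<close> small uniformly in time. Where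
        \<open>Y\<close> moves at all, the quotient of the norms is below 2 and \<open>Y\<close> is
        at most twice as long as \<open>w\<close>; elsewhere \<open>Y\<close> is the small vector
        \<open>b\<close>.\<close>
      case 3
      have Y0: "Y p = 0" using 3 p by (simp add: Y_def K1_def)
      define B where "B = {x \<in> K. \<forall>s\<in>?I. w (s, x) \<in> ball 0 (e / 2)} \<inter> (K \<inter> b -` ball 0 e)"
      have B: "openin (top_of_set K) B"
        unfolding B_def
        by (intro openin_Int openin_tube[where X = euclidean] continuous_openin_preimage_gen bc) (use wc in auto)
      have "dist (Y (s, y)) (Y p) < e" if "s \<in> ?I" "y \<in> B" for s y
      proof (cases "y \<in> K1 \<and> norm (b y) < 2 * norm (w (0, y))")
        case True
        then have "norm (b y) / norm (w (0, y)) \<le> 2" by (simp add: K1_def divide_simps)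
        then have "norm (Y (s, y)) \<le> 2 * norm (w (\<kappa> y * s, y))"
          unfolding Yn[OF conjunct1[OF True] that(1)] by (intro mult_right_mono) auto
        moreover have "norm (w (\<kappa> y * s, y)) < e / 2" using \<kappa>t[OF that(1), of y] that(2) by (auto simp: B_def)
        ultimately show ?thesis by (simp add: Y0)
      next
        case False
        then have "Y (s, y) = b y" using Yb[of y s] that by (auto simp: Y_def B_def)
        then show ?thesis using that by (simp add: Y0 B_def)
      qed
      moreover have "w (s, x) = 0" if "s \<in> ?I" for s
        using w0[OF p(3) that] 3 by simp
      then have "x \<in> B" using 3 p e by (auto simp: B_def)
      ultimately show ?thesis using openin_cylinder[OF B] p by blast
    next
      \<comment> \<open>The bound on the length of \<open>Y\<close> is multiplied by
        \<open>norm (w (0, y))\<close> to avoid the division; being strict, it also forces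
        \<open>w (0, y) \<noteq> 0\<close> for all \<open>y\<close> in \<open>B\<close>.\<close>
      case 4
      have Y0: "Y p = 0" using 4 p by (simp add: Y_def K1_def)
      define B where "B = {x \<in> K. \<forall>s\<in>?I. (\<lambda>q. e * norm (w (0, snd q)) - norm (b (snd q)) * norm (w q)) (s, x) \<in> {0<..}}"
      have B: "openin (top_of_set K) B"
        unfolding B_def
      proof (rule openin_tube[where X = euclidean])
        have "continuous_on (?I \<times> K) (\<lambda>q. w (0, snd q))" "continuous_on (?I \<times> K) (\<lambda>q. b (snd q))"
          by (rule continuous_on_compose2[OF w0c] continuous_on_compose2[OF bc]; auto intro!: continuous_intros)+
        then show "continuous_map (top_of_set (?I \<times> K)) euclidean
            (\<lambda>q. e * norm (w (0, snd q)) - norm (b (snd q)) * norm (w q))"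
          using wc by (auto intro!: continuous_intros)
      qed auto
      have "dist (Y (s, y)) (Y p) < e" if "s \<in> ?I" "y \<in> B" for s y
      proof -
        have pos: "norm (b y) * norm (w (s, y)) < e * norm (w (0, y))" if "s \<in> ?I" for s
          using \<open>y \<in> B\<close> that by (auto simp: B_def)
        then have "0 < e * norm (w (0, y))"
          using pos[of 0] by (meson atLeastAtMost_iff le_less_trans mult_nonneg_nonneg norm_ge_zero order_refl zero_le_one)
        then have wy: "w (0, y) \<noteq> 0" by auto
        show ?thesis
        proof (cases "y \<in> K1")
          case True
          then show ?thesis using pos[OF \<kappa>t[OF that(1)], of y] wy by (simp add: Y0 Yn[OF True that(1)] divide_simps)
        next
          case False
          then have "Y (s, y) = 0" using that wy by (auto simp: Y_def K1_def B_def)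
          then show ?thesis using e by (simp add: Y0)
        qed
      qed
      moreover have "x \<in> B" using 4 p e by (auto simp: B_def)
      ultimately show ?thesis using openin_cylinder[OF B] p by blast
    qed
  qed
  have YS: "Y (t, x) \<in> S \<and> lab (Y (t, x)) = lab (u x)" if "x \<in> K" "t \<in> ?I" for t x
  proof (cases "x \<in> K1")
    case True
    note kt = \<kappa>t[OF that(2), of x]
    have "norm (b x) / norm (w (0, x)) * norm (w (\<kappa> x * t, x)) / norm (V (\<kappa> x * t, x)) > 0"
      using True wn[OF True kt] V(1)[OF True kt] by (auto simp: K1_def)
    from scale[OF V(2)[OF True kt] this] show ?thesis
      using V[OF True kt] True S by (simp add: Y_def subspace_scale)
  next
    case False
    then show ?thesis using bS bl that by (simp add: Y_def)
  qed
  \<comment> \<open>Along the deepest stratum the point is translated by the displacement of the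
    path; this translation vanishes at time 0 and yields \<open>A (h (t, x))\<close> if
    \<open>u x = h (0, x)\<close>.\<close>
  define H where "H = (\<lambda>(t, x). Y (t, x) + (A (u x) + A (h (t, x)) - A (h (0, x))))"
  have Hc: "continuous_on (?I \<times> K) H"
  proof -
    have "continuous_on (?I \<times> K) (\<lambda>q. u (snd q))"
      by (rule continuous_on_compose2[OF uc]) (auto intro!: continuous_intros)
    moreover have "continuous_on (?I \<times> K) (\<lambda>q. h (0, snd q))"
      by (rule continuous_on_compose2[OF hc]) (auto intro!: continuous_intros)
    ultimately have "continuous_on (?I \<times> K) (\<lambda>q. Y q + (A (u (snd q)) + A (h q) - A (h (0, snd q))))"
      by (intro continuous_intros Yc hc A.continuous_on)
    then show ?thesis by (rule continuous_on_eq) (auto simp: H_def)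
  qed
  have HS: "H (t, x) \<in> S \<and> lab (H (t, x)) = lab (u x)" if "x \<in> K" "t \<in> ?I" for t x
  proof -
    let ?z = "A (u x) + A (h (t, x)) - A (h (0, x))"
    have m: "u x \<in> S" "h (t, x) \<in> S" "h (0, x) \<in> S" using uS hS that by auto
    have z: "?z \<in> S" using S AS m by (intro subspace_diff subspace_add) auto
    have "A ?z = ?z" using AA m by (simp add: A.add A.diff)
    from add[OF _ z this, of "Y (t, x)"] show ?thesis
      using YS[OF that] z S by (simp add: H_def subspace_add)
  qed
  have H0: "H (0, x) = u x" if x: "x \<in> K" for x
  proof (cases "x \<in> K1")
    case True
    then have "Y (0, x) = b x" using V0[OF True] Aud[OF True] by (simp add: Y_def) (simp add: ud_def K1_def)
    then show ?thesis by (simp add: H_def b_def)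
  qed (simp add: H_def Y_def b_def)
  have Hh: "H (t, x) = h (t, x)" if x: "x \<in> K" "u x = h (0, x)" "t \<in> ?I" for t x
  proof -
    have bw: "b x = w (0, x)" using x by (simp add: b_def w_def)
    have "Y (t, x) = w (t, x)"
    proof (cases "x \<in> K1")
      case True
      then have "\<kappa> x = 1" using bw by (simp add: \<kappa>_def K1_def)
      moreover have "T (t, x) = hd (t, x)" using Th[OF True _ x(3)] bw by (simp add: ud_def hd_def)
      then have "V (t, x) = hd (t, x)" using Ahd[OF True x(3)] by (simp add: V_def)
      ultimately show ?thesis using True Ahd[OF True x(3)] wn[OF True x(3)] bw
        by (simp add: Y_def) (simp add: hd_def K1_def)
    next
      case False
      then have "w (0, x) = 0" using bw x by (auto simp: K1_def)
      then show ?thesis using w0[OF x(1,3)] False bw by (simp add: Y_def)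
    qed
    then show ?thesis using x by (simp add: H_def w_def)
  qed
  have "continuous_map (top_of_set (?I \<times> K)) (top_of_set S) H" using Hc HS by auto
  then show "\<exists>H. transports K (top_of_set S) lab h u H"
    unfolding transports_def using H0 HS Hh by blast
qed

definition fix_label :: "'g set \<Rightarrow> ('g \<Rightarrow> 'v \<Rightarrow> 'v) \<Rightarrow> 'v \<Rightarrow> 'g set" where
  "fix_label R L v = {r \<in> R. L r v = v}"

text \<open>Induction on the order of \<open>R\<close>, with the representation kept fixed. A point
  not fixed by all of \<open>R\<close> has a proper subgroup \<open>R'\<close> as stabilizer, and
  near it the labels for \<open>R\<close> and \<open>R'\<close> agree, so transport exists locally
  off the fixed subspace and then on its whole complement. The cone construction adds the fixed
  subspace. For trivial \<open>R\<close> the complement is empty, so the induction has no separate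
  base.\<close>

lemma (in group) has_transport_linear:
  fixes S :: "'v::real_normed_vector set" and L :: "'a \<Rightarrow> 'v \<Rightarrow> 'v"
  assumes fin: "finite (carrier G)" and S: "subspace S"
    and L: "\<And>r. r \<in> carrier G \<Longrightarrow> bounded_linear (L r)"
    and LS: "\<And>r v. r \<in> carrier G \<Longrightarrow> v \<in> S \<Longrightarrow> L r v \<in> S"
    and one: "\<And>v. v \<in> S \<Longrightarrow> L \<one> v = v"
    and mult: "\<And>r s v. r \<in> carrier G \<Longrightarrow> s \<in> carrier G \<Longrightarrow> v \<in> S \<Longrightarrow> L (r \<otimes> s) v = L r (L s v)"
    and R: "subgroup R G"
  shows "has_transport TYPE('k::{metric_space, second_countable_topology}) (top_of_set S) (fix_label R L)"
  using R
proof (induction "card R" arbitrary: R rule: less_induct)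
  case less
  note R = less.prems
  have RG: "R \<subseteq> carrier G" using R subgroup.subset by blast
  have Rfin: "finite R" using RG fin finite_subset by blast
  have oneR: "\<one> \<in> R" using R subgroup.one_closed by blast
  have cR: "card R > 0" using Rfin oneR card_gt_0_iff by blast
  \<comment> \<open>Averaging over \<open>R\<close> projects onto the subspace fixed by
    \<open>R\<close>.\<close>
  define A where "A = (\<lambda>v. (1 / real (card R)) *\<^sub>R (\<Sum>r\<in>R. L r v))"
  have Abl: "bounded_linear A"
    unfolding A_def using L RG
    by (intro bounded_linear_compose[OF bounded_linear_scaleR_right] bounded_linear_sum) auto
  have AS: "A v \<in> S" if "v \<in> S" for v
    unfolding A_def using LS RG S that by (intro subspace_scale subspace_sum) auto
  have Afix: "A v = v" if "\<And>r. r \<in> R \<Longrightarrow> L r v = v" for v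
  proof -
    have "(\<Sum>r\<in>R. L r v) = (\<Sum>r\<in>R. v)" by (rule sum.cong) (use that in auto)
    then show ?thesis using cR by (simp add: A_def scaleR_right_distrib sum_constant_scaleR)
  qed
  have LA: "L r (A v) = A v" if r: "r \<in> R" and v: "v \<in> S" for r v
  proof -
    interpret Lr: bounded_linear "L r" using L r RG by blast
    have "bij_betw (\<lambda>s. r \<otimes> s) R R"
    proof (rule bij_betw_byWitness[where f' = "\<lambda>s. inv r \<otimes> s"])
      have "inv r \<in> R" by (rule subgroup.m_inv_closed[OF R r])
      then show "(\<lambda>s. r \<otimes> s) ` R \<subseteq> R" "(\<lambda>s. inv r \<otimes> s) ` R \<subseteq> R"
        using subgroup.m_closed[OF R r] subgroup.m_closed[OF R \<open>inv r \<in> R\<close>] by blast+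
    qed (use r RG in \<open>auto simp: m_assoc[symmetric] subset_iff\<close>)
    then have "(\<Sum>s\<in>R. L (r \<otimes> s) v) = (\<Sum>s\<in>R. L s v)" by (rule sum.reindex_bij_betw)
    moreover have "(\<Sum>s\<in>R. L (r \<otimes> s) v) = (\<Sum>s\<in>R. L r (L s v))"
      by (rule sum.cong) (use mult r RG v in auto)
    ultimately show ?thesis by (simp add: A_def Lr.scaleR Lr.sum)
  qed
  have fixed: "fix_label R L v = R \<longleftrightarrow> A v = v" if v: "v \<in> S" for v
  proof
    assume "fix_label R L v = R"
    then have "L r v = v" if "r \<in> R" for r using that unfolding fix_label_def by blast
    then show "A v = v" by (rule Afix)
  next
    assume "A v = v"
    then have "L r v = v" if "r \<in> R" for r using LA[OF that v] by metis
    then show "fix_label R L v = R" by (auto simp: fix_label_def)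
  qed
  let ?U = "{v \<in> S. A v \<noteq> v}"
  have U: "openin (top_of_set S) ?U"
  proof -
    have "openin (top_of_set S) (S \<inter> (\<lambda>v. A v - v) -` (- {0}))"
      by (intro continuous_openin_preimage_gen continuous_intros linear_continuous_on Abl) auto
    moreover have "S \<inter> (\<lambda>v. A v - v) -` (- {0}) = ?U" by auto
    ultimately show ?thesis by simp
  qed
  have "has_transport TYPE('k) (top_of_set ?U) (fix_label R L)"
  proof (rule has_transport_local)
    show "Hausdorff_space (top_of_set ?U)" by (simp add: Hausdorff_space_subtopology)
    fix p assume "p \<in> topspace (top_of_set ?U)"
    then have p: "p \<in> S" "A p \<noteq> p" by auto
    define R' where "R' = fix_label R L p"
    have R'R: "R' \<subseteq> R" by (auto simp: R'_def fix_label_def)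
    have "R' \<noteq> R" using fixed[OF p(1)] p(2) by (simp add: R'_def)
    then have "card R' < card R" using R'R Rfin psubset_card_mono by blast
    moreover have "subgroup R' G"
    proof (rule subgroupI)
      show "R' \<subseteq> carrier G" using R'R RG by blast
      show "R' \<noteq> {}" using oneR one[OF p(1)] by (auto simp: R'_def fix_label_def)
      fix r assume r: "r \<in> R'"
      then have rG: "r \<in> carrier G" and rR: "r \<in> R" and rp: "L r p = p"
        using R'R RG by (auto simp: R'_def fix_label_def)
      have "L (inv r) p = L (inv r) (L r p)" using rp by simp
      also have "\<dots> = p" using mult[of "inv r" r p] rG p(1) one by simp
      finally show "inv r \<in> R'" using subgroup.m_inv_closed[OF R rR] by (auto simp: R'_def fix_label_def)
      fix s assume "s \<in> R'"
      then show "r \<otimes> s \<in> R'" using r R p(1) RG mult subgroup.m_closed[OF R]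
        by (auto simp: R'_def fix_label_def subset_iff)
    qed
    ultimately have IH: "has_transport TYPE('k) (top_of_set S) (fix_label R' L)" by (rule less.hyps)
    \<comment> \<open>No element of \<open>R - R'\<close> fixes a point of \<open>W\<close>, so
      stabilizers in \<open>R\<close> of points of \<open>W\<close> lie in
      \<open>R'\<close>.\<close>
    define W where "W = ?U \<inter> (\<Inter>r\<in>R - R'. S \<inter> (\<lambda>v. L r v - v) -` (- {0}))"
    have W: "openin (top_of_set S) W"
    proof (cases "R - R' = {}")
      case False
      have "openin (top_of_set S) (S \<inter> (\<lambda>v. L r v - v) -` (- {0}))" if "r \<in> R" for r
        using RG that by (intro continuous_openin_preimage_gen continuous_intros linear_continuous_on L) auto
      then have "openin (top_of_set S) (\<Inter>r\<in>R - R'. S \<inter> (\<lambda>v. L r v - v) -` (- {0}))"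
        using False Rfin by (intro openin_INT2) blast+
      then show ?thesis unfolding W_def by (rule openin_Int[OF U])
    qed (simp add: W_def U)
    have WU: "W \<subseteq> ?U" by (simp add: W_def)
    have eq: "fix_label R L v = fix_label R' L v" if "v \<in> W" for v
    proof -
      have "L r v \<noteq> v" if "r \<in> R - R'" for r using \<open>v \<in> W\<close> that unfolding W_def by fastforce
      then show ?thesis using R'R unfolding fix_label_def by blast
    qed
    have sub: "subtopology (top_of_set ?U) W = top_of_set W" "subtopology (top_of_set S) W = top_of_set W"
      using WU by (auto simp: subtopology_subtopology Int_absorb1 subset_iff intro!: arg_cong[where f = top_of_set])
    have "has_transport TYPE('k) (top_of_set W) (fix_label R' L)"
      using has_transport_open_subspace[OF _ W IH] sub(2) by (simp add: Hausdorff_space_subtopology)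
    then have "has_transport TYPE('k) (top_of_set W) (fix_label R L)"
      by (rule has_transport_relabel) (use eq in auto)
    then have "has_transport TYPE('k) (subtopology (top_of_set ?U) W) (fix_label R L)"
      unfolding sub(1) .
    moreover have "openin (top_of_set ?U) W"
      using W WU openin_subset_trans[of S W ?U] by blast
    moreover have "p \<in> W"
      using p by (auto simp: W_def R'_def fix_label_def)
    ultimately show "\<exists>W. openin (top_of_set ?U) W \<and> p \<in> W \<and>
        has_transport TYPE('k) (subtopology (top_of_set ?U) W) (fix_label R L)"
      by blast
  qed
  note TPU = this
  show ?case
  proof (rule has_transport_cone[OF S Abl AS _ _ _ _ TPU])
    show "A (A v) = A v" if "v \<in> S" for v by (rule Afix) (rule LA[OF _ that])
    show "A w = w" if "v \<in> S" "w \<in> S" "fix_label R L v = fix_label R L w" "A v = v" for v w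
      using fixed that by metis
    show "fix_label R L (v + z) = fix_label R L v" if "v \<in> S" "z \<in> S" "A z = z" for v z
    proof -
      have "L r (v + z) = L r v + z" if "r \<in> R" for r
      proof -
        interpret Lr: bounded_linear "L r" using L that RG by blast
        show ?thesis using LA[OF that \<open>z \<in> S\<close>] \<open>A z = z\<close> by (simp add: Lr.add)
      qed
      then show ?thesis by (auto simp: fix_label_def)
    qed
    show "fix_label R L (c *\<^sub>R v) = fix_label R L v" if "v \<in> S" "c > 0" for v c
    proof -
      have "L r (c *\<^sub>R v) = c *\<^sub>R L r v" if "r \<in> R" for r
      proof -
        interpret Lr: bounded_linear "L r" using L that RG by blast
        show ?thesis by (simp add: Lr.scaleR)
      qed
      then show ?thesis using that by (auto simp: fix_label_def)
    qed
  qed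
qed

section \<open>Strict derivatives of smooth maps\<close>

lemma Euclidean_space_eq_top_of_set: "Euclidean_space d = top_of_set {x. \<forall>i\<ge>d. x i = 0}"
  by (simp add: Euclidean_space_def euclidean_product_topology)

definition mat_map :: "nat \<Rightarrow> (nat \<Rightarrow> nat \<Rightarrow> real) \<Rightarrow> (nat \<Rightarrow> real) \<Rightarrow> nat \<Rightarrow> real" where
  "mat_map d m x = (\<lambda>j. if j < d then \<Sum>i<d. m j i * x i else 0)"

text \<open>There is no normed space of dimension \<open>d\<close> for a variable \<open>d\<close>, so \<open>\<real>\<^sup>d\<close> is realised
  inside the normed space of bounded sequences.\<close>

definition to_seq :: "nat \<Rightarrow> (nat \<Rightarrow> real) \<Rightarrow> (nat \<Rightarrow>\<^sub>C real)" where
  "to_seq d x = Bcontfun (\<lambda>i. if i < d then x i else 0)"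

lemma apply_to_seq: "apply_bcontfun (to_seq d x) = (\<lambda>i. if i < d then x i else 0)"
proof -
  have "(\<lambda>i. if i < d then x i else 0) \<in> bcontfun"
  proof (rule bcontfun_normI)
    show "norm (if i < d then x i else 0) \<le> (\<Sum>i<d. \<bar>x i\<bar>)" for i
      by (auto intro: member_le_sum sum_nonneg)
  qed simp
  then show ?thesis unfolding to_seq_def by (rule Bcontfun_inverse)
qed

text \<open>A finite combination of fixed vectors with the coordinates as coefficients: this turns
  coordinatewise continuity and linearity into statements about the sup norm.\<close>

lemma to_seq_sum: "to_seq d x = (\<Sum>i<d. x i *\<^sub>R to_seq d (\<lambda>j. if j = i then 1 else 0))"
proof (rule bcontfun_eqI)
  fix k
  have "apply_bcontfun (\<Sum>i\<in>A. x i *\<^sub>R to_seq d (\<lambda>j. if j = i then 1 else 0)) k =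
      (\<Sum>i\<in>A. x i * (if k < d then (if k = i then 1 else 0) else 0))" if "finite A" for A
    using that by (induction A) (auto simp: apply_to_seq)
  from this[of "{..<d}"]
  show "apply_bcontfun (to_seq d x) k = apply_bcontfun (\<Sum>i<d. x i *\<^sub>R to_seq d (\<lambda>j. if j = i then 1 else 0)) k"
    by (auto simp: apply_to_seq if_distrib[of "(*) _"] cong: if_cong)
qed

lemma continuous_on_to_seq: "continuous_on T (to_seq d)"
proof -
  have "continuous_on T (\<lambda>x. \<Sum>i<d. x i *\<^sub>R to_seq d (\<lambda>j. if j = i then 1 else 0))"
    by (intro continuous_intros continuous_on_subset[OF continuous_on_product_coordinates]) auto
  then show ?thesis using to_seq_sum by (rule continuous_on_eq[OF _ sym])
qed

lemma bounded_linear_apply_bcontfun: "bounded_linear (\<lambda>v :: nat \<Rightarrow>\<^sub>C real. apply_bcontfun v i)"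
proof (rule bounded_linear_intro[of _ 1])
  show "norm (apply_bcontfun v i) \<le> norm v * 1" for v :: "nat \<Rightarrow>\<^sub>C real"
    using norm_bounded[of v i] by simp
qed simp_all

lemma continuous_on_apply_seq: "continuous_on T (\<lambda>v :: nat \<Rightarrow>\<^sub>C real. apply_bcontfun v)"
  by (intro continuous_on_coordinatewise_then_product linear_continuous_on bounded_linear_apply_bcontfun)

text \<open>Conjugating the matrices by \<open>to_seq\<close> gives bounded operators on a subspace
  of a normed space with the same stabilizers.\<close>

lemma (in group) has_transport_Euclidean_space:
  fixes m :: "'a \<Rightarrow> nat \<Rightarrow> nat \<Rightarrow> real"
  assumes fin: "finite (carrier G)"
    and one: "\<And>x. x \<in> topspace (Euclidean_space d) \<Longrightarrow> mat_map d (m \<one>) x = x"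
    and mult: "\<And>r s x. r \<in> carrier G \<Longrightarrow> s \<in> carrier G \<Longrightarrow> x \<in> topspace (Euclidean_space d) \<Longrightarrow>
      mat_map d (m (r \<otimes> s)) x = mat_map d (m r) (mat_map d (m s) x)"
    and R: "subgroup R G"
  shows "has_transport TYPE('k::{metric_space, second_countable_topology})
    (Euclidean_space d) (fix_label R (\<lambda>r. mat_map d (m r)))"
proof -
  define S where "S = {v :: nat \<Rightarrow>\<^sub>C real. \<forall>i\<ge>d. apply_bcontfun v i = 0}"
  define L where "L = (\<lambda>r (v :: nat \<Rightarrow>\<^sub>C real). to_seq d (mat_map d (m r) (apply_bcontfun v)))"
  have E: "apply_bcontfun v \<in> topspace (Euclidean_space d)" if "v \<in> S" for v
    using that by (simp add: S_def topspace_Euclidean_space)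
  have eta: "to_seq d (apply_bcontfun v) = v" if "v \<in> S" for v
    by (rule bcontfun_eqI) (use that in \<open>auto simp: apply_to_seq S_def\<close>)
  have eps: "apply_bcontfun (to_seq d x) = x" if "x \<in> topspace (Euclidean_space d)" for x
    using that by (auto simp: apply_to_seq topspace_Euclidean_space)
  have mE: "mat_map d k x \<in> topspace (Euclidean_space d)" for k x
    by (simp add: mat_map_def topspace_Euclidean_space)
  have S: "subspace S" by (auto simp: subspace_def S_def)
  have "has_transport TYPE('k) (top_of_set S) (fix_label R L)"
  proof (rule has_transport_linear[OF fin S _ _ _ _ R])
    show "bounded_linear (L r)" for r
    proof -
      have "L r v = (\<Sum>j<d. (\<Sum>i<d. m r j i * apply_bcontfun v i) *\<^sub>R to_seq d (\<lambda>k. if k = j then 1 else 0))" for v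
        unfolding L_def by (subst to_seq_sum) (auto simp: mat_map_def intro!: sum.cong)
      moreover have "bounded_linear (\<lambda>v :: nat \<Rightarrow>\<^sub>C real.
          \<Sum>j<d. (\<Sum>i<d. m r j i * apply_bcontfun v i) *\<^sub>R to_seq d (\<lambda>k. if k = j then 1 else 0))"
        by (intro bounded_linear_sum bounded_linear_scaleR_const bounded_linear_mult_const
            bounded_linear_const_mult bounded_linear_apply_bcontfun)
      ultimately show ?thesis by presburger
    qed
    show "L r v \<in> S" for r v by (simp add: L_def S_def apply_to_seq)
    show "L \<one> v = v" if "v \<in> S" for v using one[OF E[OF that]] eta[OF that] by (simp add: L_def)
    show "L (r \<otimes> s) v = L r (L s v)" if "r \<in> carrier G" "s \<in> carrier G" "v \<in> S" for r s v
      using mult[OF that(1,2) E[OF that(3)]] eps[OF mE] by (simp add: L_def)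
  qed
  then show ?thesis
  proof (rule has_transport_homeomorphic)
    show "homeomorphic_maps (Euclidean_space d) (top_of_set S) (to_seq d) apply_bcontfun"
      unfolding homeomorphic_maps_def Euclidean_space_eq_top_of_set
      using continuous_on_to_seq continuous_on_apply_seq eta eps
      by (auto simp: S_def apply_to_seq topspace_Euclidean_space)
    have "fix_label R L (to_seq d p) = fix_label R (\<lambda>r. mat_map d (m r)) p"
      if "p \<in> topspace (Euclidean_space d)" for p
    proof -
      have "L r (to_seq d p) = to_seq d p \<longleftrightarrow> mat_map d (m r) p = p" for r
        using eps[OF that] eps[OF mE] by (simp add: L_def) metis
      then show ?thesis by (simp add: fix_label_def)
    qed
    then show "fix_label R (\<lambda>r. mat_map d (m r)) p = fix_label R (\<lambda>r. mat_map d (m r)) q \<longleftrightarrow>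
        fix_label R L (to_seq d p) = fix_label R L (to_seq d q)"
      if "p \<in> topspace (Euclidean_space d)" "q \<in> topspace (Euclidean_space d)" for p q
      using that by simp
  qed
qed

text \<open>The l1 distance is additive over coordinates, so the error estimates obtained by
  changing one coordinate at a time simply add up.\<close>

definition l1 :: "nat \<Rightarrow> (nat \<Rightarrow> real) \<Rightarrow> (nat \<Rightarrow> real) \<Rightarrow> real" where
  "l1 d x y = (\<Sum>i<d. \<bar>x i - y i\<bar>)"

lemma l1_nonneg: "0 \<le> l1 d x y" by (simp add: l1_def sum_nonneg)

lemma l1_self [simp]: "l1 d x x = 0" by (simp add: l1_def)

lemma l1_coord: "i < d \<Longrightarrow> \<bar>x i - y i\<bar> \<le> l1 d x y"
  unfolding l1_def by (rule member_le_sum) auto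

lemma l1_le: "(\<And>i. i < d \<Longrightarrow> \<bar>x i - y i\<bar> \<le> e) \<Longrightarrow> l1 d x y \<le> real d * e"
  unfolding l1_def using sum_bounded_above[of "{..<d}" "\<lambda>i. \<bar>x i - y i\<bar>" e] by simp

lemma l1_eq_0:
  assumes "l1 d x y = 0" "x \<in> topspace (Euclidean_space d)" "y \<in> topspace (Euclidean_space d)"
  shows "x = y"
proof
  fix i
  show "x i = y i"
    using l1_coord[of i d x y] assms by (cases "i < d") (auto simp: topspace_Euclidean_space)
qed

lemma openin_l1_ball: "openin (Euclidean_space d) {x \<in> topspace (Euclidean_space d). l1 d x p < e}"
proof -
  have "continuous_on UNIV (\<lambda>x. l1 d x p)"
    unfolding l1_def by (intro continuous_intros continuous_on_product_coordinates)
  then have "open ((\<lambda>x. l1 d x p) -` {..<e})"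
    using open_vimage open_lessThan by blast
  then have "openin (top_of_set {x. \<forall>i\<ge>d. x i = 0}) ({x. \<forall>i\<ge>d. x i = 0} \<inter> (\<lambda>x. l1 d x p) -` {..<e})"
    by (rule openin_open_Int)
  then show ?thesis unfolding topspace_Euclidean_space unfolding Euclidean_space_eq_top_of_set
    by (simp add: Int_def vimage_def)
qed

text \<open>In the sup norm the set contains a ball around the point, and the l1 distance dominates
  the sup distance.\<close>

lemma openin_Euclidean_space_l1:
  assumes "openin (Euclidean_space d) W" "p \<in> W"
  shows "\<exists>e>0. \<forall>x \<in> topspace (Euclidean_space d). l1 d x p < e \<longrightarrow> x \<in> W"
proof -
  obtain T where T: "open T" "W = {x. \<forall>i\<ge>d. x i = 0} \<inter> T"
    using assms(1) unfolding Euclidean_space_eq_top_of_set by (auto simp: openin_open)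
  have "open (apply_bcontfun -` T :: (nat \<Rightarrow>\<^sub>C real) set)"
    using open_vimage[OF T(1)] continuous_on_apply_seq by blast
  moreover have pE: "p \<in> topspace (Euclidean_space d)" using assms openin_subset by blast
  have ap: "apply_bcontfun (to_seq d x) = x" if "x \<in> topspace (Euclidean_space d)" for x
    using that by (auto simp: apply_to_seq topspace_Euclidean_space)
  moreover have "to_seq d p \<in> apply_bcontfun -` T" using ap[OF pE] assms(2) T(2) by simp
  ultimately obtain e where e: "e > 0" "\<And>v. dist v (to_seq d p) < e \<Longrightarrow> v \<in> apply_bcontfun -` T"
    unfolding open_dist by meson
  have "x \<in> W" if x: "x \<in> topspace (Euclidean_space d)" "l1 d x p < e" for x
  proof -
    have "dist (to_seq d x) (to_seq d p) \<le> l1 d x p"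
    proof (rule dist_bound)
      fix i
      show "dist (apply_bcontfun (to_seq d x) i) (apply_bcontfun (to_seq d p) i) \<le> l1 d x p"
        using l1_coord[of i d x p] l1_nonneg[of d x p] by (auto simp: apply_to_seq dist_real_def)
    qed
    then have "to_seq d x \<in> apply_bcontfun -` T" using e(2) x(2) by simp
    then show ?thesis using ap[OF x(1)] x(1) T(2) by (simp add: topspace_Euclidean_space)
  qed
  then show ?thesis using e(1) by blast
qed

text \<open>Both \<open>x\<close> and \<open>y\<close> vary near \<open>p\<close>, unlike in the
  ordinary derivative. A strict derivative at one point therefore controls the map on a
  neighbourhood: an identity derivative gives local injectivity, with no derivatives at other points
  involved. It depends only on the germ of \<open>F\<close> at \<open>p\<close>.\<close>

definition strict_deriv :: "nat \<Rightarrow> ((nat \<Rightarrow> real) \<Rightarrow> nat \<Rightarrow> real) \<Rightarrow> (nat \<Rightarrow> nat \<Rightarrow> real) \<Rightarrow> (nat \<Rightarrow> real) \<Rightarrow> bool" where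
  "strict_deriv d F m p \<longleftrightarrow> (\<forall>e>0. \<exists>\<delta>>0. \<forall>x \<in> topspace (Euclidean_space d). \<forall>y \<in> topspace (Euclidean_space d).
     l1 d x p < \<delta> \<longrightarrow> l1 d y p < \<delta> \<longrightarrow>
     (\<forall>j<d. \<bar>F x j - F y j - (\<Sum>i<d. m j i * (x i - y i))\<bar> \<le> e * l1 d x y))"

text \<open>Pass from \<open>y\<close> to \<open>x\<close> by changing one coordinate at a time. The
  mean value theorem turns each change into a partial derivative at some point of the segment, which
  by continuity is within \<open>e\<close> of its value at \<open>p\<close>.\<close>

lemma smooth_map_on_strict_deriv:
  assumes U: "openin (Euclidean_space d) U" and p: "p \<in> U" and F: "smooth_map_on d U F"
  shows "strict_deriv d F (\<lambda>j i. iter_partial [i] (\<lambda>x. F x j) p) p"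
  unfolding strict_deriv_def
proof (intro allI impI)
  fix e :: real assume e: "e > 0"
  let ?E = "topspace (Euclidean_space d)"
  let ?D = "\<lambda>j i. iter_partial [i] (\<lambda>x. F x j)"
  have UE: "U \<subseteq> ?E" using U openin_subset by blast
  have pE: "p \<in> ?E" using p UE by blast
  have F': "smooth_real_on d U (\<lambda>x. F x j)" if "j < d" for j using F that by (simp add: smooth_map_on_def)
  have op: "openin (Euclidean_space d) {x \<in> U. \<bar>?D j i x - ?D j i p\<bar> < e}" if "j < d" "i < d" for j i
  proof -
    have "set [i] \<subseteq> {..<d}" using that by simp
    then have "continuous_map (subtopology (Euclidean_space d) U) euclideanreal (?D j i)"
      using F'[OF that(1)] unfolding smooth_real_on_def by blast
    from openin_continuous_map_preimage[OF this, of "ball (?D j i p) e"]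
    have "openin (subtopology (Euclidean_space d) U) {x \<in> U. ?D j i x \<in> ball (?D j i p) e}"
      using UE by (simp add: Int_absorb1)
    then have "openin (Euclidean_space d) {x \<in> U. ?D j i x \<in> ball (?D j i p) e}"
      using U openin_trans_full by blast
    then show ?thesis by (simp add: dist_real_def abs_minus_commute)
  qed
  define W where "W = U \<inter> (\<Inter>(j, i)\<in>{..<d} \<times> {..<d}. {x \<in> U. \<bar>?D j i x - ?D j i p\<bar> < e})"
  have "openin (Euclidean_space d) W"
  proof (cases "d = 0")
    case False
    then show ?thesis unfolding W_def
      by (intro openin_Int U openin_INT2) (use op in auto)
  qed (use U in \<open>simp add: W_def\<close>)
  moreover have "p \<in> W" using p e by (auto simp: W_def)
  ultimately obtain \<eta> where \<eta>: "\<eta> > 0" "\<And>x. x \<in> ?E \<Longrightarrow> l1 d x p < \<eta> \<Longrightarrow> x \<in> W"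
    using openin_Euclidean_space_l1 by meson
  have est: "\<bar>F x j - F y j - (\<Sum>i<d. ?D j i p * (x i - y i))\<bar> \<le> e * l1 d x y"
    if x: "x \<in> ?E" "l1 d x p < \<eta> / 2" and y: "y \<in> ?E" "l1 d y p < \<eta> / 2" and j: "j < d" for x y j
  proof -
    \<comment> \<open>\<open>z k\<close> has the first \<open>k\<close> coordinates of
      \<open>x\<close> and the others of \<open>y\<close>. Its distance to \<open>p\<close> is at
      most the sum of those of \<open>x\<close> and \<open>y\<close>, hence the radius
      \<open>\<eta> / 2\<close>.\<close>
    define z where "z = (\<lambda>k i. if i < k then x i else y i)"
    \<comment> \<open>The condition on \<open>c\<close> covers every value between
      \<open>x k\<close> and \<open>y k\<close>, whichever of the two is larger.\<close>
    have zW: "(z k)(k := c) \<in> W" if k: "k < d" and c: "\<bar>c - p k\<bar> \<le> max \<bar>x k - p k\<bar> \<bar>y k - p k\<bar>" for k c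
    proof (rule \<eta>(2))
      show "(z k)(k := c) \<in> ?E" using x(1) y(1) k by (auto simp: z_def topspace_Euclidean_space)
      have "l1 d ((z k)(k := c)) p \<le> (\<Sum>i<d. \<bar>x i - p i\<bar> + \<bar>y i - p i\<bar>)"
        unfolding l1_def using c by (intro sum_mono) (auto simp: z_def)
      also have "\<dots> = l1 d x p + l1 d y p" by (simp add: l1_def sum.distrib)
      finally show "l1 d ((z k)(k := c)) p < \<eta>" using x y by simp
    qed
    have step: "\<bar>F (z (Suc k)) j - F (z k) j - ?D j k p * (x k - y k)\<bar> \<le> e * \<bar>x k - y k\<bar>" if k: "k < d" for k
    proof -
      define g where "g = (\<lambda>c. F ((z k)(k := c)) j)"
      have zS: "z (Suc k) = (z k)(k := x k)" "z k = (z k)(k := y k)" by (auto simp: z_def)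
      have der: "(g has_real_derivative ?D j k ((z k)(k := c))) (at c)"
        if c: "\<bar>c - p k\<bar> \<le> max \<bar>x k - p k\<bar> \<bar>y k - p k\<bar>" for c
      proof -
        have "(z k)(k := c) \<in> U" using zW[OF k c] by (simp add: W_def)
        then have "(\<lambda>h. iter_partial [] (\<lambda>x. F x j) (((z k)(k := c))(k := ((z k)(k := c)) k + h))) differentiable (at 0)"
          using F'[OF j] k unfolding smooth_real_on_def by (metis empty_subsetI list.set(1))
        then have "(\<lambda>h. g (c + h)) differentiable (at 0)" by (simp add: g_def)
        then have "((\<lambda>h. g (c + h)) has_real_derivative deriv (\<lambda>h. g (c + h)) 0) (at 0)"
          using DERIV_deriv_iff_real_differentiable by blast
        then have "(g has_real_derivative deriv (\<lambda>h. g (c + h)) 0) (at c)"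
          using DERIV_at_within_shift[of g _ c 0 UNIV] by (simp add: add.commute)
        moreover have "deriv (\<lambda>h. g (c + h)) 0 = ?D j k ((z k)(k := c))" by (simp add: g_def)
        ultimately show ?thesis by simp
      qed
      have mv: "\<exists>c. \<bar>c - p k\<bar> \<le> max \<bar>x k - p k\<bar> \<bar>y k - p k\<bar> \<and> g (x k) - g (y k) = ?D j k ((z k)(k := c)) * (x k - y k)"
      proof -
        consider "x k = y k" | "x k < y k" | "y k < x k" by linarith
        then show ?thesis
        proof cases
          case 1
          then show ?thesis by (intro exI[of _ "x k"]) simp
        next
          case 2
          obtain c where c: "x k < c" "c < y k" "g (y k) - g (x k) = (y k - x k) * ?D j k ((z k)(k := c))"
            using MVT2[OF 2, of g "\<lambda>c. ?D j k ((z k)(k := c))"] der 2 by (auto simp: max_def abs_if split: if_splits)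
          then show ?thesis using 2 by (intro exI[of _ c]) (auto simp: algebra_simps)
        next
          case 3
          obtain c where c: "y k < c" "c < x k" "g (x k) - g (y k) = (x k - y k) * ?D j k ((z k)(k := c))"
            using MVT2[OF 3, of g "\<lambda>c. ?D j k ((z k)(k := c))"] der 3 by (auto simp: max_def abs_if split: if_splits)
          then show ?thesis using 3 by (intro exI[of _ c]) (auto simp: algebra_simps)
        qed
      qed
      then obtain c where c: "\<bar>c - p k\<bar> \<le> max \<bar>x k - p k\<bar> \<bar>y k - p k\<bar>"
        "g (x k) - g (y k) = ?D j k ((z k)(k := c)) * (x k - y k)" by blast
      have "(z k)(k := c) \<in> (case (j, k) of (j, i) \<Rightarrow> {x \<in> U. \<bar>?D j i x - ?D j i p\<bar> < e})"
        using zW[OF k c(1)] j k unfolding W_def by blast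
      then have "\<bar>?D j k ((z k)(k := c)) - ?D j k p\<bar> < e" by (simp only: prod.case mem_Collect_eq)
      then have "\<bar>(?D j k ((z k)(k := c)) - ?D j k p) * (x k - y k)\<bar> \<le> e * \<bar>x k - y k\<bar>"
        unfolding abs_mult by (intro mult_right_mono) auto
      moreover have "F (z (Suc k)) j - F (z k) j = ?D j k ((z k)(k := c)) * (x k - y k)"
        using c(2) zS by (simp add: g_def)
      ultimately show ?thesis by (simp add: algebra_simps)
    qed
    have ends: "z d = x" "z 0 = y" using x(1) y(1) by (auto simp: z_def topspace_Euclidean_space not_less)
    have "(\<Sum>k<d. F (z (Suc k)) j - F (z k) j) = F x j - F y j"
      using sum_lessThan_telescope[of "\<lambda>k. F (z k) j" d] by (simp add: ends)
    then have "F x j - F y j - (\<Sum>i<d. ?D j i p * (x i - y i)) =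
        (\<Sum>k<d. F (z (Suc k)) j - F (z k) j - ?D j k p * (x k - y k))"
      by (simp add: sum_subtractf)
    also have "\<bar>\<dots>\<bar> \<le> (\<Sum>k<d. e * \<bar>x k - y k\<bar>)"
      by (rule order_trans[OF sum_abs sum_mono]) (use step in auto)
    also have "\<dots> = e * l1 d x y" by (simp add: l1_def sum_distrib_left)
    finally show ?thesis .
  qed
  show "\<exists>\<delta>>0. \<forall>x\<in>?E. \<forall>y\<in>?E. l1 d x p < \<delta> \<longrightarrow> l1 d y p < \<delta> \<longrightarrow>
      (\<forall>j<d. \<bar>F x j - F y j - (\<Sum>i<d. ?D j i p * (x i - y i))\<bar> \<le> e * l1 d x y)"
    using est \<eta>(1) by (intro exI[of _ "\<eta> / 2"]) auto
qed

lemma strict_derivD: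
  assumes "strict_deriv d F m p" "e > 0"
  obtains \<delta> where "\<delta> > 0" "\<And>x y j. x \<in> topspace (Euclidean_space d) \<Longrightarrow> y \<in> topspace (Euclidean_space d) \<Longrightarrow>
    l1 d x p < \<delta> \<Longrightarrow> l1 d y p < \<delta> \<Longrightarrow> j < d \<Longrightarrow>
    \<bar>F x j - F y j - (\<Sum>i<d. m j i * (x i - y i))\<bar> \<le> e * l1 d x y"
  using assms unfolding strict_deriv_def by meson

lemma strict_deriv_cong:
  assumes F: "strict_deriv d F m p" and W: "openin (Euclidean_space d) W" "p \<in> W"
    and eq: "\<And>x j. x \<in> W \<Longrightarrow> j < d \<Longrightarrow> G x j = F x j"
  shows "strict_deriv d G m p"
  unfolding strict_deriv_def
proof (intro allI impI)
  fix e :: real assume "e > 0"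
  from strict_derivD[OF F this] obtain \<delta> where \<delta>: "\<delta> > 0"
    "\<And>x y j. x \<in> topspace (Euclidean_space d) \<Longrightarrow> y \<in> topspace (Euclidean_space d) \<Longrightarrow>
    l1 d x p < \<delta> \<Longrightarrow> l1 d y p < \<delta> \<Longrightarrow> j < d \<Longrightarrow>
    \<bar>F x j - F y j - (\<Sum>i<d. m j i * (x i - y i))\<bar> \<le> e * l1 d x y" by blast
  obtain \<eta> where "\<eta> > 0" "\<forall>x \<in> topspace (Euclidean_space d). l1 d x p < \<eta> \<longrightarrow> x \<in> W"
    using openin_Euclidean_space_l1[OF W] by blast
  then show "\<exists>\<delta>>0. \<forall>x \<in> topspace (Euclidean_space d). \<forall>y \<in> topspace (Euclidean_space d).
     l1 d x p < \<delta> \<longrightarrow> l1 d y p < \<delta> \<longrightarrow>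
     (\<forall>j<d. \<bar>G x j - G y j - (\<Sum>i<d. m j i * (x i - y i))\<bar> \<le> e * l1 d x y)"
    using \<delta> eq by (intro exI[of _ "min \<delta> \<eta>"]) auto
qed

lemma strict_deriv_mat_map: "strict_deriv d (mat_map d m) m p"
  unfolding strict_deriv_def
  by (intro allI impI exI[of _ 1])
    (auto simp: mat_map_def sum_subtractf right_diff_distrib l1_nonneg)

lemma strict_deriv_average:
  assumes "finite Q" "\<And>q. q \<in> Q \<Longrightarrow> strict_deriv d (F q) (m q) p"
  shows "strict_deriv d (\<lambda>x j. \<Sum>q\<in>Q. c * F q x j) (\<lambda>j i. \<Sum>q\<in>Q. c * m q j i) p"
  using assms
proof (induction Q)
  case empty
  show ?case unfolding strict_deriv_def by (intro allI impI exI[of _ 1]) (auto simp: l1_nonneg)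
next
  case (insert r Q)
  show ?case
    unfolding strict_deriv_def
  proof (intro allI impI)
    fix e :: real assume e: "e > 0"
    have "strict_deriv d (F r) (m r) p" using insert by simp
    \<comment> \<open>The summand 1 keeps the denominator positive when
      \<open>c = 0\<close>.\<close>
    moreover have "e / (2 * (\<bar>c\<bar> + 1)) > 0" using e by (simp add: add_nonneg_pos)
    ultimately obtain \<delta> where \<delta>: "\<delta> > 0"
      "\<And>x y j. x \<in> topspace (Euclidean_space d) \<Longrightarrow> y \<in> topspace (Euclidean_space d) \<Longrightarrow>
      l1 d x p < \<delta> \<Longrightarrow> l1 d y p < \<delta> \<Longrightarrow> j < d \<Longrightarrow>
      \<bar>F r x j - F r y j - (\<Sum>i<d. m r j i * (x i - y i))\<bar> \<le> e / (2 * (\<bar>c\<bar> + 1)) * l1 d x y"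
      using strict_derivD by blast
    have "strict_deriv d (\<lambda>x j. \<Sum>q\<in>Q. c * F q x j) (\<lambda>j i. \<Sum>q\<in>Q. c * m q j i) p"
      using insert by simp
    moreover have "e / 2 > 0" using e by simp
    ultimately obtain \<eta> where \<eta>: "\<eta> > 0"
      "\<And>x y j. x \<in> topspace (Euclidean_space d) \<Longrightarrow> y \<in> topspace (Euclidean_space d) \<Longrightarrow>
      l1 d x p < \<eta> \<Longrightarrow> l1 d y p < \<eta> \<Longrightarrow> j < d \<Longrightarrow>
      \<bar>(\<Sum>q\<in>Q. c * F q x j) - (\<Sum>q\<in>Q. c * F q y j) - (\<Sum>i<d. (\<Sum>q\<in>Q. c * m q j i) * (x i - y i))\<bar> \<le> e / 2 * l1 d x y"
      using strict_derivD by blast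
    have "\<bar>(\<Sum>q\<in>insert r Q. c * F q x j) - (\<Sum>q\<in>insert r Q. c * F q y j) -
        (\<Sum>i<d. (\<Sum>q\<in>insert r Q. c * m q j i) * (x i - y i))\<bar> \<le> e * l1 d x y"
      if xy: "x \<in> topspace (Euclidean_space d)" "y \<in> topspace (Euclidean_space d)"
        "l1 d x p < min \<delta> \<eta>" "l1 d y p < min \<delta> \<eta>" "j < d" for x y j
    proof -
      let ?a = "F r x j - F r y j - (\<Sum>i<d. m r j i * (x i - y i))"
      let ?b = "(\<Sum>q\<in>Q. c * F q x j) - (\<Sum>q\<in>Q. c * F q y j) - (\<Sum>i<d. (\<Sum>q\<in>Q. c * m q j i) * (x i - y i))"
      have "(\<Sum>i<d. (\<Sum>q\<in>insert r Q. c * m q j i) * (x i - y i)) =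
          c * (\<Sum>i<d. m r j i * (x i - y i)) + (\<Sum>i<d. (\<Sum>q\<in>Q. c * m q j i) * (x i - y i))"
        using insert.hyps by (simp add: distrib_right sum.distrib sum_distrib_left mult.assoc)
      then have eq: "(\<Sum>q\<in>insert r Q. c * F q x j) - (\<Sum>q\<in>insert r Q. c * F q y j) -
          (\<Sum>i<d. (\<Sum>q\<in>insert r Q. c * m q j i) * (x i - y i)) = c * ?a + ?b"
        using insert.hyps by (simp add: algebra_simps)
      have "\<bar>c * ?a\<bar> \<le> \<bar>c\<bar> * (e / (2 * (\<bar>c\<bar> + 1)) * l1 d x y)"
        unfolding abs_mult using \<delta>(2)[of x y j] xy by (intro mult_left_mono) auto
      also have "\<dots> = (\<bar>c\<bar> / (\<bar>c\<bar> + 1)) * (e / 2 * l1 d x y)" by simp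
      also have "\<dots> \<le> 1 * (e / 2 * l1 d x y)"
        using e l1_nonneg[of d x y] by (intro mult_right_mono) (auto simp: divide_le_eq)
      finally have "\<bar>c * ?a\<bar> \<le> e / 2 * l1 d x y" by simp
      moreover have "\<bar>?b\<bar> \<le> e / 2 * l1 d x y" using \<eta>(2)[of x y j] xy by simp
      ultimately show ?thesis unfolding eq by linarith
    qed
    then show "\<exists>\<delta>>0. \<forall>x \<in> topspace (Euclidean_space d). \<forall>y \<in> topspace (Euclidean_space d).
      l1 d x p < \<delta> \<longrightarrow> l1 d y p < \<delta> \<longrightarrow>
      (\<forall>j<d. \<bar>(\<Sum>q\<in>insert r Q. c * F q x j) - (\<Sum>q\<in>insert r Q. c * F q y j) -
        (\<Sum>i<d. (\<Sum>q\<in>insert r Q. c * m q j i) * (x i - y i))\<bar> \<le> e * l1 d x y)"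
      using \<delta>(1) \<eta>(1) by (intro exI[of _ "min \<delta> \<eta>"]) auto
  qed
qed

lemma strict_deriv_compose:
  assumes F: "strict_deriv d F m p" and G: "strict_deriv d G k (F p)"
    and W: "openin (Euclidean_space d) W" "p \<in> W" and FE: "\<And>x. x \<in> W \<Longrightarrow> F x \<in> topspace (Euclidean_space d)"
  shows "strict_deriv d (\<lambda>x. G (F x)) (\<lambda>j i. \<Sum>l<d. k j l * m l i) p"
  unfolding strict_deriv_def
proof (intro allI impI)
  fix e :: real assume e: "e > 0"
  let ?E = "topspace (Euclidean_space d)"
  \<comment> \<open>\<open>B - 1\<close> and \<open>A - 1\<close> bound the absolute row sums of
    \<open>m\<close> and \<open>k\<close>. The 1 in \<open>B\<close> absorbs the error term of
    \<open>F\<close> taken with constant 1, so each coordinate of \<open>F\<close> is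
    \<open>B\<close>-Lipschitz near \<open>p\<close>, and summing coordinates makes \<open>C\<close>
    an l1 Lipschitz constant. The 1 in \<open>A\<close> and in \<open>C\<close> only ensures
    positivity.\<close>
  define B where "B = (\<Sum>j<d. \<Sum>i<d. \<bar>m j i\<bar>) + 1"
  define A where "A = (\<Sum>j<d. \<Sum>i<d. \<bar>k j i\<bar>) + 1"
  define C where "C = real d * B + 1"
  have B: "B > 0" unfolding B_def by (intro add_nonneg_pos sum_nonneg) auto
  have A: "A > 0" unfolding A_def by (intro add_nonneg_pos sum_nonneg) auto
  have C: "C > 0" using B by (simp add: C_def add_nonneg_pos)
  have row: "(\<Sum>i<d. \<bar>n j i\<bar>) \<le> (\<Sum>j<d. \<Sum>i<d. \<bar>n j i\<bar>)" if "j < d" for n :: "nat \<Rightarrow> nat \<Rightarrow> real" and j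
    using that by (intro member_le_sum[of j "{..<d}" "\<lambda>j. \<Sum>i<d. \<bar>n j i\<bar>"]) (auto intro: sum_nonneg)
  obtain \<delta>1 where \<delta>1: "\<delta>1 > 0" "\<And>x y j. x \<in> ?E \<Longrightarrow> y \<in> ?E \<Longrightarrow> l1 d x p < \<delta>1 \<Longrightarrow> l1 d y p < \<delta>1 \<Longrightarrow> j < d \<Longrightarrow>
    \<bar>F x j - F y j - (\<Sum>i<d. m j i * (x i - y i))\<bar> \<le> 1 * l1 d x y"
    using strict_derivD[OF F zero_less_one] by blast
  have eA: "e / (2 * A) > 0" and eC: "e / (2 * C) > 0" using e A C by simp_all
  obtain \<delta>2 where \<delta>2: "\<delta>2 > 0" "\<And>x y j. x \<in> ?E \<Longrightarrow> y \<in> ?E \<Longrightarrow> l1 d x p < \<delta>2 \<Longrightarrow> l1 d y p < \<delta>2 \<Longrightarrow> j < d \<Longrightarrow>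
    \<bar>F x j - F y j - (\<Sum>i<d. m j i * (x i - y i))\<bar> \<le> e / (2 * A) * l1 d x y"
    using strict_derivD[OF F eA] by blast
  obtain \<delta>3 where \<delta>3: "\<delta>3 > 0" "\<And>x y j. x \<in> ?E \<Longrightarrow> y \<in> ?E \<Longrightarrow> l1 d x (F p) < \<delta>3 \<Longrightarrow> l1 d y (F p) < \<delta>3 \<Longrightarrow> j < d \<Longrightarrow>
    \<bar>G x j - G y j - (\<Sum>i<d. k j i * (x i - y i))\<bar> \<le> e / (2 * C) * l1 d x y"
    using strict_derivD[OF G eC] by blast
  obtain \<delta>4 where \<delta>4: "\<delta>4 > 0" "\<And>x. x \<in> ?E \<Longrightarrow> l1 d x p < \<delta>4 \<Longrightarrow> x \<in> W"
    using openin_Euclidean_space_l1[OF W] by meson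
  have pE: "p \<in> ?E" using W openin_subset by blast
  have lip: "l1 d (F x) (F y) \<le> C * l1 d x y"
    if xy: "x \<in> ?E" "y \<in> ?E" "l1 d x p < \<delta>1" "l1 d y p < \<delta>1" for x y
  proof -
    have "\<bar>F x j - F y j\<bar> \<le> B * l1 d x y" if j: "j < d" for j
    proof -
      have "\<bar>\<Sum>i<d. m j i * (x i - y i)\<bar> \<le> (\<Sum>i<d. \<bar>m j i\<bar> * l1 d x y)"
        by (rule order_trans[OF sum_abs sum_mono]) (auto simp: abs_mult intro!: mult_left_mono l1_coord)
      also have "\<dots> \<le> (B - 1) * l1 d x y"
        unfolding sum_distrib_right[symmetric] using row[OF j, of m] l1_nonneg[of d x y]
        by (intro mult_right_mono) (auto simp: B_def)
      finally show ?thesis using \<delta>1(2)[OF xy j] by (simp add: algebra_simps)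
    qed
    from l1_le[of d "F x" "F y", OF this] show ?thesis
      using l1_nonneg[of d x y] by (simp add: C_def algebra_simps)
  qed
  define \<delta> where "\<delta> = min (min \<delta>1 \<delta>2) (min \<delta>4 (\<delta>3 / C))"
  have \<delta>: "\<delta> > 0" using \<delta>1 \<delta>2 \<delta>3 \<delta>4 C by (simp add: \<delta>_def)
  have near: "F x \<in> ?E \<and> l1 d (F x) (F p) < \<delta>3" if "x \<in> ?E" "l1 d x p < \<delta>" for x
  proof -
    have "l1 d (F x) (F p) \<le> C * l1 d x p" using lip[of x p] that pE \<delta>1(1) by (simp add: \<delta>_def)
    also have "\<dots> < \<delta>3" using that C by (simp add: \<delta>_def pos_less_divide_eq mult.commute)
    finally show ?thesis using FE[OF \<delta>4(2)] that by (simp add: \<delta>_def)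
  qed
  have est: "\<bar>G (F x) j - G (F y) j - (\<Sum>i<d. (\<Sum>l<d. k j l * m l i) * (x i - y i))\<bar> \<le> e * l1 d x y"
    if xy: "x \<in> ?E" "y \<in> ?E" "l1 d x p < \<delta>" "l1 d y p < \<delta>" and j: "j < d" for x y j
  proof -
    let ?r = "\<lambda>l. F x l - F y l - (\<Sum>i<d. m l i * (x i - y i))"
    have "\<bar>G (F x) j - G (F y) j - (\<Sum>l<d. k j l * (F x l - F y l))\<bar> \<le> e / (2 * C) * l1 d (F x) (F y)"
      using \<delta>3(2) near xy j by blast
    also have "\<dots> \<le> e / (2 * C) * (C * l1 d x y)"
      using lip[of x y] xy eC by (intro mult_left_mono) (auto simp: \<delta>_def)
    also have "\<dots> = e / 2 * l1 d x y" using C by simp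
    finally have 1: "\<bar>G (F x) j - G (F y) j - (\<Sum>l<d. k j l * (F x l - F y l))\<bar> \<le> e / 2 * l1 d x y" .
    have "\<bar>k j l * ?r l\<bar> \<le> \<bar>k j l\<bar> * (e / (2 * A) * l1 d x y)" if "l < d" for l
      unfolding abs_mult using \<delta>2(2)[of x y l] xy that by (intro mult_left_mono) (auto simp: \<delta>_def)
    then have "\<bar>\<Sum>l<d. k j l * ?r l\<bar> \<le> (\<Sum>l<d. \<bar>k j l\<bar> * (e / (2 * A) * l1 d x y))"
      by (intro order_trans[OF sum_abs sum_mono]) blast
    also have "\<dots> \<le> A * (e / (2 * A) * l1 d x y)"
      unfolding sum_distrib_right[symmetric]
    proof (rule mult_right_mono)
      show "(\<Sum>l<d. \<bar>k j l\<bar>) \<le> A" using row[OF j, of k] by (simp add: A_def)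
      show "0 \<le> e / (2 * A) * l1 d x y" using eA l1_nonneg[of d x y] by (intro mult_nonneg_nonneg) simp_all
    qed
    also have "\<dots> = e / 2 * l1 d x y" using A by simp
    finally have 2: "\<bar>\<Sum>l<d. k j l * ?r l\<bar> \<le> e / 2 * l1 d x y" .
    have "(\<Sum>i<d. (\<Sum>l<d. k j l * m l i) * (x i - y i)) = (\<Sum>i<d. \<Sum>l<d. k j l * (m l i * (x i - y i)))"
      by (simp add: sum_distrib_right mult.assoc)
    also have "\<dots> = (\<Sum>l<d. \<Sum>i<d. k j l * (m l i * (x i - y i)))" by (rule sum.swap)
    also have "\<dots> = (\<Sum>l<d. k j l * (\<Sum>i<d. m l i * (x i - y i)))" by (simp add: sum_distrib_left)
    finally have "(\<Sum>l<d. k j l * (F x l - F y l)) - (\<Sum>i<d. (\<Sum>l<d. k j l * m l i) * (x i - y i)) = (\<Sum>l<d. k j l * ?r l)"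
      by (simp add: right_diff_distrib sum_subtractf)
    then show ?thesis using 1 2 by linarith
  qed
  show "\<exists>\<delta>>0. \<forall>x\<in>?E. \<forall>y\<in>?E. l1 d x p < \<delta> \<longrightarrow> l1 d y p < \<delta> \<longrightarrow>
      (\<forall>j<d. \<bar>G (F x) j - G (F y) j - (\<Sum>i<d. (\<Sum>l<d. k j l * m l i) * (x i - y i))\<bar> \<le> e * l1 d x y)"
    using est \<delta> by blast
qed

lemma strict_deriv_unique:
  assumes F: "strict_deriv d F m p" and G: "strict_deriv d F k p" and p: "p \<in> topspace (Euclidean_space d)"
    and j: "j < d" and i: "i < d"
  shows "m j i = k j i"
proof (rule ccontr)
  assume ne: "m j i \<noteq> k j i"
  \<comment> \<open>The two error bounds add up to \<open>2 * e * h\<close>, while the derivatives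
    differ by \<open>4 * e * h\<close> over the increment \<open>h\<close>.\<close>
  define e where "e = \<bar>m j i - k j i\<bar> / 4"
  have e: "e > 0" using ne by (simp add: e_def)
  let ?E = "topspace (Euclidean_space d)"
  obtain \<delta>1 where \<delta>1: "\<delta>1 > 0" "\<And>x y j. x \<in> ?E \<Longrightarrow> y \<in> ?E \<Longrightarrow> l1 d x p < \<delta>1 \<Longrightarrow> l1 d y p < \<delta>1 \<Longrightarrow> j < d \<Longrightarrow>
    \<bar>F x j - F y j - (\<Sum>i<d. m j i * (x i - y i))\<bar> \<le> e * l1 d x y"
    using strict_derivD[OF F e] by blast
  obtain \<delta>2 where \<delta>2: "\<delta>2 > 0" "\<And>x y j. x \<in> ?E \<Longrightarrow> y \<in> ?E \<Longrightarrow> l1 d x p < \<delta>2 \<Longrightarrow> l1 d y p < \<delta>2 \<Longrightarrow> j < d \<Longrightarrow>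
    \<bar>F x j - F y j - (\<Sum>i<d. k j i * (x i - y i))\<bar> \<le> e * l1 d x y"
    using strict_derivD[OF G e] by blast
  define h where "h = min \<delta>1 \<delta>2 / 2"
  have h: "h > 0" "h < \<delta>1" "h < \<delta>2" using \<delta>1 \<delta>2 by (auto simp: h_def min_def)
  define x where "x = p(i := p i + h)"
  have diff: "x l - p l = (if l = i then h else 0)" for l by (simp add: x_def)
  have xE: "x \<in> ?E" using p i by (auto simp: x_def topspace_Euclidean_space)
  have l: "l1 d x p = h"
    using i h(1) by (simp add: l1_def diff if_distrib[of abs] cong: if_cong)
  have s: "(\<Sum>l<d. n j l * (x l - p l)) = n j i * h" for n :: "nat \<Rightarrow> nat \<Rightarrow> real"
    using i by (simp add: diff if_distrib[of "(*) _"] cong: if_cong)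
  have "\<bar>F x j - F p j - m j i * h\<bar> \<le> e * h" "\<bar>F x j - F p j - k j i * h\<bar> \<le> e * h"
    using \<delta>1(2)[OF xE p _ _ j] \<delta>2(2)[OF xE p _ _ j] \<delta>1(1) \<delta>2(1) h l s by simp_all
  then have "\<bar>m j i * h - k j i * h\<bar> \<le> 2 * (e * h)" by linarith
  then have "\<bar>m j i - k j i\<bar> * h \<le> 2 * e * h" using h(1) by (simp add: abs_mult left_diff_distrib[symmetric])
  then have "\<bar>m j i - k j i\<bar> \<le> 2 * e" using h(1) by simp
  then show False using e by (simp add: e_def)
qed

text \<open>Near \<open>p\<close> the map differs from the identity by a contraction. Injectivity
  and continuity are the input for invariance of domain, which will supply openness of the image and
  continuity of the inverse.\<close>

lemma strict_deriv_id_injective: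
  assumes F: "strict_deriv d F (\<lambda>j i. if i = j then 1 else 0) p" and p: "p \<in> topspace (Euclidean_space d)"
  shows "\<exists>W. openin (Euclidean_space d) W \<and> p \<in> W \<and> inj_on F W \<and>
    (\<forall>j<d. continuous_map (subtopology (Euclidean_space d) W) euclideanreal (\<lambda>x. F x j))"
proof -
  let ?E = "topspace (Euclidean_space d)"
  \<comment> \<open>Summed over \<open>d\<close> coordinates the error is less than half of the
    distance, which forces the distance of two points with equal images to be 0. Using
    \<open>d + 1\<close> keeps the constant positive for \<open>d = 0\<close>.\<close>
  have e: "1 / (2 * (real d + 1)) > 0" by simp
  obtain \<delta> where \<delta>: "\<delta> > 0" "\<And>x y j. x \<in> ?E \<Longrightarrow> y \<in> ?E \<Longrightarrow> l1 d x p < \<delta> \<Longrightarrow> l1 d y p < \<delta> \<Longrightarrow> j < d \<Longrightarrow>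
    \<bar>F x j - F y j - (\<Sum>i<d. (if i = j then 1 else 0) * (x i - y i))\<bar> \<le> 1 / (2 * (real d + 1)) * l1 d x y"
    using strict_derivD[OF F e] by blast
  define W where "W = {x \<in> ?E. l1 d x p < \<delta>}"
  have W: "openin (Euclidean_space d) W" unfolding W_def by (rule openin_l1_ball)
  have est: "\<bar>F x j - F y j - (x j - y j)\<bar> \<le> 1 / (2 * (real d + 1)) * l1 d x y"
    if "x \<in> W" "y \<in> W" "j < d" for x y j
    using \<delta>(2)[of x y j] that by (simp add: W_def if_distrib[of "\<lambda>c. c * _"] cong: if_cong)
  have "inj_on F W"
  proof (rule inj_onI)
    fix x y assume xy: "x \<in> W" "y \<in> W" "F x = F y"
    have "\<bar>x j - y j\<bar> \<le> 1 / (2 * (real d + 1)) * l1 d x y" if "j < d" for j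
      using est[OF xy(1,2) that] xy(3) by simp
    then have "l1 d x y \<le> real d * (1 / (2 * (real d + 1)) * l1 d x y)" by (rule l1_le)
    also have "\<dots> = (real d / (real d + 1)) * (l1 d x y / 2)" by simp
    also have "\<dots> \<le> 1 * (l1 d x y / 2)"
      using l1_nonneg[of d x y] by (intro mult_right_mono) simp_all
    finally have "l1 d x y = 0" using l1_nonneg[of d x y] by simp
    then show "x = y" using xy l1_eq_0 by (auto simp: W_def)
  qed
  moreover have "continuous_map (subtopology (Euclidean_space d) W) euclideanreal (\<lambda>x. F x j)" if j: "j < d" for j
  proof -
    have WE: "W \<subseteq> {x. \<forall>i\<ge>d. x i = 0}" by (auto simp: W_def topspace_Euclidean_space)
    have "continuous_on W (\<lambda>x. F x j)"
    proof (rule continuous_onI_openin)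
      fix x and e :: real assume x: "x \<in> W" and e: "e > 0"
      let ?B = "W \<inter> {y \<in> ?E. l1 d y x < e / 2}"
      have "openin (top_of_set {x. \<forall>i\<ge>d. x i = 0}) ?B"
        using openin_Int[OF W openin_l1_ball[of d x "e/2"]] unfolding Euclidean_space_eq_top_of_set .
      then have "openin (top_of_set W) ?B" using openin_subset_trans[OF _ _ WE] by blast
      moreover have "x \<in> ?B" using x e by (auto simp: W_def)
      moreover have "dist (F y j) (F x j) < e" if y: "y \<in> ?B" for y
      proof -
        have yW: "y \<in> W" and ly: "l1 d y x < e / 2" using y by auto
        have "1 / (2 * (real d + 1)) * l1 d y x \<le> 1 * l1 d y x"
          using l1_nonneg[of d y x] by (intro mult_right_mono) auto
        then show ?thesis using est[OF yW x j] l1_coord[OF j, of y x] ly unfolding dist_real_def by linarith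
      qed
      ultimately show "\<exists>U. openin (top_of_set W) U \<and> x \<in> U \<and> (\<forall>y\<in>U. dist (F y j) (F x j) < e)"
        by blast
    qed
    moreover have "subtopology (Euclidean_space d) W = top_of_set W"
      unfolding Euclidean_space_eq_top_of_set subtopology_subtopology using WE by (simp add: Int_absorb1)
    ultimately have "continuous_map (subtopology (Euclidean_space d) W) euclideanreal (\<lambda>x. F x j)" by simp
    then show ?thesis .
  qed
  ultimately show ?thesis using W \<delta>(1) p by (intro exI[of _ W]) (auto simp: W_def)
qed

section \<open>Smooth manifolds\<close>

lemma strict_deriv_cong_matrix:
  assumes "strict_deriv d F m p" "\<And>j i. j < d \<Longrightarrow> i < d \<Longrightarrow> k j i = m j i"
  shows "strict_deriv d F k p"
proof -
  have "(\<Sum>i<d. k j i * (x i - y i)) = (\<Sum>i<d. m j i * (x i - y i))" if "j < d" for j and x y :: "nat \<Rightarrow> real"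
    using assms(2) that by (intro sum.cong) auto
  then show ?thesis using assms(1) by (simp add: strict_deriv_def cong: conj_cong)
qed

lemma strict_deriv_id: "strict_deriv d (\<lambda>x. x) (\<lambda>j i. if i = j then 1 else 0) p"
proof -
  have "(\<Sum>i<d. (if i = j then 1 else 0) * (x i - y i)) = x j - y j" if "j < d" for j and x y :: "nat \<Rightarrow> real"
    using that by (simp add: if_distrib[of "\<lambda>c. c * _"] cong: if_cong)
  then show ?thesis unfolding strict_deriv_def
    by (intro allI impI exI[of _ 1]) (auto simp: l1_nonneg)
qed

lemma mat_map_sum: "mat_map d k (\<lambda>i. \<Sum>r\<in>R. c * v r i) j = (\<Sum>r\<in>R. c * mat_map d k (v r) j)"
proof (cases "j < d")
  case True
  have "(\<Sum>i<d. k j i * (\<Sum>r\<in>R. c * v r i)) = (\<Sum>i<d. \<Sum>r\<in>R. c * (k j i * v r i))"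
    by (simp add: sum_distrib_left mult.left_commute)
  also have "\<dots> = (\<Sum>r\<in>R. \<Sum>i<d. c * (k j i * v r i))" by (rule sum.swap)
  finally show ?thesis using True by (simp add: mat_map_def sum_distrib_left)
qed (simp add: mat_map_def)

lemma openin_Ball_finite:
  assumes "finite J" "\<And>j. j \<in> J \<Longrightarrow> openin X {x \<in> topspace X. P j x}"
  shows "openin X {x \<in> topspace X. \<forall>j\<in>J. P j x}"
  using assms
proof (induction J)
  case (insert j J)
  have "openin X ({x \<in> topspace X. P j x} \<inter> {x \<in> topspace X. \<forall>j\<in>J. P j x})"
    using insert by (intro openin_Int) auto
  moreover have "{x \<in> topspace X. P j x} \<inter> {x \<in> topspace X. \<forall>j\<in>J. P j x} = {x \<in> topspace X. \<forall>j\<in>insert j J. P j x}"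
    by auto
  ultimately show ?case by simp
qed simp

text \<open>Near a point with stabilizer \<open>Q\<close>, averaging a chart over \<open>Q\<close> yields a chart in which \<open>Q\<close> acts
  linearly.\<close>

lemma smooth_G_manifold_has_transport:
  fixes G (structure)
  assumes G: "group G" and fin: "finite (carrier G)" and M: "smooth_G_manifold G act d M"
  shows "has_transport TYPE('k::{metric_space, second_countable_topology}) M (fix_label (carrier G) act)"
proof -
  interpret group G by (rule G)
  interpret action: group_action G "topspace M" act using M by (simp add: smooth_G_manifold_def)
  let ?X = "Euclidean_space d"
  let ?E = "topspace ?X"
  have HM: "Hausdorff_space M" using M by (simp add: smooth_G_manifold_def)
  have HX: "Hausdorff_space ?X"
    unfolding Euclidean_space_eq_top_of_set by (simp add: Hausdorff_space_subtopology)
  have actc: "continuous_map M M (act g)" if "g \<in> carrier G" for g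
    using M that by (simp add: smooth_G_manifold_def)
  have actM: "act g z \<in> topspace M" if "g \<in> carrier G" "z \<in> topspace M" for g z
    using action.element_image that by blast
  have act1: "act \<one> z = z" if "z \<in> topspace M" for z
    using action.id_eq_one that by (metis restrict_apply')
  have actmult: "act (g \<otimes> h) z = act g (act h z)" if "g \<in> carrier G" "h \<in> carrier G" "z \<in> topspace M" for g h z
    using action.composition_rule that by blast
  obtain A where A: "smooth_atlas d M A"
    "\<And>g U \<phi> V \<psi>. g \<in> carrier G \<Longrightarrow> (U, \<phi>) \<in> A \<Longrightarrow> (V, \<psi>) \<in> A \<Longrightarrow>
      smooth_map_on d (\<psi> ` (V \<inter> {y \<in> topspace M. act g y \<in> U})) (\<phi> \<circ> act g \<circ> inv_into V \<psi>)"
    using M unfolding smooth_G_manifold_def by fast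
  have "\<exists>N. openin M N \<and> p \<in> N \<and> has_transport TYPE('k) (subtopology M N) (fix_label (carrier G) act)"
    if p: "p \<in> topspace M" for p
  proof -
    obtain U \<phi> where U: "(U, \<phi>) \<in> A" "p \<in> U" using A(1) p unfolding smooth_atlas_def by force
    have Uo: "openin M U" and \<phi>Uo: "openin ?X (\<phi> ` U)"
      and hom: "homeomorphic_map (subtopology M U) (subtopology ?X (\<phi> ` U)) \<phi>"
      using A(1) U(1) unfolding smooth_atlas_def by blast+
    have UM: "U \<subseteq> topspace M" using Uo openin_subset by blast
    have \<phi>E: "\<phi> z \<in> ?E" if "z \<in> U" for z using \<phi>Uo openin_subset that by blast
    have topU: "topspace (subtopology M U) = U" using UM by auto
    have inj\<phi>: "inj_on \<phi> U" using homeomorphic_imp_injective_map[OF hom] topU by simp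
    define \<psi> where "\<psi> = inv_into U \<phi>"
    have \<psi>\<phi>: "\<psi> (\<phi> z) = z" if "z \<in> U" for z using inj\<phi> that by (simp add: \<psi>_def)
    have \<phi>open: "openin ?X (\<phi> ` V)" if "openin M V" "V \<subseteq> U" for V
    proof -
      have "openin (subtopology M U) V" using that by (metis openin_subtopology_Int2 inf.absorb2)
      then have "openin (subtopology ?X (\<phi> ` U)) (\<phi> ` V)"
        using homeomorphic_imp_open_map[OF hom] by (simp add: open_map_def)
      then show ?thesis using \<phi>Uo openin_trans_full by blast
    qed
    have \<phi>pre: "openin M {z \<in> U. \<phi> z \<in> W}" if "openin ?X W" for W
    proof -
      have "continuous_map (subtopology M U) ?X \<phi>"
        using homeomorphic_imp_continuous_map[OF hom] continuous_map_in_subtopology by blast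
      from openin_continuous_map_preimage[OF this that]
      have "openin (subtopology M U) {z \<in> U. \<phi> z \<in> W}" unfolding topU .
      then show ?thesis using Uo openin_trans_full by blast
    qed
    define a where "a = \<phi> p"
    have aE: "a \<in> ?E" using \<phi>E U(2) by (simp add: a_def)
    define Q where "Q = stabilizer G act p"
    have Q: "subgroup Q G" unfolding Q_def by (rule action.stabilizer_subgroup[OF p])
    have QG: "Q \<subseteq> carrier G" using subgroup.subset[OF Q] .
    have Qfin: "finite Q" using QG fin finite_subset by blast
    have oneQ: "\<one> \<in> Q" using subgroup.one_closed[OF Q] .
    have invQ: "inv q \<in> Q" if "q \<in> Q" for q using subgroup.m_inv_closed[OF Q that] .
    have multQ: "q \<otimes> r \<in> Q" if "q \<in> Q" "r \<in> Q" for q r using subgroup.m_closed[OF Q that] .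
    have Qp: "act q p = p" if "q \<in> Q" for q using that by (simp add: Q_def stabilizer_def)
    define D where "D = (\<lambda>q. U \<inter> {y \<in> topspace M. act q y \<in> U})"
    have Do: "openin M (D q)" if "q \<in> Q" for q
      unfolding D_def using openin_continuous_map_preimage[OF actc Uo, of q] QG that by (intro openin_Int Uo) auto
    have Dp: "p \<in> D q" if "q \<in> Q" for q using Qp[OF that] U(2) p by (simp add: D_def)
    \<comment> \<open>The action read in the chart. Outside the image of \<open>D q\<close> the
      values are arbitrary; only the germ at \<open>a\<close> is used.\<close>
    define F where "F = (\<lambda>q x. \<phi> (act q (\<psi> x)))"
    define m where "m = (\<lambda>q j i. iter_partial [i] (\<lambda>x. F q x j) a)"
    have F\<phi>: "F q (\<phi> z) = \<phi> (act q z)" if "z \<in> U" for q z using \<psi>\<phi>[OF that] by (simp add: F_def)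
    have Fa: "F q a = a" if "q \<in> Q" for q using F\<phi>[OF U(2)] Qp[OF that] by (simp add: a_def)
    have aD: "a \<in> \<phi> ` D q" if "q \<in> Q" for q using Dp[OF that] by (simp add: a_def)
    have \<phi>Do: "openin ?X (\<phi> ` D q)" if "q \<in> Q" for q by (rule \<phi>open[OF Do[OF that]]) (auto simp: D_def)
    have der: "strict_deriv d (F q) (m q) a" if q: "q \<in> Q" for q
      unfolding m_def
    proof (rule smooth_map_on_strict_deriv[OF \<phi>Do[OF q] aD[OF q]])
      have "smooth_map_on d (\<phi> ` D q) (\<phi> \<circ> act q \<circ> inv_into U \<phi>)"
        unfolding D_def using A(2)[OF _ U(1) U(1), of q] q QG by blast
      then show "smooth_map_on d (\<phi> ` D q) (F q)" by (simp add: F_def \<psi>_def o_def)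
    qed
    \<comment> \<open>Since every \<open>F q\<close> fixes \<open>a\<close>, the chain rule and
      uniqueness of the derivative make the Jacobians at \<open>a\<close> a representation of
      \<open>Q\<close>.\<close>
    have mmult: "m (q \<otimes> r) j i = (\<Sum>l<d. m q j l * m r l i)" if q: "q \<in> Q" "r \<in> Q" and ji: "j < d" "i < d" for q r j i
    proof (rule strict_deriv_unique[OF der[OF multQ[OF q]] _ aE ji])
      have "strict_deriv d (\<lambda>x. F q (F r x)) (\<lambda>j i. \<Sum>l<d. m q j l * m r l i) a"
      proof (rule strict_deriv_compose[OF der[OF q(2)] _ \<phi>Do[OF q(2)] aD[OF q(2)]])
        show "strict_deriv d (F q) (m q) (F r a)" using der[OF q(1)] Fa[OF q(2)] by simp
        show "F r x \<in> ?E" if "x \<in> \<phi> ` D r" for x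
          using that F\<phi> \<phi>E by (auto simp: D_def)
      qed
      then show "strict_deriv d (F (q \<otimes> r)) (\<lambda>j i. \<Sum>l<d. m q j l * m r l i) a"
      proof (rule strict_deriv_cong[OF _ \<phi>Do[OF q(2)] aD[OF q(2)]])
        fix x and j :: nat assume "x \<in> \<phi> ` D r"
        then obtain z where z: "x = \<phi> z" "z \<in> U" "act r z \<in> U" by (auto simp: D_def)
        have "act (q \<otimes> r) z = act q (act r z)" using actmult q QG UM z(2) by blast
        then show "F (q \<otimes> r) x j = F q (F r x) j"
          using F\<phi>[OF z(2)] F\<phi>[OF z(3)] z(1) by simp
      qed
    qed
    have mone: "m \<one> j i = (if i = j then 1 else 0)" if ji: "j < d" "i < d" for j i
    proof (rule strict_deriv_unique[OF der[OF oneQ] _ aE ji])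
      show "strict_deriv d (F \<one>) (\<lambda>j i. if i = j then 1 else 0) a"
      proof (rule strict_deriv_cong[OF strict_deriv_id \<phi>Do[OF oneQ] aD[OF oneQ]])
        show "F \<one> x j = x j" if "x \<in> \<phi> ` D \<one>" for x j
          using that F\<phi> act1 by (auto simp: D_def)
      qed
    qed
    let ?L = "\<lambda>q. mat_map d (m q)"
    have Lmult: "?L (q \<otimes> r) x = ?L q (?L r x)" if q: "q \<in> Q" "r \<in> Q" for q r x
    proof
      fix j
      show "?L (q \<otimes> r) x j = ?L q (?L r x) j"
      proof (cases "j < d")
        case True
        have "?L (q \<otimes> r) x j = (\<Sum>i<d. \<Sum>l<d. m q j l * (m r l i * x i))"
          using True mmult[OF q True] by (simp add: mat_map_def sum_distrib_right mult.assoc)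
        also have "\<dots> = (\<Sum>l<d. \<Sum>i<d. m q j l * (m r l i * x i))" by (rule sum.swap)
        also have "\<dots> = ?L q (?L r x) j" using True by (simp add: mat_map_def sum_distrib_left)
        finally show ?thesis .
      qed (simp add: mat_map_def)
    qed
    have Lone: "?L \<one> x = x" if "x \<in> ?E" for x
    proof
      fix j
      show "?L \<one> x j = x j"
        using that mone by (cases "j < d") (auto simp: mat_map_def topspace_Euclidean_space
            if_distrib[of "\<lambda>c. c * _"] cong: if_cong)
    qed
    have TPX: "has_transport TYPE('k) ?X (fix_label Q ?L)"
    proof -
      interpret Qg: group "G\<lparr>carrier := Q\<rparr>" using subgroup.subgroup_is_group[OF Q G] .
      show ?thesis
        using Qg.has_transport_Euclidean_space[of d m Q] Qfin Lone Lmult Qg.subgroup_self by simp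
    qed
    define c where "c = 1 / real (card Q)"
    \<comment> \<open>The linearizing average: conjugating a summand by an element of
      \<open>Q\<close> permutes the summands, and at \<open>a\<close> each summand has derivative
      \<open>m (inv q)\<close> times \<open>m q\<close>, the identity.\<close>
    define \<Phi> where "\<Phi> = (\<lambda>x j. \<Sum>q\<in>Q. c * ?L (inv q) (F q x) j)"
    have cQ: "real (card Q) * c = 1"
      using Qfin oneQ by (auto simp: c_def card_eq_0_iff)
    have \<Phi>E: "\<Phi> x \<in> ?E" for x by (simp add: \<Phi>_def mat_map_def topspace_Euclidean_space)
    have "strict_deriv d \<Phi> (\<lambda>j i. \<Sum>q\<in>Q. c * (\<Sum>l<d. m (inv q) j l * m q l i)) a"
      unfolding \<Phi>_def
    proof (rule strict_deriv_average[OF Qfin])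
      fix q assume q: "q \<in> Q"
      show "strict_deriv d (\<lambda>x. ?L (inv q) (F q x)) (\<lambda>j i. \<Sum>l<d. m (inv q) j l * m q l i) a"
      proof (rule strict_deriv_compose[OF der[OF q] strict_deriv_mat_map \<phi>Do[OF q] aD[OF q]])
        show "F q x \<in> ?E" if "x \<in> \<phi> ` D q" for x using that F\<phi> \<phi>E by (auto simp: D_def)
      qed
    qed
    then have "strict_deriv d \<Phi> (\<lambda>j i. if i = j then 1 else 0) a"
    proof (rule strict_deriv_cong_matrix)
      fix j i assume ji: "j < d" "i < d"
      have "(\<Sum>q\<in>Q. c * (\<Sum>l<d. m (inv q) j l * m q l i)) = (\<Sum>q\<in>Q. c * (if i = j then 1 else 0))"
      proof (rule sum.cong[OF refl])
        fix q assume q: "q \<in> Q"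
        have "(\<Sum>l<d. m (inv q) j l * m q l i) = m (inv q \<otimes> q) j i" using mmult[OF invQ[OF q] q ji] by simp
        also have "inv q \<otimes> q = \<one>" using q QG by auto
        finally show "c * (\<Sum>l<d. m (inv q) j l * m q l i) = c * (if i = j then 1 else 0)" using mone[OF ji] by simp
      qed
      also have "\<dots> = (if i = j then 1 else 0)" using cQ by simp
      finally show "(if i = j then 1 else 0) = (\<Sum>q\<in>Q. c * (\<Sum>l<d. m (inv q) j l * m q l i))" by simp
    qed
    from strict_deriv_id_injective[OF this aE] obtain W where W: "openin ?X W" "a \<in> W" "inj_on \<Phi> W"
      "\<And>j. j < d \<Longrightarrow> continuous_map (subtopology ?X W) euclideanreal (\<lambda>x. \<Phi> x j)" by blast
    have \<Phi>c: "continuous_map (subtopology ?X W) ?X \<Phi>"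
    proof -
      have "continuous_map (subtopology ?X W) ?X (\<lambda>x i. if i < d then \<Phi> x i else 0)"
        unfolding continuous_map_componentwise_Euclidean_space using W(4) by blast
      moreover have "(\<lambda>x i. if i < d then \<Phi> x i else 0) = \<Phi>"
        by (auto simp: \<Phi>_def mat_map_def fun_eq_iff)
      ultimately show ?thesis by simp
    qed
    define V where "V = {z \<in> U. \<phi> z \<in> W}"
    have Vo: "openin M V" unfolding V_def by (rule \<phi>pre[OF W(1)])
    \<comment> \<open>The first set keeps all \<open>Q\<close>-translates of a point in the part of
      the chart where \<open>\<Phi>\<close> is injective. On the second no element outside
      \<open>Q\<close> fixes a point; it is open because \<open>M\<close> is Hausdorff and the group
      finite. Together they let stabilizers be read off from \<open>Q\<close> and
      \<open>\<Phi>\<close> alone.\<close>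
    define N where "N = {z \<in> topspace M. \<forall>q\<in>Q. act q z \<in> V} \<inter> {z \<in> topspace M. \<forall>g\<in>carrier G - Q. act g z \<noteq> z}"
    have No: "openin M N"
      unfolding N_def
    proof (rule openin_Int)
      show "openin M {z \<in> topspace M. \<forall>q\<in>Q. act q z \<in> V}"
        by (rule openin_Ball_finite[OF Qfin], rule openin_continuous_map_preimage[OF _ Vo], rule actc) (use QG in blast)
      show "openin M {z \<in> topspace M. \<forall>g\<in>carrier G - Q. act g z \<noteq> z}"
      proof (rule openin_Ball_finite)
        fix g assume "g \<in> carrier G - Q"
        then have "closedin M {z \<in> topspace M. act g z = z}"
          using closedin_continuous_maps_eq[OF HM actc continuous_map_id[unfolded id_def]] by simp
        then have "openin M (topspace M - {z \<in> topspace M. act g z = z})" by blast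
        moreover have "topspace M - {z \<in> topspace M. act g z = z} = {z \<in> topspace M. act g z \<noteq> z}" by auto
        ultimately show "openin M {z \<in> topspace M. act g z \<noteq> z}" by simp
      qed (use fin in simp)
    qed
    have pN: "p \<in> N"
      using p Qp U(2) W(2) by (auto simp: N_def V_def a_def Q_def stabilizer_def)
    have NM: "N \<subseteq> topspace M" by (auto simp: N_def)
    have NV: "act q z \<in> V" if "z \<in> N" "q \<in> Q" for z q using that by (simp add: N_def)
    have VU: "V \<subseteq> U" by (auto simp: V_def)
    have NV1: "N \<subseteq> V"
    proof
      fix z assume "z \<in> N"
      then show "z \<in> V" using NV[OF _ oneQ, of z] act1 NM by auto
    qed
    have NU: "N \<subseteq> U" using NV1 VU by blast
    have \<phi>NW: "\<phi> ` N \<subseteq> W" using NV1 by (auto simp: V_def)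
    have equiv: "\<Phi> (\<phi> (act q z)) = ?L q (\<Phi> (\<phi> z))" if z: "z \<in> N" and q: "q \<in> Q" for z q
    proof
      fix j
      have zM: "z \<in> topspace M" using z NM by blast
      have "?L q (\<Phi> (\<phi> z)) j = (\<Sum>r\<in>Q. c * ?L q (?L (inv r) (F r (\<phi> z))) j)"
        unfolding \<Phi>_def by (rule mat_map_sum)
      also have "\<dots> = (\<Sum>r\<in>Q. c * ?L (q \<otimes> inv r) (F r (\<phi> z)) j)"
        using Lmult[OF q invQ] by simp
      \<comment> \<open>Substitute \<open>r = s \<otimes> q\<close>, so that \<open>q\<close>
        cancels in the matrix and moves onto the point.\<close>
      also have "\<dots> = (\<Sum>s\<in>Q. c * ?L (q \<otimes> inv (s \<otimes> q)) (F (s \<otimes> q) (\<phi> z)) j)"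
      proof (rule sum.reindex_bij_betw[symmetric])
        show "bij_betw (\<lambda>s. s \<otimes> q) Q Q"
        proof (rule bij_betw_byWitness[where f' = "\<lambda>s. s \<otimes> inv q"])
          show "(\<lambda>s. s \<otimes> q) ` Q \<subseteq> Q" "(\<lambda>s. s \<otimes> inv q) ` Q \<subseteq> Q"
            using multQ q invQ[OF q] by auto
        qed (use q QG in \<open>auto simp: m_assoc subset_iff\<close>)
      qed
      also have "\<dots> = (\<Sum>s\<in>Q. c * ?L (inv s) (F s (\<phi> (act q z))) j)"
      proof (rule sum.cong[OF refl])
        fix s assume s: "s \<in> Q"
        have sq: "s \<in> carrier G" "q \<in> carrier G" using s q QG by auto
        then have "q \<otimes> inv (s \<otimes> q) = inv s" by (simp add: inv_mult_group m_assoc[symmetric])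
        moreover have "z \<in> U" "act q z \<in> U" using NU z NV[OF z q] VU by blast+
        then have "F (s \<otimes> q) (\<phi> z) = F s (\<phi> (act q z))"
          using F\<phi> actmult[OF sq zM] by simp
        ultimately show "c * ?L (q \<otimes> inv (s \<otimes> q)) (F (s \<otimes> q) (\<phi> z)) j = c * ?L (inv s) (F s (\<phi> (act q z))) j"
          by simp
      qed
      finally show "\<Phi> (\<phi> (act q z)) j = ?L q (\<Phi> (\<phi> z)) j" by (simp add: \<Phi>_def)
    qed
    have lab: "fix_label (carrier G) act z = fix_label Q ?L (\<Phi> (\<phi> z))" if z: "z \<in> N" for z
    proof -
      have "act q z = z \<longleftrightarrow> ?L q (\<Phi> (\<phi> z)) = \<Phi> (\<phi> z)" if q: "q \<in> Q" for q
      proof -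
        have V: "act q z \<in> V" "z \<in> V" using NV[OF z q] NV1 z by auto
        have "act q z = z \<longleftrightarrow> \<phi> (act q z) = \<phi> z"
          using inj_on_eq_iff[OF inj\<phi>, of "act q z" z] V VU by blast
        also have "\<dots> \<longleftrightarrow> \<Phi> (\<phi> (act q z)) = \<Phi> (\<phi> z)"
          using W(3) V by (auto simp: V_def inj_on_eq_iff)
        finally show ?thesis using equiv[OF z q] by simp
      qed
      moreover have "g \<in> Q" if "g \<in> carrier G" "act g z = z" for g using z that by (auto simp: N_def)
      ultimately show ?thesis using QG unfolding fix_label_def by blast
    qed
    have \<phi>No: "openin ?X (\<phi> ` N)" by (rule \<phi>open[OF No NU])
    have \<Phi>cN: "continuous_map (subtopology ?X (\<phi> ` N)) ?X \<Phi>"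
      using continuous_map_from_subtopology_mono[OF \<Phi>c \<phi>NW] .
    have injN: "inj_on \<Phi> (\<phi> ` N)" using W(3) \<phi>NW inj_on_subset by blast
    have \<phi>NE: "topspace (subtopology ?X (\<phi> ` N)) = \<phi> ` N"
      using openin_subset[OF \<phi>No] by auto
    \<comment> \<open>Invariance of domain makes the injective continuous map \<open>\<Phi>\<close>
      a homeomorphism onto an open set.\<close>
    have hom2: "homeomorphic_map (subtopology ?X (\<phi> ` N)) (subtopology ?X (\<Phi> ` \<phi> ` N)) \<Phi>"
      using invariance_of_domain_Euclidean_space_embedding_map[OF \<phi>No \<Phi>cN injN]
      unfolding embedding_map_def \<phi>NE .
    have hom1: "homeomorphic_map (subtopology M N) (subtopology ?X (\<phi> ` N)) \<phi>"
    proof -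
      have "homeomorphic_map (subtopology (subtopology M U) N) (subtopology (subtopology ?X (\<phi> ` U)) (\<phi> ` N)) \<phi>"
      proof (rule homeomorphic_map_subtopologies[OF hom])
        show "\<phi> ` (topspace (subtopology M U) \<inter> N) = topspace (subtopology ?X (\<phi> ` U)) \<inter> \<phi> ` N"
          using NU NM \<phi>E by auto
      qed
      moreover have "U \<inter> N = N" "\<phi> ` U \<inter> \<phi> ` N = \<phi> ` N" using NU by auto
      ultimately show ?thesis by (simp add: subtopology_subtopology)
    qed
    have "homeomorphic_map (subtopology M N) (subtopology ?X (\<Phi> ` \<phi> ` N)) (\<Phi> \<circ> \<phi>)"
      by (rule homeomorphic_map_compose[OF hom1 hom2])
    then obtain g where g: "homeomorphic_maps (subtopology M N) (subtopology ?X (\<Phi> ` \<phi> ` N)) (\<Phi> \<circ> \<phi>) g"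
      unfolding homeomorphic_map_maps by blast
    have "openin ?X (\<Phi> ` \<phi> ` N)" by (rule invariance_of_domain_Euclidean_space[OF \<phi>No \<Phi>cN injN])
    from has_transport_open_subspace[OF HX this TPX]
    have "has_transport TYPE('k) (subtopology M N) (fix_label (carrier G) act)"
      by (rule has_transport_homeomorphic[OF _ g]) (use lab in auto)
    then show ?thesis using No pN by blast
  qed
  then show ?thesis by (rule has_transport_local[OF HM])
qed

section \<open>Linking simplices\<close>

lemma openin_quotient_topology:
  "openin (quotient_topology X q) U \<longleftrightarrow> U \<subseteq> q ` topspace X \<and> openin X {x \<in> topspace X. q x \<in> U}"
proof -
  have "istopology (\<lambda>U. U \<subseteq> q ` topspace X \<and> openin X {x \<in> topspace X. q x \<in> U})"
    unfolding istopology_def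
  proof (intro conjI allI impI; (elim conjE)?)
    fix S T
    assume "openin X {x \<in> topspace X. q x \<in> S}" "openin X {x \<in> topspace X. q x \<in> T}"
    from openin_Int[OF this] show "openin X {x \<in> topspace X. q x \<in> S \<inter> T}"
      by (rule back_subst[of "openin X"]) auto
  next
    fix \<K> assume K: "\<forall>S\<in>\<K>. S \<subseteq> q ` topspace X \<and> openin X {x \<in> topspace X. q x \<in> S}"
    then show "\<Union>\<K> \<subseteq> q ` topspace X" by blast
    have "openin X (\<Union>S\<in>\<K>. {x \<in> topspace X. q x \<in> S})" using K by blast
    then show "openin X {x \<in> topspace X. q x \<in> \<Union>\<K>}"
      by (rule back_subst[of "openin X"]) auto
  qed blast
  then show ?thesis unfolding quotient_topology_def by simp
qed

lemma topspace_quotient_topology: "topspace (quotient_topology X q) = q ` topspace X"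
proof
  show "topspace (quotient_topology X q) \<subseteq> q ` topspace X"
    using openin_quotient_topology[of X q] openin_topspace by blast
  have "{x \<in> topspace X. q x \<in> q ` topspace X} = topspace X" by auto
  then have "openin (quotient_topology X q) (q ` topspace X)"
    unfolding openin_quotient_topology by simp
  then show "q ` topspace X \<subseteq> topspace (quotient_topology X q)" using openin_subset by blast
qed

lemma continuous_map_into_quotient_topology: "continuous_map X (quotient_topology X q) q"
  unfolding continuous_map_def topspace_quotient_topology openin_quotient_topology by auto

lemma continuous_map_from_quotient_topology:
  assumes "continuous_map X Y (f \<circ> q)"
  shows "continuous_map (quotient_topology X q) Y f"
  unfolding continuous_map_def topspace_quotient_topology openin_quotient_topology
proof (intro conjI allI impI)
  show "f \<in> q ` topspace X \<rightarrow> topspace Y" using continuous_map_funspace[OF assms] by auto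
  show "openin X {x \<in> topspace X. q x \<in> {x \<in> q ` topspace X. f x \<in> U}}" if "openin Y U" for U
    using openin_continuous_map_preimage[OF assms that] by (rule back_subst[of "openin X"]) auto
qed auto

lemma closedin_quotient_topology:
  assumes "U \<subseteq> q ` topspace X" "closedin X {x \<in> topspace X. q x \<in> U}"
  shows "closedin (quotient_topology X q) U"
  unfolding closedin_def topspace_quotient_topology openin_quotient_topology
proof (intro conjI)
  have "openin X (topspace X - {x \<in> topspace X. q x \<in> U})" using assms(2) by blast
  then show "openin X {x \<in> topspace X. q x \<in> q ` topspace X - U}"
    by (rule back_subst[of "openin X"]) auto
qed (use assms in auto)

text \<open>The vanishing of the last \<open>k\<close> coordinates persists for smaller
  \<open>k\<close>, so having index at least \<open>k\<close> is a closed condition: it describes a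
  face.\<close>

lemma link_index_ge_iff: "k \<le> link_index m x \<longleftrightarrow> k \<le> m \<and> (\<forall>i. m - k < i \<and> i \<le> m \<longrightarrow> x i = 0)"
proof -
  let ?P = "\<lambda>k. k \<le> m \<and> (\<forall>i. m - k < i \<and> i \<le> m \<longrightarrow> x i = 0)"
  have P: "?P (link_index m x)"
    unfolding link_index_def by (rule GreatestI_nat[where k = 0 and b = m]) auto
  show ?thesis
  proof
    assume "k \<le> link_index m x"
    then show "?P k" using P by auto
  next
    assume "?P k"
    then show "k \<le> link_index m x"
      unfolding link_index_def by (rule Greatest_le_nat[where b = m]) auto
  qed
qed

section \<open>Retracting a neighbourhood of the boundary of the simplex\<close>

lemma continuous_on_Min_coordinates:
  assumes "finite A" "A \<noteq> {}"
  shows "continuous_on S (\<lambda>x :: nat \<Rightarrow> real. Min (x ` A))"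
  using assms
proof (induction A rule: finite_ne_induct)
  case (singleton i)
  then show ?case using continuous_on_subset[OF continuous_on_product_coordinates[of i]] by simp
next
  case (insert i A)
  have "continuous_on S (\<lambda>x. min (x i) (Min (x ` A)))"
    by (intro continuous_intros insert.IH continuous_on_subset[OF continuous_on_product_coordinates]) auto
  then show ?case using insert by simp
qed

text \<open>Off the boundary of the simplex, \<open>damp\<close> switches the homotopy off before \<open>push\<close>, which moves
  points radially away from the barycentre, stops taking values in the boundary.\<close>

definition min_coord :: "nat \<Rightarrow> (nat \<Rightarrow> real) \<Rightarrow> real" where
  "min_coord m x = Min (x ` {..m})"

definition damp :: "nat \<Rightarrow> (nat \<Rightarrow> real) \<Rightarrow> real" where
  "damp m x = max 0 (1 - 2 * (real m + 1) * min_coord m x)"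

definition push :: "nat \<Rightarrow> (nat \<Rightarrow> real) \<Rightarrow> nat \<Rightarrow> real" where
  "push m x = (let s = min (min_coord m x) (1 / (2 * (real m + 1)))
     in (\<lambda>i. if i \<le> m then (x i - s) / (1 - (real m + 1) * s) else 0))"

lemma min_coord_props:
  assumes "x \<in> standard_simplex m"
  shows "0 \<le> min_coord m x" "i \<le> m \<Longrightarrow> min_coord m x \<le> x i" "\<exists>i\<le>m. x i = min_coord m x"
    "(\<exists>i\<le>m. x i = 0) \<Longrightarrow> min_coord m x = 0"
proof -
  have pos: "0 \<le> x i" for i using assms by (simp add: standard_simplex_def)
  show "0 \<le> min_coord m x" using pos by (auto simp: min_coord_def)
  show le: "min_coord m x \<le> x i" if "i \<le> m" for i using that by (auto simp: min_coord_def intro: Min_le)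
  have "min_coord m x \<in> x ` {..m}" unfolding min_coord_def by (rule Min_in) auto
  then show "\<exists>i\<le>m. x i = min_coord m x" by auto
  show "min_coord m x = 0" if "\<exists>i\<le>m. x i = 0" using that le \<open>0 \<le> min_coord m x\<close> by force
qed

lemma continuous_on_min_coord: "continuous_on S (min_coord m)"
  unfolding min_coord_def by (rule continuous_on_Min_coordinates) auto

lemma continuous_on_damp: "continuous_on S (damp m)"
  unfolding damp_def by (intro continuous_intros continuous_on_min_coord)

lemma damp_range:
  assumes "x \<in> standard_simplex m"
  shows "damp m x \<in> {0..1}"
  using min_coord_props(1)[OF assms] by (simp add: damp_def)

text \<open>The cap keeps the denominator of \<open>push\<close> at least 1/2. At the barycentre the
  smallest coordinate is \<open>1 / (real m + 1)\<close>, and the denominator would vanish without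
  it.\<close>

lemma push_denominator_pos:
  fixes a c :: real
  assumes "c > 0"
  shows "1 - c * min a (1 / (2 * c)) > 0"
proof -
  have "c * min a (1 / (2 * c)) \<le> c * (1 / (2 * c))" using assms by (intro mult_left_mono) auto
  also have "\<dots> = 1 / 2" using assms by simp
  finally show ?thesis by linarith
qed

lemma continuous_on_push: "continuous_on S (push m)"
proof (rule continuous_on_coordinatewise_then_product)
  fix i
  let ?s = "\<lambda>x. min (min_coord m x) (1 / (2 * (real m + 1)))"
  have s: "continuous_on S ?s"
    by (intro continuous_intros continuous_on_min_coord) auto
  have "1 - (real m + 1) * ?s x \<noteq> 0" for x
    using push_denominator_pos[of "real m + 1" "min_coord m x"] by linarith
  then have "continuous_on S (\<lambda>x. (x i - ?s x) / (1 - (real m + 1) * ?s x))"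
    by (intro continuous_intros s continuous_on_subset[OF continuous_on_product_coordinates]) auto
  then show "continuous_on S (\<lambda>x. push m x i)"
    by (cases "i \<le> m") (auto simp: push_def Let_def)
qed

lemma push_in_simplex:
  assumes x: "x \<in> standard_simplex m"
  shows "push m x \<in> standard_simplex m"
proof -
  define s where "s = min (min_coord m x) (1 / (2 * (real m + 1)))"
  have d: "1 - (real m + 1) * s > 0"
    unfolding s_def by (rule push_denominator_pos) simp
  have push: "push m x i = (if i \<le> m then (x i - s) / (1 - (real m + 1) * s) else 0)" for i
    by (simp add: push_def Let_def s_def)
  have pos: "0 \<le> push m x i" for i
    using min_coord_props(2)[OF x, of i] d by (auto simp: push s_def)
  have "(\<Sum>i\<le>m. push m x i) = (\<Sum>i\<le>m. x i - s) / (1 - (real m + 1) * s)"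
    by (simp add: push sum_divide_distrib)
  also have "(\<Sum>i\<le>m. x i - s) = 1 - (real m + 1) * s"
    using x by (simp add: sum_subtractf standard_simplex_def algebra_simps)
  finally have sum: "(\<Sum>i\<le>m. push m x i) = 1" using d by simp
  have "push m x i \<le> 1" for i
  proof (cases "i \<le> m")
    case True
    then have "push m x i \<le> (\<Sum>i\<le>m. push m x i)" using pos by (intro member_le_sum) auto
    then show ?thesis using sum by simp
  qed (simp add: push)
  then show ?thesis using pos sum by (simp add: standard_simplex_def push)
qed

text \<open>\<open>damp\<close> is nonzero only where the smallest coordinate is below the cap in
  \<open>push\<close>; there that coordinate itself is subtracted and becomes 0.\<close>

lemma push_boundary:
  assumes x: "x \<in> standard_simplex m" and "damp m x \<noteq> 0"
  shows "\<exists>i\<le>m. push m x i = 0"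
proof -
  have "min_coord m x < 1 / (2 * (real m + 1))"
    using assms(2) by (simp add: damp_def max_def pos_less_divide_eq algebra_simps split: if_splits)
  moreover obtain i where "i \<le> m" "x i = min_coord m x" using min_coord_props(3)[OF x] by blast
  ultimately show ?thesis by (intro exI[of _ i]) (simp add: push_def Let_def)
qed

lemma boundary_damp_push:
  assumes x: "x \<in> standard_simplex m" and "\<exists>i\<le>m. x i = 0"
  shows "damp m x = 1" "push m x = x"
proof -
  have 0: "min_coord m x = 0" by (rule min_coord_props(4)[OF assms])
  then show "damp m x = 1" by (simp add: damp_def)
  show "push m x = x"
  proof
    fix i
    show "push m x i = x i" using x 0 by (auto simp: push_def Let_def standard_simplex_def)
  qed
qed

section \<open>Cosets\<close>

lemma (in group) l_coset_eq_iff: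
  assumes H: "subgroup H G" and g: "g \<in> carrier G" "g' \<in> carrier G"
  shows "g <# H = g' <# H \<longleftrightarrow> inv g \<otimes> g' \<in> H"
proof
  assume eq: "g <# H = g' <# H"
  have "g' \<in> g' <# H" using subgroup.one_closed[OF H] g(2) by (force simp: l_coset_def)
  then obtain h where h: "h \<in> H" "g' = g \<otimes> h" using eq by (auto simp: l_coset_def)
  moreover have "h \<in> carrier G" using h(1) subgroup.mem_carrier[OF H] by blast
  ultimately show "inv g \<otimes> g' \<in> H" using g by (simp add: m_assoc[symmetric])
next
  assume h: "inv g \<otimes> g' \<in> H"
  have HG: "H \<subseteq> carrier G" using subgroup.subset[OF H] .
  have "g' <# H = (g \<otimes> (inv g \<otimes> g')) <# H" using g by (simp add: m_assoc[symmetric])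
  also have "\<dots> = g <# ((inv g \<otimes> g') <# H)" using lcos_m_assoc[OF HG g(1), of "inv g \<otimes> g'"] g by simp
  also have "(inv g \<otimes> g') <# H = H" using coset_join3[OF _ H h] g by simp
  finally show "g <# H = g' <# H" ..
qed

section \<open>Extending from the horn to the cylinder\<close>

theorem theorem3p8:
  fixes G :: "('g, 'b) monoid_scheme"
    and act :: "'g \<Rightarrow> 'm \<Rightarrow> 'm"
    and M :: "'m topology"
    and d n :: nat
    and Hs :: "'g set list"
    and f :: "real \<times> (nat \<Rightarrow> real) \<times> ('g set \<times> (nat \<Rightarrow> real)) \<Rightarrow> 'm"
  assumes "group G"
    and "finite (carrier G)"
    and "smooth_G_manifold G act d M"
    and "Hs \<noteq> []"
    and "\<forall>H \<in> set Hs. subgroup H G"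
    and "sorted_wrt (\<subset>) Hs"
    and "isovariant_map G (subtopology (cyl G n Hs) (horn G n Hs)) (cyl_act G) M act f"
  shows "\<exists>F. isovariant_map G (cyl G n Hs) (cyl_act G) M act F \<and>
             (\<forall>p \<in> horn G n Hs. F p = f p)"
proof -
  interpret group G by (rule assms(1))
  interpret action: group_action G "topspace M" act using assms(3) by (simp add: smooth_G_manifold_def)
  note fin = assms(2)
  define m where "m = length Hs - 1"
  have lenm: "length Hs = Suc m" using assms(4) by (simp add: m_def)
  let ?\<Delta> = "standard_simplex m" and ?I = "{0..1::real}" and ?D = "disc n" and ?L = "linking_simplex G Hs"
  let ?lab = "fix_label (carrier G) act"
  let ?one = "\<one>\<^bsub>G\<^esub>"
  define P where "P = prod_topology (discrete_topology (carrier G)) (top_of_set ?\<Delta>)"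
  define K where "K = ?D \<times> ?\<Delta>"
  have L: "?L = quotient_topology P (link_quot G Hs)"
    by (simp add: linking_simplex_def P_def m_def euclidean_product_topology)
  have topP: "topspace P = carrier G \<times> ?\<Delta>" by (simp add: P_def)
  \<comment> \<open>\<open>Hx x\<close> is the subgroup governing the fibre over \<open>x\<close>:
    the class of the pair of the unit and \<open>x\<close> is \<open>(Hx x, x)\<close>, and its
    stabilizer is \<open>Hx x\<close>.\<close>
  define Hx where "Hx = (\<lambda>x. Hs ! link_index m x)"
  have idx: "link_index m x \<le> m" for x using link_index_ge_iff[of "link_index m x" m x] by simp
  have sub: "subgroup (Hs ! k) G" if "k \<le> m" for k using assms(5) that lenm by simp
  have Hsub: "subgroup (Hx x) G" for x unfolding Hx_def by (rule sub[OF idx])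
  have HG: "Hx x \<subseteq> carrier G" for x using subgroup.subset[OF Hsub] .
  have chain: "Hs ! i \<subseteq> Hs ! j" if "i \<le> j" "j \<le> m" for i j
    using sorted_wrt_nth_less[OF assms(6), of i j] that lenm by (cases "i = j") auto
  have q: "link_quot G Hs (g, x) = (g <#\<^bsub>G\<^esub> Hx x, x)" for g x
    by (simp add: link_quot_def Hx_def m_def)
  have topL: "topspace ?L = {(g <#\<^bsub>G\<^esub> Hx x, x) | g x. g \<in> carrier G \<and> x \<in> ?\<Delta>}"
    unfolding L topspace_quotient_topology topP by (auto simp: q image_iff)
  have cosetL: "(g <#\<^bsub>G\<^esub> Hx x, x) \<in> topspace ?L" if "g \<in> carrier G" "x \<in> ?\<Delta>" for g x
    using that topL by blast
  have DE: "subtopology (Euclidean_space n) ?D = top_of_set ?D"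
    unfolding Euclidean_space_eq_top_of_set subtopology_subtopology
    by (rule arg_cong[of _ _ top_of_set]) (auto simp: disc_def)
  have cyl: "cyl G n Hs = prod_topology (top_of_set ?I) (prod_topology (top_of_set ?D) ?L)"
    by (simp add: cyl_def DE)
  have topcyl: "topspace (cyl G n Hs) = ?I \<times> ?D \<times> topspace ?L" by (simp add: cyl)
  have horn: "(t, v, C, x) \<in> horn G n Hs \<longleftrightarrow>
      (t, v, C, x) \<in> topspace (cyl G n Hs) \<and> ((\<exists>i\<le>m. x i = 0) \<or> t = 0)" for t v C x
    unfolding horn_def link_boundary_def topcyl by (auto simp: m_def)
  have hornsub: "horn G n Hs \<subseteq> topspace (cyl G n Hs)" unfolding horn_def by auto
  let ?J = "subtopology (cyl G n Hs) (horn G n Hs)"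
  have topJ: "topspace ?J = horn G n Hs" using hornsub by auto
  have fc: "continuous_map ?J M f"
    and feq: "\<And>g p. g \<in> carrier G \<Longrightarrow> p \<in> horn G n Hs \<Longrightarrow> f (cyl_act G g p) = act g (f p)"
    and fiso: "\<And>p. p \<in> horn G n Hs \<Longrightarrow> {g \<in> carrier G. cyl_act G g p = p} = ?lab (f p)"
    using assms(7) unfolding isovariant_map_def topJ fix_label_def by blast+
  have cact: "cyl_act G g (t, v, C, x) = (t, v, g <#\<^bsub>G\<^esub> C, x)" for g t v C x
    by (simp add: cyl_act_def link_act_def)
  have one_coset: "?one <#\<^bsub>G\<^esub> Hx x = Hx x" for x by (rule lcos_mult_one[OF HG])
  have assoc: "g <#\<^bsub>G\<^esub> (h <#\<^bsub>G\<^esub> Hx x) = (g \<otimes>\<^bsub>G\<^esub> h) <#\<^bsub>G\<^esub> Hx x" if "g \<in> carrier G" "h \<in> carrier G" for g h x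
    by (rule lcos_m_assoc[OF HG that])
  have flab: "?lab (f (t, v, Hx x, x)) = Hx x" if p: "(t, v, Hx x, x) \<in> horn G n Hs" for t v x
  proof -
    have "g <#\<^bsub>G\<^esub> Hx x = Hx x \<longleftrightarrow> g \<in> Hx x" if g: "g \<in> carrier G" for g
      using l_coset_eq_iff[OF Hsub one_closed g, of x] one_coset[of x] g by auto
    then have "{g \<in> carrier G. cyl_act G g (t, v, Hx x, x) = (t, v, Hx x, x)} = Hx x"
      using HG[of x] by (auto simp: cact)
    then show ?thesis using fiso[OF p] by simp
  qed

  \<comment> \<open>\<open>Hx\<close> jumps between faces, but the section is the quotient map
    restricted to the slice over the unit, hence continuous.\<close>
  have sec: "continuous_map (top_of_set ?\<Delta>) ?L (\<lambda>x. (Hx x, x))"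
  proof -
    have "continuous_map (top_of_set ?\<Delta>) P (\<lambda>x. (?one, x))"
      unfolding P_def by (intro continuous_map_pairedI) auto
    from continuous_map_compose[OF this continuous_map_into_quotient_topology[of P "link_quot G Hs"]]
    show ?thesis unfolding L[symmetric] by (simp add: o_def q one_coset)
  qed
  have into_cyl: "continuous_map (top_of_set (?I \<times> K)) (cyl G n Hs)
      (\<lambda>p. (\<tau> p, fst (snd p), Hx (\<rho> (snd (snd p))), \<rho> (snd (snd p))))"
    if \<tau>: "continuous_on (?I \<times> K) \<tau>" "\<And>p. p \<in> ?I \<times> K \<Longrightarrow> \<tau> p \<in> ?I"
      and \<rho>: "continuous_on ?\<Delta> \<rho>" "\<And>x. x \<in> ?\<Delta> \<Longrightarrow> \<rho> x \<in> ?\<Delta>" for \<tau> \<rho>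
    unfolding cyl
  proof (intro continuous_map_pairedI)
    show "continuous_map (top_of_set (?I \<times> K)) (top_of_set ?I) \<tau>" using \<tau> by auto
    have "continuous_on (?I \<times> K) (\<lambda>p. fst (snd p))"
      by (intro continuous_on_fst continuous_on_snd continuous_on_id)
    then show "continuous_map (top_of_set (?I \<times> K)) (top_of_set ?D) (\<lambda>p. fst (snd p))"
      by (auto simp: K_def)
    have "continuous_on (?I \<times> K) (\<lambda>p. snd (snd p))"
      by (intro continuous_on_snd continuous_on_id)
    then have "continuous_on (?I \<times> K) (\<lambda>p. \<rho> (snd (snd p)))"
      by (rule continuous_on_compose2[OF \<rho>(1)]) (auto simp: K_def)
    then have "continuous_map (top_of_set (?I \<times> K)) (top_of_set ?\<Delta>) (\<lambda>p. \<rho> (snd (snd p)))"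
      using \<rho>(2) by (auto simp: K_def)
    from continuous_map_compose[OF this sec]
    show "continuous_map (top_of_set (?I \<times> K)) ?L (\<lambda>p. (Hx (\<rho> (snd (snd p))), \<rho> (snd (snd p))))"
      by (simp add: o_def)
  qed

  \<comment> \<open>The path follows \<open>f\<close> over the pushed point at damped speed. It
    stays in the horn: either the pushed point lies on the boundary, or the damping keeps the time
    at 0. Its constant label \<open>Hx (push m x)\<close> may be larger than the label
    \<open>Hx x\<close> of \<open>u\<close>.\<close>
  define h where "h = (\<lambda>(t, v, x). f (damp m x * t, v, Hx (push m x), push m x))"
  define u where "u = (\<lambda>(v, x). f (0, v, Hx x, x))"
  have HxL: "(Hx x, x) \<in> topspace ?L" if "x \<in> ?\<Delta>" for x using cosetL[OF one_closed that] one_coset by simp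
  have dt: "damp m x * t \<in> ?I" if "x \<in> ?\<Delta>" "t \<in> ?I" for x t
    using damp_range[OF that(1)] that(2) by (auto simp: mult_le_one)
  have hhorn: "(damp m x * t, v, Hx (push m x), push m x) \<in> horn G n Hs" if "t \<in> ?I" "v \<in> ?D" "x \<in> ?\<Delta>" for t v x
    unfolding horn topcyl using dt[OF that(3,1)] that HxL[OF push_in_simplex[OF that(3)]] push_boundary[OF that(3)]
    by (cases "damp m x = 0") auto
  have uhorn: "(0, v, Hx x, x) \<in> horn G n Hs" if "v \<in> ?D" "x \<in> ?\<Delta>" for v x
    unfolding horn topcyl using that HxL by auto
  have hc: "continuous_map (top_of_set (?I \<times> K)) M h"
  proof -
    have "continuous_on (?I \<times> K) (\<lambda>p. damp m (snd (snd p)) * fst p)"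
      by (intro continuous_intros continuous_on_compose2[OF continuous_on_damp[of UNIV m]]) auto
    then have "continuous_map (top_of_set (?I \<times> K)) (cyl G n Hs)
        (\<lambda>p. (damp m (snd (snd p)) * fst p, fst (snd p), Hx (push m (snd (snd p))), push m (snd (snd p))))"
    proof (rule into_cyl[OF _ _ continuous_on_push push_in_simplex])
      show "damp m (snd (snd p)) * fst p \<in> ?I" if "p \<in> ?I \<times> K" for p
        using that dt by (auto simp: K_def)
    qed
    then have "continuous_map (top_of_set (?I \<times> K)) ?J
        (\<lambda>p. (damp m (snd (snd p)) * fst p, fst (snd p), Hx (push m (snd (snd p))), push m (snd (snd p))))"
      unfolding continuous_map_in_subtopology using hhorn by (auto simp: K_def)
    from continuous_map_compose[OF this fc] show ?thesis
      by (rule continuous_map_cong_on) (auto simp: h_def)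
  qed
  have uc: "continuous_map (top_of_set K) M u"
  proof -
    have "continuous_map (top_of_set (?I \<times> K)) (cyl G n Hs)
        (\<lambda>p. (0, fst (snd p), Hx (snd (snd p)), snd (snd p)))"
      using into_cyl[of "\<lambda>_. 0" "\<lambda>x. x"] by auto
    then have "continuous_map (top_of_set (?I \<times> K)) ?J
        (\<lambda>p. (0, fst (snd p), Hx (snd (snd p)), snd (snd p)))"
      unfolding continuous_map_in_subtopology using uhorn by (auto simp: K_def)
    from continuous_map_compose[OF this fc]
    have "continuous_map (top_of_set (?I \<times> K)) M (\<lambda>p. u (snd p))"
      by (rule continuous_map_cong_on) (auto simp: u_def)
    moreover have "continuous_on K (\<lambda>y. (0::real, y))"
      by (intro continuous_on_Pair continuous_on_const continuous_on_id)
    ultimately have "continuous_map (top_of_set K) M (\<lambda>y. u (snd (0::real, y)))"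
      by (rule continuous_map_reparam) simp
    then show ?thesis by simp
  qed
  have "iso_homotopy K M ?lab h"
  proof (rule iso_homotopyI[OF hc])
    fix y and t :: real assume "y \<in> K" "t \<in> ?I"
    then obtain v x where y: "y = (v, x)" "v \<in> ?D" "x \<in> ?\<Delta>" by (auto simp: K_def)
    show "?lab (h (t, y)) = ?lab (h (0, y))"
      using flab[OF hhorn[OF \<open>t \<in> ?I\<close> y(2,3)]] flab[OF hhorn[OF _ y(2,3), of 0]] by (simp add: h_def y(1))
  qed
  then obtain H where H: "transports K M ?lab h u H"
    using smooth_G_manifold_has_transport[OF assms(1,2,3), where 'k = "(nat \<Rightarrow> real) \<times> (nat \<Rightarrow> real)"] uc
    unfolding has_transport_def by blast
  have Hc: "continuous_map (top_of_set (?I \<times> K)) M H"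
    and H0: "\<And>y. y \<in> K \<Longrightarrow> H (0, y) = u y"
    and Hl: "\<And>y t. y \<in> K \<Longrightarrow> t \<in> ?I \<Longrightarrow> ?lab (H (t, y)) = ?lab (u y)"
    and Hh: "\<And>y t. y \<in> K \<Longrightarrow> u y = h (0, y) \<Longrightarrow> t \<in> ?I \<Longrightarrow> H (t, y) = h (t, y)"
    using H unfolding transports_def by blast+
  have HM: "H (t, v, x) \<in> topspace M" if "t \<in> ?I" "v \<in> ?D" "x \<in> ?\<Delta>" for t v x
    using continuous_map_funspace[OF Hc] that by (auto simp: K_def)
  have Hlab: "?lab (H (t, v, x)) = Hx x" if "t \<in> ?I" "v \<in> ?D" "x \<in> ?\<Delta>" for t v x
    using Hl[of "(v, x)" t] flab[OF uhorn[OF that(2,3)]] that by (simp add: K_def u_def)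
  have Hf: "H (t, v, x) = f (t, v, Hx x, x)"
    if tvx: "t \<in> ?I" "v \<in> ?D" "x \<in> ?\<Delta>" and b: "(\<exists>i\<le>m. x i = 0) \<or> t = 0" for t v x
  proof (cases "t = 0")
    case True
    then show ?thesis using H0[of "(v, x)"] tvx by (simp add: K_def u_def)
  next
    case False
    \<comment> \<open>On the boundary \<open>damp\<close> is 1 and \<open>push\<close> is the
      identity, so the point starts its path and the path is \<open>f\<close> itself.\<close>
    then have bd: "\<exists>i\<le>m. x i = 0" using b by blast
    note dp = boundary_damp_push[OF tvx(3) bd]
    have "u (v, x) = h (0, v, x)" by (simp add: u_def h_def dp)
    then show ?thesis using Hh[of "(v, x)" t] tvx by (simp add: K_def h_def dp)
  qed

  have actmult: "act (g \<otimes>\<^bsub>G\<^esub> h) z = act g (act h z)" if "g \<in> carrier G" "h \<in> carrier G" "z \<in> topspace M" for g h z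
    using action.composition_rule that by blast
  have actM: "act g z \<in> topspace M" if "g \<in> carrier G" "z \<in> topspace M" for g z
    using action.element_image that by blast
  have act_eq_iff: "act g z = act g' z \<longleftrightarrow> inv\<^bsub>G\<^esub> g \<otimes>\<^bsub>G\<^esub> g' \<in> ?lab z"
    if g: "g \<in> carrier G" "g' \<in> carrier G" and z: "z \<in> topspace M" for g g' z
  proof -
    have "act (inv\<^bsub>G\<^esub> g \<otimes>\<^bsub>G\<^esub> g') z = act (inv\<^bsub>G\<^esub> g) (act g' z)" using actmult g z by simp
    moreover have "act (inv\<^bsub>G\<^esub> g) (act g z) = z" using action.orbit_sym_aux[OF g(1) z refl] .
    moreover have "act g (act (inv\<^bsub>G\<^esub> g) (act g' z)) = act g' z"
      using action.orbit_sym_aux[of "inv\<^bsub>G\<^esub> g" "act g' z"] g actM[OF g(2) z] by simp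
    ultimately show ?thesis using g by (auto simp: fix_label_def)
  qed
  \<comment> \<open>The value is independent of the chosen representative because
    \<open>H (t, v, x)\<close> has stabilizer exactly \<open>Hx x\<close>.\<close>
  define F where "F = (\<lambda>(t, v, C, x). act (SOME g. g \<in> carrier G \<and> C = g <#\<^bsub>G\<^esub> Hx x) (H (t, v, x)))"
  have F: "F (t, v, g <#\<^bsub>G\<^esub> Hx x, x) = act g (H (t, v, x))"
    if g: "g \<in> carrier G" and tvx: "t \<in> ?I" "v \<in> ?D" "x \<in> ?\<Delta>" for t v g x
  proof -
    let ?g = "SOME g'. g' \<in> carrier G \<and> g <#\<^bsub>G\<^esub> Hx x = g' <#\<^bsub>G\<^esub> Hx x"
    have g': "?g \<in> carrier G \<and> g <#\<^bsub>G\<^esub> Hx x = ?g <#\<^bsub>G\<^esub> Hx x" by (rule someI[of _ g]) (use g in simp)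
    then have "inv\<^bsub>G\<^esub> g \<otimes>\<^bsub>G\<^esub> ?g \<in> Hx x" using l_coset_eq_iff[OF Hsub g] by blast
    then have "act g (H (t, v, x)) = act ?g (H (t, v, x))"
      using act_eq_iff[OF g conjunct1[OF g'] HM[OF tvx]] Hlab[OF tvx] by blast
    then show ?thesis by (simp add: F_def)
  qed
  have elem: "\<exists>t v g x. p = (t, v, g <#\<^bsub>G\<^esub> Hx x, x) \<and> t \<in> ?I \<and> v \<in> ?D \<and> g \<in> carrier G \<and> x \<in> ?\<Delta>"
    if "p \<in> topspace (cyl G n Hs)" for p
    using that unfolding topcyl topL by auto

  have sndc: "continuous_map ?L (top_of_set ?\<Delta>) snd"
    unfolding L
  proof (rule continuous_map_from_quotient_topology)
    have "snd \<circ> link_quot G Hs = snd" by (auto simp: fun_eq_iff q)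
    then show "continuous_map P (top_of_set ?\<Delta>) (snd \<circ> link_quot G Hs)"
      unfolding P_def by (simp add: continuous_map_snd)
  qed
  \<comment> \<open>\<open>T g\<close> is the translate by \<open>g\<close> of the section. These
    finitely many closed sets cover the linking simplex, and over each of them \<open>F\<close> is
    \<open>H\<close> followed by the action of \<open>g\<close>.\<close>
  define T where "T = (\<lambda>g. {(g <#\<^bsub>G\<^esub> Hx x, x) | x. x \<in> ?\<Delta>})"
  have Tclosed: "closedin ?L (T g)" if g: "g \<in> carrier G" for g
    unfolding L
  proof (rule closedin_quotient_topology)
    show "T g \<subseteq> link_quot G Hs ` topspace P"
      using topL g unfolding L topspace_quotient_topology T_def by blast
    have cl: "closedin (top_of_set ?\<Delta>) {x \<in> ?\<Delta>. c \<in> Hx x}" for c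
    proof -
      have cl1: "closedin (top_of_set ?\<Delta>) {x \<in> ?\<Delta>. k \<le> link_index m x}" for k
      proof (cases "k \<le> m")
        case True
        have "closed {x :: nat \<Rightarrow> real. \<forall>i. m - k < i \<and> i \<le> m \<longrightarrow> x i = 0}"
          by (intro closed_Collect_all closed_Collect_imp closed_Collect_eq continuous_on_product_coordinates
              continuous_on_const) auto
        from closedin_closed_Int[OF this, of ?\<Delta>] show ?thesis
          using True by (simp add: link_index_ge_iff Int_def)
      qed (simp add: link_index_ge_iff)
      \<comment> \<open>Because the chain increases, \<open>c\<close> lies in \<open>Hx x\<close> as
        soon as it lies in some \<open>Hs ! k\<close> with \<open>k\<close> at most the index; this
        exhibits the set as a finite union of closed faces.\<close>
      have "{x \<in> ?\<Delta>. c \<in> Hx x} = (\<Union>k\<in>{k. k \<le> m \<and> c \<in> Hs ! k}. {x \<in> ?\<Delta>. k \<le> link_index m x})"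
        using idx chain unfolding Hx_def by blast
      then show ?thesis using cl1 by (auto intro!: closedin_Union)
    qed
    have eq: "{y \<in> topspace P. link_quot G Hs y \<in> T g} =
        (\<Union>g'\<in>carrier G. {g'} \<times> {x \<in> ?\<Delta>. inv\<^bsub>G\<^esub> g \<otimes>\<^bsub>G\<^esub> g' \<in> Hx x})"
    proof -
      have "link_quot G Hs (g', x) \<in> T g \<longleftrightarrow> inv\<^bsub>G\<^esub> g \<otimes>\<^bsub>G\<^esub> g' \<in> Hx x"
        if "g' \<in> carrier G" "x \<in> ?\<Delta>" for g' x
        using l_coset_eq_iff[OF Hsub g that(1), of x] that(2) by (auto simp: T_def q)
      then show ?thesis unfolding topP by auto
    qed
    have "closedin P ({g'} \<times> {x \<in> ?\<Delta>. inv\<^bsub>G\<^esub> g \<otimes>\<^bsub>G\<^esub> g' \<in> Hx x})" if "g' \<in> carrier G" for g'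
      unfolding P_def closedin_prod_Times_iff using cl that by auto
    then show "closedin P {y \<in> topspace P. link_quot G Hs y \<in> T g}"
      unfolding eq using fin by (intro closedin_Union) auto
  qed
  have Fc: "continuous_map (cyl G n Hs) M F"
  proof (rule pasting_lemma_closed[OF fin, where T = "\<lambda>g. {p \<in> topspace (cyl G n Hs). snd (snd p) \<in> T g}"
        and f = "\<lambda>g p. act g (H (fst p, fst (snd p), snd (snd (snd p))))"])
    fix g assume g: "g \<in> carrier G"
    have "continuous_map (cyl G n Hs) ?L (\<lambda>p. snd (snd p))"
      unfolding cyl using continuous_map_compose[OF continuous_map_snd continuous_map_snd] by (simp add: o_def)
    from closedin_continuous_map_preimage[OF this Tclosed[OF g]]
    show "closedin (cyl G n Hs) {p \<in> topspace (cyl G n Hs). snd (snd p) \<in> T g}" .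
    have "continuous_map (cyl G n Hs) (prod_topology (top_of_set ?I) (prod_topology (top_of_set ?D) (top_of_set ?\<Delta>)))
        (\<lambda>p. (fst p, fst (snd p), snd (snd (snd p))))"
      unfolding cyl
    proof (intro continuous_map_pairedI)
      show "continuous_map (prod_topology (top_of_set ?I) (prod_topology (top_of_set ?D) ?L)) (top_of_set ?I) fst"
        by (rule continuous_map_fst)
      show "continuous_map (prod_topology (top_of_set ?I) (prod_topology (top_of_set ?D) ?L)) (top_of_set ?D) (\<lambda>p. fst (snd p))"
        using continuous_map_compose[OF continuous_map_snd continuous_map_fst] by (simp add: o_def)
      show "continuous_map (prod_topology (top_of_set ?I) (prod_topology (top_of_set ?D) ?L)) (top_of_set ?\<Delta>) (\<lambda>p. snd (snd (snd p)))"
        using continuous_map_compose[OF continuous_map_compose[OF continuous_map_snd continuous_map_snd] sndc]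
        by (simp add: o_def)
    qed
    then have "continuous_map (cyl G n Hs) (top_of_set (?I \<times> K)) (\<lambda>p. (fst p, fst (snd p), snd (snd (snd p))))"
      by (simp add: K_def)
    from continuous_map_compose[OF continuous_map_compose[OF this Hc], of M "act g"]
    have "continuous_map (cyl G n Hs) M (\<lambda>p. act g (H (fst p, fst (snd p), snd (snd (snd p)))))"
      using assms(3) g by (simp add: o_def smooth_G_manifold_def)
    then show "continuous_map (subtopology (cyl G n Hs) {p \<in> topspace (cyl G n Hs). snd (snd p) \<in> T g}) M
        (\<lambda>p. act g (H (fst p, fst (snd p), snd (snd (snd p)))))"
      by (rule continuous_map_from_subtopology)
  next
    have pt: "act g (H (fst p, fst (snd p), snd (snd (snd p)))) = F p"
      if "g \<in> carrier G" "p \<in> topspace (cyl G n Hs)" "snd (snd p) \<in> T g" for g p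
      using elem[OF that(2)] that(3) F[OF that(1)] by (auto simp: T_def)
    show "act g (H (fst p, fst (snd p), snd (snd (snd p)))) = act g' (H (fst p, fst (snd p), snd (snd (snd p))))"
      if "g \<in> carrier G" "g' \<in> carrier G" "p \<in> topspace (cyl G n Hs) \<inter>
        {p \<in> topspace (cyl G n Hs). snd (snd p) \<in> T g} \<inter> {p \<in> topspace (cyl G n Hs). snd (snd p) \<in> T g'}" for g g' p
      using pt[of g p] pt[of g' p] that by simp
    show "\<exists>g. g \<in> carrier G \<and> p \<in> {p \<in> topspace (cyl G n Hs). snd (snd p) \<in> T g} \<and>
        F p = act g (H (fst p, fst (snd p), snd (snd (snd p))))" if p: "p \<in> topspace (cyl G n Hs)" for p
    proof -
      obtain t v g x where e: "p = (t, v, g <#\<^bsub>G\<^esub> Hx x, x)" "g \<in> carrier G" "x \<in> ?\<Delta>" using elem[OF p] by blast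
      then have "snd (snd p) \<in> T g" by (auto simp: T_def)
      then show ?thesis using pt[OF e(2) p] e(2) p by auto
    qed
  qed
  have "isovariant_map G (cyl G n Hs) (cyl_act G) M act F"
    unfolding isovariant_map_def
  proof (intro conjI ballI Fc)
    fix g p assume g: "g \<in> carrier G" and "p \<in> topspace (cyl G n Hs)"
    then obtain t v g' x where p: "p = (t, v, g' <#\<^bsub>G\<^esub> Hx x, x)" "t \<in> ?I" "v \<in> ?D" "g' \<in> carrier G" "x \<in> ?\<Delta>"
      using elem by blast
    show "F (cyl_act G g p) = act g (F p)"
      using F[OF m_closed[OF g p(4)] p(2,3,5)] F[OF p(4) p(2,3,5)] actmult[OF g p(4) HM[OF p(2,3,5)]]
      by (simp add: p(1) cact assoc[OF g p(4)])
  next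
    fix p assume "p \<in> topspace (cyl G n Hs)"
    then obtain t v g' x where p: "p = (t, v, g' <#\<^bsub>G\<^esub> Hx x, x)" "t \<in> ?I" "v \<in> ?D" "g' \<in> carrier G" "x \<in> ?\<Delta>"
      using elem by blast
    \<comment> \<open>Both stabilizers are the conjugate of \<open>Hx x\<close> by
      \<open>g'\<close>: on the left that of a coset, on the right that of a translate of
      \<open>H (t, v, x)\<close>.\<close>
    have "cyl_act G g p = p \<longleftrightarrow> act g (F p) = F p" if g: "g \<in> carrier G" for g
    proof -
      have "cyl_act G g p = p \<longleftrightarrow> g' <#\<^bsub>G\<^esub> Hx x = (g \<otimes>\<^bsub>G\<^esub> g') <#\<^bsub>G\<^esub> Hx x"
        by (auto simp: p(1) cact assoc[OF g p(4)])
      also have "\<dots> \<longleftrightarrow> inv\<^bsub>G\<^esub> g' \<otimes>\<^bsub>G\<^esub> (g \<otimes>\<^bsub>G\<^esub> g') \<in> ?lab (H (t, v, x))"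
        unfolding Hlab[OF p(2,3,5)] by (rule l_coset_eq_iff[OF Hsub p(4) m_closed[OF g p(4)]])
      also have "\<dots> \<longleftrightarrow> act g' (H (t, v, x)) = act (g \<otimes>\<^bsub>G\<^esub> g') (H (t, v, x))"
        by (rule act_eq_iff[OF p(4) m_closed[OF g p(4)] HM[OF p(2,3,5)], symmetric])
      also have "\<dots> \<longleftrightarrow> act g (F p) = F p"
        unfolding actmult[OF g p(4) HM[OF p(2,3,5)]] p(1) F[OF p(4) p(2,3,5)] by auto
      finally show ?thesis .
    qed
    then show "{g \<in> carrier G. cyl_act G g p = p} = {g \<in> carrier G. act g (F p) = F p}" by blast
  qed
  moreover have "F p = f p" if p: "p \<in> horn G n Hs" for p
  proof -
    obtain t v g x where e: "p = (t, v, g <#\<^bsub>G\<^esub> Hx x, x)" "t \<in> ?I" "v \<in> ?D" "g \<in> carrier G" "x \<in> ?\<Delta>"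
      using elem p hornsub by blast
    have b: "(\<exists>i\<le>m. x i = 0) \<or> t = 0" using p unfolding e(1) horn by blast
    have base: "(t, v, Hx x, x) \<in> horn G n Hs" unfolding horn topcyl using e b HxL by auto
    have "F p = act g (f (t, v, Hx x, x))" using F[OF e(4) e(2,3,5)] Hf[OF e(2,3,5) b] e(1) by simp
    also have "\<dots> = f p" using feq[OF e(4) base] by (simp add: cact e(1))
    finally show ?thesis .
  qed
  ultimately show ?thesis by blast
qed

end
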